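(* Let $\Omega\subset\mathbb{R}^N$ be a bounded smooth domain and $p_1,p_2\in C_+(\overline{\Omega})$. Let $f:\Omega\times\mathbb{R}\to\mathbb{R}$ be a Carathéodory function satisfying $|f(x,t)|\le C_1+C_2|t|^{\alpha(x)-1}$ for all $(x,t)\in\Omega\times\mathbb{R}$, for some constants $C_1,C_2$ and some $\alpha\in C_+(\overline{\Omega})$ with $\alpha(x)<p_M^*(x)$ for all $x\in\overline\Omega$. Suppose moreover that $$|f(x,t)|\le C_1+C_2|t|^{\beta(x)-1}\quad\text{for all }(x,t)\in\Omega\times\mathbb{R},$$ where $\beta\in C(\overline\Omega)$ satisfies $1\le\beta^+<p_m^-$. Then the problem $$-\mathrm{div}(|\nabla u|^{p_1(x)-2}\nabla u)-\mathrm{div}(|\nabla u|^{p_2(x)-2}\nabla u)=f(x,u)\ \text{in }\Omega,\qquad u=0\ \text{on }\partial\Omega$$ has a weak solution.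
   Context: $C_+(\overline{\Omega})=\{h\in C(\overline{\Omega}):h>1\text{ on }\overline\Omega\}$; for $h\in C(\overline\Omega)$, $h^+=\max_{\overline\Omega}h$, $h^-=\min_{\overline\Omega}h$. $p_M(x)=\max\{p_1(x),p_2(x)\}$, $p_m(x)=\min\{p_1(x),p_2(x)\}$; for $p\in C_+(\overline\Omega)$, $p^*(x)=\frac{Np(x)}{N-p(x)}$ if $p(x)<N$, $p^*(x)=\infty$ if $p(x)\ge N$. $L^{p(x)}(\Omega)$ is the variable exponent Lebesgue space with Luxemburg norm $|u|_{p(x)}=\inf\{\lambda>0:\int_\Omega|u/\lambda|^{p(x)}dx\le1\}$, $W^{1,p(x)}(\Omega)=\{u\in L^{p(x)}:|\nabla u|\in L^{p(x)}\}$ with norm $|u|_{p(x)}+|\nabla u|_{p(x)}$, and $W_0^{1,p(x)}(\Omega)$ is the closure of $C_0^\infty(\Omega)$ in it. $X:=W_0^{1,p_1(x)}(\Omega)\cap W_0^{1,p_2(x)}(\Omega)$. A weak solution is $u\in X$ with $\int_\Omega|\nabla u|^{p_1(x)-2}\nabla u\cdot\nabla v\,dx+\int_\Omega|\nabla u|^{p_2(x)-2}\nabla u\cdot\nabla v\,dx=\int_\Omega f(x,u)v\,dx$ for all $v\in X$. *)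

theory Defs
  imports "HOL-Analysis.Analysis"
begin

coinductive smooth_fun :: "('a::euclidean_space \<Rightarrow> real) \<Rightarrow> bool" where
  "(\<And>x. (f has_derivative f' x) (at x)) \<Longrightarrow> (\<And>v. smooth_fun (\<lambda>x. f' x v)) \<Longrightarrow> smooth_fun f"

definition smooth_bounded_domain :: "'a::euclidean_space set \<Rightarrow> bool" where
  "smooth_bounded_domain \<Omega> \<longleftrightarrow> open \<Omega> \<and> connected \<Omega> \<and> bounded \<Omega> \<and> \<Omega> \<noteq> {} \<and>
     (\<exists>\<phi>. smooth_fun \<phi> \<and> \<Omega> = {x. \<phi> x < 0} \<and>
        (\<forall>x. \<phi> x = 0 \<longrightarrow> frechet_derivative \<phi> (at x) \<noteq> (\<lambda>v. 0)))"

definition test_fun :: "'a::euclidean_space set \<Rightarrow> ('a \<Rightarrow> real) \<Rightarrow> bool" where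
  "test_fun \<Omega> \<phi> \<longleftrightarrow> smooth_fun \<phi> \<and> compact (closure {x. \<phi> x \<noteq> 0})
      \<and> closure {x. \<phi> x \<noteq> 0} \<subseteq> \<Omega>"

definition grad :: "('a::euclidean_space \<Rightarrow> real) \<Rightarrow> 'a \<Rightarrow> 'a" where
  "grad \<phi> x = (\<Sum>i\<in>Basis. frechet_derivative \<phi> (at x) i *\<^sub>R i)"

definition weak_grad :: "'a::euclidean_space set \<Rightarrow> ('a \<Rightarrow> real) \<Rightarrow> ('a \<Rightarrow> 'a) \<Rightarrow> bool" where
  "weak_grad \<Omega> u g \<longleftrightarrow>
     (\<forall>K. compact K \<and> K \<subseteq> \<Omega> \<longrightarrow> set_integrable lebesgue K u \<and> set_integrable lebesgue K g) \<and>
     (\<forall>\<phi>. test_fun \<Omega> \<phi> \<longrightarrow> (\<forall>i\<in>Basis.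
        (LINT x:\<Omega>|lebesgue. u x * (grad \<phi> x \<bullet> i)) = - (LINT x:\<Omega>|lebesgue. (g x \<bullet> i) * \<phi> x)))"

definition modular :: "'a::euclidean_space set \<Rightarrow> ('a \<Rightarrow> real) \<Rightarrow> ('a \<Rightarrow> real) \<Rightarrow> ennreal" where
  "modular \<Omega> p u = (\<integral>\<^sup>+ x\<in>\<Omega>. ennreal (\<bar>u x\<bar> powr p x) \<partial>lebesgue)"

definition Lvar :: "'a::euclidean_space set \<Rightarrow> ('a \<Rightarrow> real) \<Rightarrow> ('a \<Rightarrow> real) \<Rightarrow> bool" where
  "Lvar \<Omega> p u \<longleftrightarrow> u \<in> borel_measurable (restrict_space lebesgue \<Omega>) \<and>
     (\<exists>c>0. modular \<Omega> p (\<lambda>x. u x / c) < \<infinity>)"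

definition lux_norm :: "'a::euclidean_space set \<Rightarrow> ('a \<Rightarrow> real) \<Rightarrow> ('a \<Rightarrow> real) \<Rightarrow> real" where
  "lux_norm \<Omega> p u = Inf {c. c > 0 \<and> modular \<Omega> p (\<lambda>x. u x / c) \<le> 1}"

definition W0 :: "'a::euclidean_space set \<Rightarrow> ('a \<Rightarrow> real) \<Rightarrow> ('a \<Rightarrow> real) \<Rightarrow> ('a \<Rightarrow> 'a) \<Rightarrow> bool" where
  "W0 \<Omega> p u g \<longleftrightarrow> Lvar \<Omega> p u \<and> weak_grad \<Omega> u g \<and> Lvar \<Omega> p (\<lambda>x. norm (g x)) \<and>
     (\<exists>\<phi>s. (\<forall>n. test_fun \<Omega> (\<phi>s n)) \<and>
        (\<lambda>n. lux_norm \<Omega> p (\<lambda>x. \<phi>s n x - u x) + lux_norm \<Omega> p (\<lambda>x. norm (grad (\<phi>s n) x - g x)))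
          \<longlonglongrightarrow> 0)"

definition Cplus :: "'a::euclidean_space set \<Rightarrow> ('a \<Rightarrow> real) \<Rightarrow> bool" where
  "Cplus \<Omega> h \<longleftrightarrow> continuous_on (closure \<Omega>) h \<and> (\<forall>x\<in>closure \<Omega>. h x > 1)"

text \<open>alpha(x) < p^*(x), where p^*(x) = N p/(N-p) if p < N and infinity otherwise.\<close>
definition below_crit :: "('a::euclidean_space \<Rightarrow> real) \<Rightarrow> ('a \<Rightarrow> real) \<Rightarrow> 'a \<Rightarrow> bool" where
  "below_crit a p x \<longleftrightarrow> (p x < real DIM('a) \<longrightarrow> a x < real DIM('a) * p x / (real DIM('a) - p x))"

text \<open>|f(x,t)| <= C1 + C2 |t|^(e(x)-1) for all x in Omega and t, with the convention 0^0 = 1;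
 when t = 0 and e(x) - 1 < 0 the right-hand side is +infinity and there is no constraint.\<close>
definition growth :: "'a::euclidean_space set \<Rightarrow> real \<Rightarrow> real \<Rightarrow> ('a \<Rightarrow> real) \<Rightarrow> ('a \<Rightarrow> real \<Rightarrow> real) \<Rightarrow> bool" where
  "growth \<Omega> C1 C2 e f \<longleftrightarrow> (\<forall>x\<in>\<Omega>. \<forall>t::real.
     (if t = 0 then (e x - 1 = 0 \<longrightarrow> \<bar>f x t\<bar> \<le> C1 + C2) \<and> (e x - 1 > 0 \<longrightarrow> \<bar>f x t\<bar> \<le> C1)
      else \<bar>f x t\<bar> \<le> C1 + C2 * \<bar>t\<bar> powr (e x - 1)))"

definition caratheodory :: "'a::euclidean_space set \<Rightarrow> ('a \<Rightarrow> real \<Rightarrow> real) \<Rightarrow> bool" where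
  "caratheodory \<Omega> f \<longleftrightarrow> (\<forall>t. (\<lambda>x. f x t) \<in> borel_measurable (restrict_space lebesgue \<Omega>)) \<and>
     (AE x in lebesgue. x \<in> \<Omega> \<longrightarrow> continuous_on UNIV (f x))"

definition weak_solution :: "'a::euclidean_space set \<Rightarrow> ('a \<Rightarrow> real) \<Rightarrow> ('a \<Rightarrow> real) \<Rightarrow>
     ('a \<Rightarrow> real \<Rightarrow> real) \<Rightarrow> ('a \<Rightarrow> real) \<Rightarrow> bool" where
  "weak_solution \<Omega> p1 p2 f u \<longleftrightarrow> (\<exists>g. W0 \<Omega> p1 u g \<and> W0 \<Omega> p2 u g \<and>
     (\<forall>v h. W0 \<Omega> p1 v h \<and> W0 \<Omega> p2 v h \<longrightarrow>
        set_integrable lebesgue \<Omega> (\<lambda>x. norm (g x) powr (p1 x - 2) * (g x \<bullet> h x)) \<and>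
        set_integrable lebesgue \<Omega> (\<lambda>x. norm (g x) powr (p2 x - 2) * (g x \<bullet> h x)) \<and>
        set_integrable lebesgue \<Omega> (\<lambda>x. f x (u x) * v x) \<and>
        (LINT x:\<Omega>|lebesgue. norm (g x) powr (p1 x - 2) * (g x \<bullet> h x))
        + (LINT x:\<Omega>|lebesgue. norm (g x) powr (p2 x - 2) * (g x \<bullet> h x))
        = (LINT x:\<Omega>|lebesgue. f x (u x) * v x)))"

end

theory Submission
  imports Defs "HOL-Complex_Analysis.Great_Picard"
begin

text \<open>
  With \<open>q = p\<^sub>m\<^sup>-\<close>, both growth conditions together give \<open>\<bar>f(x,t)\<bar> \<le> C (1 + \<bar>t\<bar>\<^sup>b\<^sup>-\<^sup>1)\<close> for a constant \<open>1 < b < q\<close>, so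
  \<open>J u = \<integral> \<bar>\<nabla>u\<bar>\<^bsup>p1\<^esup>/p1 + \<integral> \<bar>\<nabla>u\<bar>\<^bsup>p2\<^esup>/p2 - \<integral> F(x,u)\<close> is coercive and a solution is obtained by minimising \<open>J\<close>.
  Weak compactness is not needed: by Rellich's theorem a minimising sequence has a subsequence converging in
  \<open>L\<^sup>1\<close>, along which the \<open>F\<close>-term converges; comparing with midpoints, the convexity defect of the gradient
  terms tends to zero, and uniform convexity of \<open>\<bar>\<cdot>\<bar>\<^sup>p\<close> makes the gradients a Cauchy sequence in both modulars.

  Everything about Sobolev functions rests on one estimate for test functions,
  \<open>\<integral> \<bar>\<phi>(x+y) - \<phi>(x)\<bar>\<^sup>s \<le> \<bar>y\<bar>\<^sup>s \<integral> \<bar>\<nabla>\<phi>\<bar>\<^sup>s\<close>. Taking \<open>\<bar>y\<bar>\<close> larger than the diameter of the domain gives the Poincare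
  inequality, and averaging over small balls gives both Rellich's theorem and a small local gain of
  integrability. As \<open>p\<close> is continuous, hence of small oscillation on small balls, the gain yields
  the Poincare inequality for the variable exponent norm, which makes the space complete under gradient convergence.
\<close>

section \<open>Elementary inequalities for powers of norms\<close>

text \<open>The obstacle is that the modular \<open>vmod M p\<close> is not homogeneous, and a
  linear bound of the modular of a function by that of its gradient fails in general. What survives
  is that a bounded gradient modular forces a bounded modular of the function; rescaling then shows
  that small gradients force small functions, which suffices for completeness. Completeness matters
  because the minimising sequence is only known to converge in L1, whereas membership in the space
  asks for approximation in the variable exponent norm. Coercivity and compactness only see the
  constant exponent \<open>q\<close>, for which the Poincare inequality is linear. Both growth
  bounds enter: the one with \<beta> controls large t, while near t = 0 its exponent \<beta>(x) - 1
  may be negative and the one with \<alpha> > 1 takes over. The space is an intersection of two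
  closures whose approximating sequences may differ, so the function spaces are treated for one
  exponent at a time.\<close>

lemma powr_norm_add_le:
  fixes a b :: "'b::real_normed_vector"
  assumes "0 \<le> p" "p \<le> P"
  shows "norm (a + b) powr p \<le> 2 powr P * (norm a powr p + norm b powr p)"
proof -
  have "norm (a + b) \<le> 2 * max (norm a) (norm b)"
    using norm_triangle_ineq[of a b] by linarith
  then have "norm (a + b) powr p \<le> (2 * max (norm a) (norm b)) powr p"
    using assms by (intro powr_mono2) auto
  also have "\<dots> = 2 powr p * max (norm a) (norm b) powr p"
    by (simp add: powr_mult)
  \<comment> \<open>The constant uses the upper bound \<open>P\<close> instead of \<open>p\<close>,
    so that it can be pulled out of an integral over a varying exponent.\<close>
  also have "\<dots> \<le> 2 powr P * (norm a powr p + norm b powr p)"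
    using assms by (intro mult_mono powr_mono) (auto simp: max_def)
  finally show ?thesis .
qed

text \<open>Case split at \<open>s = 1\<close>. Integrated over a finite measure space, this gives
  control of lower exponents by higher ones, up to the total mass.\<close>

lemma powr_exponent_le:
  fixes s :: real
  assumes "0 \<le> s" "0 \<le> p" "p \<le> p'"
  shows "s powr p \<le> 1 + s powr p'"
proof (cases "s \<le> 1")
  case True
  then have "s powr p \<le> 1" using assms by (simp add: powr_le1)
  then show ?thesis by (smt (verit) powr_ge_zero)
next
  case False
  then have "s powr p \<le> s powr p'" using assms by (intro powr_mono) auto
  then show ?thesis by linarith
qed

text \<open>The mean value theorem on both halves of the interval gives slopes
  \<open>p * z1 powr (p - 1)\<close> and \<open>p * z2 powr (p - 1)\<close> with
  \<open>z1 < z2\<close>. Only interior derivatives are used, which admits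
  \<open>s = 0\<close>.\<close>

lemma powr_midpoint_strict_convex:
  fixes s t p :: real
  assumes "1 < p" "0 \<le> s" "s < t"
  shows "((s + t) / 2) powr p < (s powr p + t powr p) / 2"
proof -
  define m where "m = (s + t) / 2"
  have m: "s < m" "m < t" using assms by (auto simp: m_def)
  have D: "\<exists>z. a < z \<and> z < b \<and> b powr p - a powr p = (b - a) * (p * z powr (p - 1))"
    if "0 \<le> a" "a < b" for a b :: real
  proof -
    have "\<exists>l z. a < z \<and> z < b \<and> ((\<lambda>x. x powr p) has_real_derivative l) (at z) \<and> b powr p - a powr p = (b - a) * l"
    proof (rule MVT[OF \<open>a < b\<close>])
      show "continuous_on {a..b} (\<lambda>x. x powr p)"
        using that assms by (intro continuous_on_powr') (auto intro!: continuous_intros)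
    next
      fix x assume "a < x" "x < b"
      then have "((\<lambda>x. x powr p) has_real_derivative p * x powr (p - 1)) (at x)"
        using that by (intro has_real_derivative_powr) auto
      then show "(\<lambda>x. x powr p) differentiable at x"
        using real_differentiable_def by blast
    qed
    then obtain l z where z: "a < z" "z < b" "((\<lambda>x. x powr p) has_real_derivative l) (at z)"
        "b powr p - a powr p = (b - a) * l" by blast
    have "l = p * z powr (p - 1)"
      using DERIV_unique[OF z(3) has_real_derivative_powr] z that by auto
    then show ?thesis using z by blast
  qed
  obtain z1 where z1: "s < z1" "z1 < m" "m powr p - s powr p = (m - s) * (p * z1 powr (p - 1))"
    using D[of s m] assms m by auto
  obtain z2 where z2: "m < z2" "z2 < t" "t powr p - m powr p = (t - m) * (p * z2 powr (p - 1))"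
    using D[of m t] assms m by auto
  have "z1 powr (p - 1) < z2 powr (p - 1)"
    using z1 z2 assms by (intro powr_less_mono2) auto
  then have "(m - s) * (p * z1 powr (p - 1)) < (t - m) * (p * z2 powr (p - 1))"
    using m assms by (intro mult_le_less_imp_less mult_strict_left_mono) (auto simp: m_def field_simps)
  then show ?thesis using z1 z2 by (simp add: m_def)
qed

text \<open>If the norms differ, the triangle inequality reduces the claim to the scalar case; if
  they agree, the parallelogram law makes the midpoint strictly shorter.\<close>

lemma norm_powr_midpoint_strict_convex:
  fixes a b :: "'b::real_inner"
  assumes "1 < p" "a \<noteq> b"
  shows "norm ((1/2) *\<^sub>R (a + b)) powr p < (norm a powr p + norm b powr p) / 2"
proof (cases "norm a = norm b")
  case True
  have "(norm (a + b))\<^sup>2 + (norm (a - b))\<^sup>2 = 2 * (norm a)\<^sup>2 + 2 * (norm b)\<^sup>2"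
    by (simp add: power2_norm_eq_inner inner_add inner_diff inner_commute)
  then have "(norm (a + b))\<^sup>2 < (2 * norm a)\<^sup>2"
    using True assms(2) by (simp add: power2_eq_square) (smt (verit) mult_pos_pos zero_less_norm_iff right_minus_eq)
  then have "norm (a + b) < 2 * norm a"
    by (rule power2_less_imp_less) simp
  then have "norm ((1/2) *\<^sub>R (a + b)) powr p < norm a powr p"
    using assms by (intro powr_less_mono2) auto
  then show ?thesis using True by simp
next
  case False
  have "norm ((1/2) *\<^sub>R (a + b)) powr p \<le> ((norm a + norm b) / 2) powr p"
    using assms norm_triangle_ineq[of a b] by (intro powr_mono2) auto
  also have "\<dots> < (norm a powr p + norm b powr p) / 2"
  proof (cases "norm a < norm b")
    case True
    then show ?thesis using powr_midpoint_strict_convex[of p "norm a" "norm b"] assms by simp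
  next
    case F: False
    then show ?thesis using powr_midpoint_strict_convex[of p "norm b" "norm a"] assms False
      by (simp add: add.commute)
  qed
  finally show ?thesis .
qed

lemma norm_powr_midpoint_convex:
  fixes a b :: "'b::real_inner"
  assumes "1 < p"
  shows "norm ((1/2) *\<^sub>R (a + b)) powr p \<le> (norm a powr p + norm b powr p) / 2"
proof (cases "a = b")
  case True
  have "(1/2) *\<^sub>R (b + b) = b" by (simp flip: scaleR_2)
  then show ?thesis using True by simp
next
  case False
  then show ?thesis using norm_powr_midpoint_strict_convex[OF assms False] by linarith
qed

text \<open>After scaling to \<open>norm a + norm b = 1\<close> the convexity defect is a positive continuous
  function on the compact set where \<open>norm (a - b) \<ge> \<eta>\<close>.\<close>

lemma norm_powr_uniformly_convex:
  fixes q P \<epsilon> :: real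
  assumes q: "1 < q" and \<epsilon>: "0 < \<epsilon>"
  obtains C where "0 \<le> C" "\<And>p a b :: 'b::euclidean_space. q \<le> p \<Longrightarrow> p \<le> P \<Longrightarrow>
     norm (a - b) powr p \<le> \<epsilon> * (norm a powr p + norm b powr p)
       + C * ((norm a powr p + norm b powr p) / 2 - norm ((1/2) *\<^sub>R (a + b)) powr p)"
proof -
  \<comment> \<open>Where \<open>norm (a - b)\<close> is at most \<open>\<eta>\<close> times the sum
    of the norms, \<open>\<eta> powr p \<le> \<eta>\<close> and \<open>powr_norm_add_le\<close>
    leave the factor \<open>\<eta> * 2 powr P\<close>, which is at most
    \<open>\<epsilon>\<close>.\<close>
  define \<eta> where "\<eta> = min 1 (\<epsilon> / 2 powr P)"
  have \<eta>: "0 < \<eta>" "\<eta> \<le> 1" "\<eta> * 2 powr P \<le> \<epsilon>"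
    using \<epsilon> by (auto simp: \<eta>_def min_def field_simps)
  define S where "S = {q..P} \<times> {(a::'b, b::'b). norm a + norm b = 1 \<and> \<eta> \<le> norm (a - b)}"
  define d where "d = (\<lambda>(p::real, a::'b, b::'b).
     (norm a powr p + norm b powr p) / 2 - norm ((1/2) *\<^sub>R (a + b)) powr p)"
  have "closed {(a::'b, b::'b). norm a + norm b = 1 \<and> \<eta> \<le> norm (a - b)}"
    unfolding case_prod_unfold Collect_conj_eq
    by (intro closed_Int closed_Collect_eq closed_Collect_le continuous_intros)
  moreover have "bounded {(a::'b, b::'b). norm a + norm b = 1 \<and> \<eta> \<le> norm (a - b)}"
  proof (rule bounded_subset)
    show "bounded (cball (0::'b) 1 \<times> cball (0::'b) 1)" by (intro bounded_Times bounded_cball)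
    show "{(a::'b, b::'b). norm a + norm b = 1 \<and> \<eta> \<le> norm (a - b)} \<subseteq> cball 0 1 \<times> cball 0 1"
      by (auto simp: mem_cball dist_norm) (smt (verit) norm_ge_zero)+
  qed
  ultimately have S: "compact S"
    unfolding S_def by (intro compact_Times) (auto simp: compact_eq_bounded_closed)
  have cd: "continuous_on S d"
    unfolding d_def case_prod_unfold
    using q by (intro continuous_intros continuous_on_powr') (auto simp: S_def)
  obtain d0 where d0: "d0 > 0" "\<And>z. z \<in> S \<Longrightarrow> d0 \<le> d z"
  proof (cases "S = {}")
    case True
    then show ?thesis using that[of 1] by auto
  next
    case False
    obtain z where z: "z \<in> S" "\<And>y. y \<in> S \<Longrightarrow> d z \<le> d y"
      using continuous_attains_inf[OF S False cd] by blast
    obtain p a b where zeq: "z = (p, a, b)" by (cases z)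
    have "a \<noteq> b" "1 < p" using z(1) q \<eta> by (auto simp: S_def zeq)
    then have "d z > 0"
      using norm_powr_midpoint_strict_convex[of p a b] by (simp add: d_def zeq)
    then show ?thesis using that z by blast
  qed
  show ?thesis
  proof (rule that[of "1 / d0"])
    show "0 \<le> 1 / d0" using d0 by simp
    fix p :: real and a b :: 'b
    assume p: "q \<le> p" "p \<le> P"
    define s where "s = norm a + norm b"
    define D where "D = (norm a powr p + norm b powr p) / 2 - norm ((1/2) *\<^sub>R (a + b)) powr p"
    have D: "D \<ge> 0" using norm_powr_midpoint_convex[of p a b] p q by (simp add: D_def)
    have sp: "s powr p \<le> 2 powr P * (norm a powr p + norm b powr p)"
      using powr_norm_add_le[of p P "norm a" "norm b"] p q by (simp add: s_def)
    show "norm (a - b) powr p \<le> \<epsilon> * (norm a powr p + norm b powr p)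
       + 1 / d0 * ((norm a powr p + norm b powr p) / 2 - norm ((1/2) *\<^sub>R (a + b)) powr p)"
    proof (cases "norm (a - b) \<le> \<eta> * s")
      case True
      then have "norm (a - b) powr p \<le> (\<eta> * s) powr p"
        using p q by (intro powr_mono2) auto
      also have "\<dots> = \<eta> powr p * s powr p" by (simp add: powr_mult)
      also have "\<dots> \<le> \<eta> powr 1 * s powr p"
        using \<eta> p q by (intro mult_right_mono powr_mono') auto
      also have "\<dots> \<le> \<eta> * (2 powr P * (norm a powr p + norm b powr p))"
        using \<eta> sp by (simp add: mult_left_mono)
      also have "\<dots> \<le> \<epsilon> * (norm a powr p + norm b powr p)"
        using mult_right_mono[OF \<eta>(3), of "norm a powr p + norm b powr p"] by (simp add: mult_ac)
      finally show ?thesis using D d0 unfolding D_def[symmetric] by (simp add: add_increasing2)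
    next
      case False
      have s: "s > 0" using False by (metis s_def \<eta>(1) add_cancel_right_right add_nonneg_nonneg
          diff_zero less_eq_real_def mult_zero_right norm_eq_zero norm_ge_zero not_less add_nonneg_eq_0_iff)
      \<comment> \<open>The defect and \<open>s powr p\<close> are both homogeneous of degree
        \<open>p\<close>, so the minimum \<open>d0\<close> on the normalised pairs gives
        \<open>s powr p \<le> D / d0\<close>.\<close>
      have "(p, (1/s) *\<^sub>R a, (1/s) *\<^sub>R b) \<in> S"
        using p s False
        by (auto simp: S_def simp flip: scaleR_diff_right add_divide_distrib) (auto simp: s_def field_simps)
      then have "d0 \<le> d (p, (1/s) *\<^sub>R a, (1/s) *\<^sub>R b)" by (rule d0)
      also have "\<dots> = D / s powr p"
      proof -
        have "norm ((1/2) *\<^sub>R ((1/s) *\<^sub>R a + (1/s) *\<^sub>R b)) = norm ((1/2) *\<^sub>R (a + b)) / s"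
          using s by (simp flip: scaleR_add_right)
        then show ?thesis using s
          by (simp add: d_def D_def powr_divide diff_divide_distrib add_divide_distrib mult.commute)
      qed
      finally have "s powr p \<le> D / d0" using s d0 by (simp add: field_simps)
      moreover have "norm (a - b) powr p \<le> s powr p"
        using p q norm_triangle_ineq4[of a b] by (intro powr_mono2) (auto simp: s_def)
      ultimately have "norm (a - b) powr p \<le> D / d0" by linarith
      then show ?thesis using \<epsilon> unfolding D_def[symmetric] by (simp add: add_increasing)
    qed
  qed
qed

text \<open>At the origin the difference quotient is \<open>norm h powr (p - 1) / p\<close>, which
  tends to zero since \<open>p > 1\<close>. The same formula is right there even for
  \<open>p < 2\<close>, because its factor \<open>x \<bullet> h\<close> is zero.\<close>

lemma norm_powr_has_derivative:
  fixes x :: "'b::real_inner"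
  assumes p: "1 < p"
  shows "((\<lambda>x. norm x powr p / p) has_derivative (\<lambda>h. norm x powr (p - 2) * (x \<bullet> h))) (at x)"
proof (cases "x = 0")
  case False
  have "((\<lambda>x. norm x powr p) has_derivative (\<lambda>h. p * norm x powr (p - 1) * (h \<bullet> sgn x))) (at x)"
    using has_derivative_compose[OF has_derivative_norm[OF False]
        has_real_derivative_powr[of "norm x" p, THEN has_field_derivative_imp_has_derivative]] False
    by (simp add: mult.commute)
  then have "((\<lambda>x. (1/p) * norm x powr p) has_derivative (\<lambda>h. (1/p) * (p * norm x powr (p - 1) * (h \<bullet> sgn x)))) (at x)"
    by (rule has_derivative_mult_right)
  moreover have "(1/p) * (p * norm x powr (p - 1) * (h \<bullet> sgn x)) = norm x powr (p - 2) * (x \<bullet> h)" for h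
  proof -
    have "norm x powr (p - 1) = norm x powr (p - 2) * norm x"
      using False powr_add[of "norm x" "p - 2" 1] by simp
    then show ?thesis using p False
      by (simp add: sgn_div_norm inner_commute field_simps)
  qed
  ultimately show ?thesis by simp
next
  case True
  have "((\<lambda>h::'b. norm h powr (p - 1) / p) \<longlongrightarrow> 0 powr (p - 1) / p) (at 0)"
    using p by (intro tendsto_intros tendsto_powr2) (auto intro!: tendsto_eq_intros always_eventually)
  then have "((\<lambda>h::'b. norm h powr (p - 1) / p) \<longlongrightarrow> 0) (at 0)" by simp
  moreover have "norm h powr p / p / norm h = norm h powr (p - 1) / p" if "h \<noteq> 0" for h :: 'b
    using that powr_add[of "norm h" "p - 1" 1] by simp
  ultimately have "((\<lambda>h::'b. norm h powr p / p / norm h) \<longlongrightarrow> 0) (at 0)"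
    by (subst Lim_cong_within[where g = "\<lambda>h. norm h powr (p - 1) / p"]) auto
  then show ?thesis using True p by (simp add: has_derivative_at)
qed

section \<open>Modulars and integrals\<close>

text \<open>The variable exponent modular with values in \<open>ennreal\<close>, over any measure
  and for vector-valued functions, so that functions and gradients share one theory. With the
  exponent \<open>\<lambda>x. 1\<close> it is the L1 norm.\<close>

definition vmod :: "'a measure \<Rightarrow> ('a \<Rightarrow> real) \<Rightarrow> ('a \<Rightarrow> 'b::real_normed_vector) \<Rightarrow> ennreal" where
  "vmod M p w = (\<integral>\<^sup>+x. ennreal (norm (w x) powr p x) \<partial>M)"

lemma vmod_minus_commute: "vmod M p (\<lambda>x. v x - w x) = vmod M p (\<lambda>x. w x - v x)"
  unfolding vmod_def by (simp add: norm_minus_commute)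

lemma vmod_eq_integral:
  assumes "integrable M (\<lambda>x. norm (w x) powr p x)"
  shows "vmod M p w = ennreal (\<integral>x. norm (w x) powr p x \<partial>M)"
  unfolding vmod_def by (rule nn_integral_eq_integral[OF assms]) simp

lemma integrable_if_vmod_finite:
  assumes [measurable]: "w \<in> borel_measurable M" "p \<in> borel_measurable M" and "vmod M p w < \<infinity>"
  shows "integrable M (\<lambda>x. norm (w x) powr p x)"
  using assms by (intro integrableI_nonneg) (auto simp: vmod_def)

lemma L1_Cauchy_AE_limit:
  fixes w :: "nat \<Rightarrow> 'a \<Rightarrow> 'b::euclidean_space"
  assumes int: "\<And>n. integrable M (w n)"
    and cauchy: "\<And>e. e > 0 \<Longrightarrow> \<exists>N. \<forall>i\<ge>N. \<forall>j\<ge>N. (LINT x|M. norm (w i x - w j x)) < e"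
  obtains r g where "strict_mono r" "g \<in> borel_measurable M" "AE x in M. (\<lambda>n. w (r n) x) \<longlonglongrightarrow> g x"
proof -
  obtain r where r: "strict_mono r" "AE x in M. Cauchy (\<lambda>i. w (r i) x)"
    using cauchy_L1_AE_cauchy_subseq[OF int cauchy] by blast
  have [measurable]: "\<And>n. w n \<in> borel_measurable M" using int by auto
  show ?thesis
  proof (rule that[OF r(1)])
    show "(\<lambda>x. lim (\<lambda>n. w (r n) x)) \<in> borel_measurable M" by measurable
    show "AE x in M. (\<lambda>n. w (r n) x) \<longlonglongrightarrow> lim (\<lambda>n. w (r n) x)"
      using r(2) by eventually_elim (simp add: Cauchy_convergent_iff convergent_LIMSEQ_iff)
  qed
qed

lemma ennreal_tendsto_0_iff_eventually_le:
  fixes f :: "'c \<Rightarrow> ennreal"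
  shows "(f \<longlongrightarrow> 0) F \<longleftrightarrow> (\<forall>e>0. \<forall>\<^sub>F n in F. f n \<le> ennreal e)"
proof
  assume f: "(f \<longlongrightarrow> 0) F"
  show "\<forall>e>0. \<forall>\<^sub>F n in F. f n \<le> ennreal e"
  proof (intro allI impI)
    fix e :: real assume "0 < e"
    then have "0 < ennreal e" by simp
    from order_tendstoD(2)[OF f this] show "\<forall>\<^sub>F n in F. f n \<le> ennreal e"
      by (rule eventually_mono) simp
  qed
next
  assume *: "\<forall>e>0. \<forall>\<^sub>F n in F. f n \<le> ennreal e"
  show "(f \<longlongrightarrow> 0) F"
  proof (rule order_tendstoI)
    fix a :: ennreal assume "0 < a"
    then obtain e where e: "e > 0" "ennreal e < a"
    proof (cases a)
      case (real r)
      then show ?thesis using that[of "r / 2"] \<open>0 < a\<close> by (simp add: ennreal_less_iff)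
    qed (use that[of 1] in auto)
    then have "\<forall>\<^sub>F n in F. f n \<le> ennreal e" using * by blast
    then show "\<forall>\<^sub>F n in F. f n < a"
      by eventually_elim (use e(2) in \<open>blast intro: le_less_trans\<close>)
  qed simp
qed

text \<open>Fatou's lemma in the second index: the Cauchy bound for \<open>w n x - w (r k) x\<close>
  passes to the limit in \<open>k\<close>. The subsequence only supplies the candidate; convergence
  holds for the whole sequence.\<close>

lemma vmod_Cauchy_tendsto_AE_limit:
  fixes w :: "nat \<Rightarrow> 'a \<Rightarrow> 'b::euclidean_space"
  assumes [measurable]: "\<And>n. w n \<in> borel_measurable M" "p \<in> borel_measurable M"
    and p: "\<And>x. x \<in> space M \<Longrightarrow> 0 < p x"
    and r: "strict_mono r" "AE x in M. (\<lambda>n. w (r n) x) \<longlonglongrightarrow> g x"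
    and cauchy: "\<And>e. e > 0 \<Longrightarrow> \<exists>N. \<forall>i\<ge>N. \<forall>j\<ge>N. vmod M p (\<lambda>x. w i x - w j x) \<le> ennreal e"
  shows "(\<lambda>n. vmod M p (\<lambda>x. w n x - g x)) \<longlonglongrightarrow> 0"
proof -

  have bound: "\<exists>N. \<forall>n\<ge>N. vmod M p (\<lambda>x. w n x - g x) \<le> ennreal e" if e0: "e > 0" for e
  proof -
    obtain N where N: "\<And>i j. i \<ge> N \<Longrightarrow> j \<ge> N \<Longrightarrow> vmod M p (\<lambda>x. w i x - w j x) \<le> ennreal e"
      using cauchy[OF e0] by blast
    have "vmod M p (\<lambda>x. w n x - g x) \<le> ennreal e" if "n \<ge> N" for n
    proof -
      have "vmod M p (\<lambda>x. w n x - g x)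
          \<le> (\<integral>\<^sup>+x. liminf (\<lambda>k. ennreal (norm (w n x - w (r k) x) powr p x)) \<partial>M)"
        unfolding vmod_def
      proof (rule nn_integral_mono_AE, use r(2) AE_space in eventually_elim)
        case (elim x)
        have "(\<lambda>k. ennreal (norm (w n x - w (r k) x) powr p x)) \<longlonglongrightarrow> ennreal (norm (w n x - g x) powr p x)"
          by (intro tendsto_ennrealI tendsto_powr2 tendsto_norm tendsto_diff tendsto_const elim p always_eventually) auto
        then show ?case using lim_imp_Liminf[OF sequentially_bot] by (metis order_refl)
      qed
      also have "\<dots> \<le> liminf (\<lambda>k. vmod M p (\<lambda>x. w n x - w (r k) x))"
        unfolding vmod_def by (rule nn_integral_liminf) measurable
      also have "\<dots> \<le> ennreal e"
      proof (rule Liminf_le)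
        show "\<forall>\<^sub>F k in sequentially. vmod M p (\<lambda>x. w n x - w (r k) x) \<le> ennreal e"
          using eventually_ge_at_top[of N]
          by eventually_elim (use N[OF \<open>n \<ge> N\<close>] seq_suble[OF r(1)] in \<open>blast intro: order_trans\<close>)
      qed simp
      finally show ?thesis .
    qed
    then show ?thesis by blast
  qed
  then show ?thesis by (simp add: ennreal_tendsto_0_iff_eventually_le eventually_sequentially)
qed

text \<open>Below the threshold \<open>\<delta>\<close> the power is at most
  \<open>\<delta> powr s\<close>; above it, raising the exponent costs at most
  \<open>\<delta> powr (s - P)\<close>. Choosing \<open>\<delta>\<close> first and then a small
  modular yields convergence in a lower exponent.\<close>

lemma norm_powr_le_norm_powr:
  fixes w :: "'b::real_normed_vector"
  assumes "0 \<le> s" "s \<le> p" "p \<le> P" "0 < \<delta>" "\<delta> \<le> 1"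
  shows "norm w powr s \<le> \<delta> powr s + \<delta> powr (s - P) * norm w powr p"
proof (cases "norm w \<le> \<delta>")
  case True
  then have "norm w powr s \<le> \<delta> powr s" using assms by (intro powr_mono2) auto
  then show ?thesis by (simp add: add_increasing2)
next
  case False
  then have w: "norm w > 0" using assms by linarith
  have "norm w powr s = norm w powr (s - p) * norm w powr p"
    using w by (simp flip: powr_add)
  also have "\<dots> \<le> \<delta> powr (s - p) * norm w powr p"
    using False assms by (intro mult_right_mono powr_mono2') auto
  also have "\<dots> \<le> \<delta> powr (s - P) * norm w powr p"
    using assms by (intro mult_right_mono powr_mono') auto
  finally show ?thesis using powr_ge_zero[of \<delta> s] by linarith
qed

text \<open>Dominated convergence for the difference quotients, which the mean value inequality
  bounds by \<open>B\<close>. It serves both the first variation and integration by parts.\<close>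

lemma has_real_derivative_lebesgue_integral:
  fixes k k' :: "'a \<Rightarrow> real \<Rightarrow> real"
  assumes int: "\<And>t. \<bar>t\<bar> < 1 \<Longrightarrow> integrable M (\<lambda>x. k x t)"
    and deriv: "\<And>x t. x \<in> space M \<Longrightarrow> \<bar>t\<bar> < 1 \<Longrightarrow> (k x has_real_derivative k' x t) (at t)"
    and bound: "\<And>x t. x \<in> space M \<Longrightarrow> \<bar>t\<bar> < 1 \<Longrightarrow> \<bar>k' x t\<bar> \<le> B x"
    and B: "integrable M B"
    and meas: "(\<lambda>x. k' x 0) \<in> borel_measurable M"
  shows "((\<lambda>t. \<integral>x. k x t \<partial>M) has_real_derivative (\<integral>x. k' x 0 \<partial>M)) (at 0)"
proof -
  have "((\<lambda>t. ((\<integral>x. k x t \<partial>M) - (\<integral>x. k x 0 \<partial>M)) / t) \<longlongrightarrow> (\<integral>x. k' x 0 \<partial>M)) (at 0)"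
    unfolding tendsto_at_iff_sequentially
  proof (intro allI impI)
    fix X :: "nat \<Rightarrow> real"
    assume X0: "\<forall>i. X i \<in> UNIV - {0}" and X: "X \<longlonglongrightarrow> 0"
    \<comment> \<open>A null sequence may leave the unit interval finitely often; there it is
      replaced by the nonzero value \<open>1/2\<close>, so that the bound holds for every
      index.\<close>
    define Y where "Y i = (if \<bar>X i\<bar> < 1 then X i else 1/2)" for i
    have ev: "\<forall>\<^sub>F i in sequentially. Y i = X i"
    proof -
      have "\<forall>\<^sub>F i in sequentially. dist (X i) 0 < 1" using X by (rule tendstoD) simp
      then show ?thesis by eventually_elim (simp add: Y_def)
    qed
    have Y: "Y i \<noteq> 0" "\<bar>Y i\<bar> < 1" for i using X0 by (auto simp: Y_def)
    have Ylim: "Y \<longlonglongrightarrow> 0" using X ev by (simp add: tendsto_cong)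
    have "(\<lambda>i. \<integral>x. (k x (Y i) - k x 0) / Y i \<partial>M) \<longlonglongrightarrow> (\<integral>x. k' x 0 \<partial>M)"
    proof (rule integral_dominated_convergence[where w = B])
      show "(\<lambda>x. (k x (Y i) - k x 0) / Y i) \<in> borel_measurable M" for i
        using int[OF Y(2)] int[of 0] by (auto dest!: borel_measurable_integrable)
      show "AE x in M. (\<lambda>i. (k x (Y i) - k x 0) / Y i) \<longlonglongrightarrow> k' x 0"
      proof (rule AE_I2)
        fix x assume x: "x \<in> space M"
        have "((\<lambda>h. (k x h - k x 0) / h) \<longlongrightarrow> k' x 0) (at 0)"
          using deriv[OF x, of 0] by (simp add: DERIV_def)
        then show "(\<lambda>i. (k x (Y i) - k x 0) / Y i) \<longlonglongrightarrow> k' x 0"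
          using Y Ylim unfolding tendsto_at_iff_sequentially comp_def by auto
      qed
      show "AE x in M. norm ((k x (Y i) - k x 0) / Y i) \<le> B x" for i
      proof (rule AE_I2)
        fix x assume x: "x \<in> space M"
        have "norm (k x (Y i) - k x 0) \<le> B x * norm (Y i - 0)"
        proof (rule field_differentiable_bound[of "{-1<..<1}" _ "k' x"])
          show "(k x has_real_derivative k' x z) (at z within {-1<..<1})" if "z \<in> {-1<..<1}" for z
            by (rule has_field_derivative_at_within, rule deriv[OF x]) (use that in \<open>auto simp: abs_less_iff\<close>)
          show "norm (k' x z) \<le> B x" if "z \<in> {-1<..<1}" for z
            using bound[OF x, of z] that by (auto simp: abs_less_iff)
        qed (use Y(2)[of i] in \<open>auto simp: abs_less_iff\<close>)
        then show "norm ((k x (Y i) - k x 0) / Y i) \<le> B x"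
          using Y(1)[of i] by (simp add: pos_divide_le_eq)
      qed
    qed (fact meas, fact B)
    moreover have "(\<integral>x. (k x (Y i) - k x 0) / Y i \<partial>M) = ((\<integral>x. k x (Y i) \<partial>M) - (\<integral>x. k x 0 \<partial>M)) / Y i" for i
      using int[OF Y(2)] int[of 0] by (simp add: Bochner_Integration.integral_diff)
    ultimately have "(\<lambda>i. ((\<integral>x. k x (Y i) \<partial>M) - (\<integral>x. k x 0 \<partial>M)) / Y i) \<longlonglongrightarrow> (\<integral>x. k' x 0 \<partial>M)"
      by (simp only:)
    then show "((\<lambda>t. ((\<integral>x. k x t \<partial>M) - (\<integral>x. k x 0 \<partial>M)) / t) \<circ> X) \<longlonglongrightarrow> (\<integral>x. k' x 0 \<partial>M)"
      unfolding comp_def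
      by (rule Lim_transform_eventually) (use ev in \<open>eventually_elim, simp\<close>)
  qed
  then show ?thesis by (simp add: DERIV_def)
qed

text \<open>The variable \<open>t\<close> is rounded down to a multiple of \<open>1 / Suc n\<close>.
  The rounded value ranges over a countable set, so measurability in \<open>x\<close> suffices, and
  continuity in \<open>t\<close> gives pointwise convergence.\<close>

lemma caratheodory_measurable_pair:
  fixes f :: "'a \<Rightarrow> real \<Rightarrow> real"
  assumes meas: "\<And>t. (\<lambda>x. f x t) \<in> borel_measurable M"
    and cont: "\<And>x. x \<in> space M \<Longrightarrow> continuous_on UNIV (f x)"
  shows "(\<lambda>(x, t). f x t) \<in> borel_measurable (M \<Otimes>\<^sub>M borel)"
proof -
  have 1: "(\<lambda>z. f (fst z) (real_of_int \<lfloor>real (Suc n) * snd z\<rfloor> / real (Suc n)))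
      \<in> borel_measurable (M \<Otimes>\<^sub>M borel)" for n :: nat
  proof -
    have "(\<lambda>z. (\<lambda>i z. f (fst z) (real_of_int i / real (Suc n))) \<lfloor>real (Suc n) * snd z\<rfloor> z)
        \<in> borel_measurable (M \<Otimes>\<^sub>M borel)"
    proof (rule measurable_compose_countable[where g = "\<lambda>z. \<lfloor>real (Suc n) * snd z\<rfloor>"
          and f = "\<lambda>i z. f (fst z) (real_of_int i / real (Suc n))"])
      show "(\<lambda>z. f (fst z) (real_of_int i / real (Suc n))) \<in> borel_measurable (M \<Otimes>\<^sub>M borel)" for i
        using measurable_compose[OF measurable_fst meas] by simp
    qed measurable
    then show ?thesis by simp
  qed
  have 2: "(\<lambda>n. f (fst z) (real_of_int \<lfloor>real (Suc n) * snd z\<rfloor> / real (Suc n))) \<longlonglongrightarrow> (case z of (x, t) \<Rightarrow> f x t)"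
    if "z \<in> space (M \<Otimes>\<^sub>M borel)" for z :: "'a \<times> real"
  proof -
    from that have x: "fst z \<in> space M" by (auto simp: space_pair_measure)
    have "(\<lambda>n. real_of_int \<lfloor>real (Suc n) * snd z\<rfloor> / real (Suc n)) \<longlonglongrightarrow> snd z"
    proof (rule tendsto_sandwich)
      show "\<forall>\<^sub>F n in sequentially. snd z - 1 / real (Suc n) \<le> real_of_int \<lfloor>real (Suc n) * snd z\<rfloor> / real (Suc n)"
      proof (rule always_eventually, rule allI)
        fix n
        have "real (Suc n) * snd z - 1 \<le> real_of_int \<lfloor>real (Suc n) * snd z\<rfloor>" by linarith
        then have "(real (Suc n) * snd z - 1) / real (Suc n) \<le> real_of_int \<lfloor>real (Suc n) * snd z\<rfloor> / real (Suc n)"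
          by (rule divide_right_mono) simp
        then show "snd z - 1 / real (Suc n) \<le> real_of_int \<lfloor>real (Suc n) * snd z\<rfloor> / real (Suc n)"
          by (simp add: diff_divide_distrib del: of_nat_Suc)
      qed
      show "\<forall>\<^sub>F n in sequentially. real_of_int \<lfloor>real (Suc n) * snd z\<rfloor> / real (Suc n) \<le> snd z"
      proof (rule always_eventually, rule allI)
        fix n
        have "real_of_int \<lfloor>real (Suc n) * snd z\<rfloor> / real (Suc n) \<le> (real (Suc n) * snd z) / real (Suc n)"
          by (rule divide_right_mono) auto
        then show "real_of_int \<lfloor>real (Suc n) * snd z\<rfloor> / real (Suc n) \<le> snd z"
          by (simp del: of_nat_Suc)
      qed
      show "(\<lambda>n. snd z - 1 / real (Suc n)) \<longlonglongrightarrow> snd z"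
        using LIMSEQ_inverse_real_of_nat[THEN tendsto_diff[OF tendsto_const[of "snd z"]]] by (simp add: inverse_eq_divide)
    qed simp
    then show ?thesis
      using cont[OF x] unfolding case_prod_unfold
      by (intro isCont_tendsto_compose[where g = "f (fst z)"]) (auto simp: continuous_on_eq_continuous_at)
  qed
  show ?thesis by (rule borel_measurable_LIMSEQ_real[OF 2 1])
qed

lemma exists_large_powr_small:
  fixes a e :: real
  assumes "a < 0" "0 < e"
  obtains R where "1 \<le> R" "\<And>m. R \<le> m \<Longrightarrow> m powr a \<le> e"
proof (rule that)
  show "1 \<le> max 1 (e powr (1/a))" by simp
  fix m assume "max 1 (e powr (1/a)) \<le> m"
  then have "m powr a \<le> (e powr (1/a)) powr a"
    using assms by (intro powr_mono2') auto
  then show "m powr a \<le> e" using assms by (simp add: powr_powr)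
qed

text \<open>A Young type inequality: past the threshold \<open>R\<close> the factor
  \<open>s powr (1 - q)\<close> is at most \<open>e\<close>, and up to it the constant
  \<open>R\<close> suffices.\<close>

lemma exists_le_powr:
  fixes q e :: real
  assumes "1 < q" "0 < e"
  obtains D where "0 \<le> D" "\<And>s. 0 \<le> s \<Longrightarrow> s \<le> e * s powr q + D"
proof -
  obtain R where R: "1 \<le> R" "\<And>m. R \<le> m \<Longrightarrow> m powr (1 - q) \<le> e"
    using exists_large_powr_small[of "1 - q" e] assms by auto
  show ?thesis
  proof (rule that[of R])
    fix s :: real assume "0 \<le> s"
    show "s \<le> e * s powr q + R"
    proof (cases "s \<le> R")
      case False
      then have "s = s powr (1 - q) * s powr q" using R by (simp flip: powr_add)
      also have "\<dots> \<le> e * s powr q" using R False by (intro mult_right_mono) auto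
      finally show ?thesis using R by linarith
    qed (use assms in \<open>simp add: add_increasing\<close>)
  qed (use R in simp)
qed

section \<open>Minimisation of the energy\<close>

text \<open>The variational argument only meets these properties of the Sobolev space.
  \<open>X u g\<close> reads: \<open>u\<close> belongs to the space with gradient \<open>g\<close>;
  a relation fits because the gradient enters the energy as a datum of its own. Poincare's
  inequality and compactness are stated for the constant exponent \<open>q\<close>, a lower bound of
  both exponents. In \<open>X_closed\<close> the functions converge only in L1, but the gradients in
  both modulars.\<close>

locale energy_space = finite_measure M for M :: "'a measure" +
  fixes p1 p2 :: "'a \<Rightarrow> real" and q P K b C :: real
    and X :: "('a \<Rightarrow> real) \<Rightarrow> ('a \<Rightarrow> 'b::euclidean_space) \<Rightarrow> bool"
    and f :: "'a \<Rightarrow> real \<Rightarrow> real"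
  assumes p1_meas [measurable]: "p1 \<in> borel_measurable M"
    and p2_meas [measurable]: "p2 \<in> borel_measurable M"
    and q_gt_1: "1 < q"
    and p1_bounds: "\<And>x. x \<in> space M \<Longrightarrow> q \<le> p1 x \<and> p1 x \<le> P"
    and p2_bounds: "\<And>x. x \<in> space M \<Longrightarrow> q \<le> p2 x \<and> p2 x \<le> P"
    and K_nonneg: "0 \<le> K" and q_le_P: "q \<le> P"
    and X_measurable: "\<And>u g. X u g \<Longrightarrow> u \<in> borel_measurable M"
    and X_grad_measurable: "\<And>u g. X u g \<Longrightarrow> g \<in> borel_measurable M"
    and X_integrable1: "\<And>u g. X u g \<Longrightarrow> integrable M (\<lambda>x. norm (g x) powr p1 x)"
    and X_integrable2: "\<And>u g. X u g \<Longrightarrow> integrable M (\<lambda>x. norm (g x) powr p2 x)"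
    and X_integrable: "\<And>u g. X u g \<Longrightarrow> integrable M (\<lambda>x. \<bar>u x\<bar> powr q)"
    and X_poincare: "\<And>u g. X u g \<Longrightarrow>
          (\<integral>x. \<bar>u x\<bar> powr q \<partial>M) \<le> K * (\<integral>x. norm (g x) powr q \<partial>M)"
    and X_zero: "X (\<lambda>x. 0) (\<lambda>x. 0)"
    and X_linear: "\<And>u g v h c. X u g \<Longrightarrow> X v h \<Longrightarrow> X (\<lambda>x. u x + c * v x) (\<lambda>x. g x + c *\<^sub>R h x)"
    and X_compact: "\<And>u g B. (\<And>n::nat. X (u n) (g n)) \<Longrightarrow>
          (\<And>n. (\<integral>x. norm (g n x) powr q \<partial>M) \<le> B) \<Longrightarrow>
          \<exists>r::nat \<Rightarrow> nat. strict_mono r \<and> (\<forall>e>0. \<exists>N. \<forall>i\<ge>N. \<forall>j\<ge>N. (\<integral>x. \<bar>u (r i) x - u (r j) x\<bar> \<partial>M) < e)"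
    and X_closed: "\<And>u g u0 g0. (\<And>n::nat. X (u n) (g n)) \<Longrightarrow>
          u0 \<in> borel_measurable M \<Longrightarrow> g0 \<in> borel_measurable M \<Longrightarrow>
          (\<lambda>n. vmod M (\<lambda>x. 1) (\<lambda>x. u n x - u0 x)) \<longlonglongrightarrow> 0 \<Longrightarrow>
          (\<lambda>n. vmod M p1 (\<lambda>x. g n x - g0 x)) \<longlonglongrightarrow> 0 \<Longrightarrow>
          (\<lambda>n. vmod M p2 (\<lambda>x. g n x - g0 x)) \<longlonglongrightarrow> 0 \<Longrightarrow> X u0 g0"
    and f_measurable: "\<And>t. (\<lambda>x. f x t) \<in> borel_measurable M"
    and f_continuous: "\<And>x. x \<in> space M \<Longrightarrow> continuous_on UNIV (f x)"
    and b_gt_1: "1 < b" and b_less: "b < q" and C_nonneg: "0 \<le> C"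
    and f_growth: "\<And>x t. x \<in> space M \<Longrightarrow> \<bar>f x t\<bar> \<le> C * (1 + \<bar>t\<bar> powr (b - 1))"
begin

abbreviation "\<mu> \<equiv> measure M (space M)"

section \<open>The primitive of the nonlinearity and its superposition operator\<close>

lemma f_pair_measurable [measurable]: "(\<lambda>(x, t). f x t) \<in> borel_measurable (M \<Otimes>\<^sub>M borel)"
  by (rule caratheodory_measurable_pair[OF f_measurable f_continuous])

text \<open>The primitive of \<open>f x\<close> that vanishes at 0, with the integration variable
  scaled to the unit interval. Negative \<open>t\<close> needs no separate case, and measurability
  follows from that of integrals with a parameter.\<close>

definition F :: "'a \<Rightarrow> real \<Rightarrow> real" where
  "F x t = (LINT s|lborel. indicator {0..1} s *\<^sub>R (f x (s * t) * t))"

lemma F_0 [simp]: "F x 0 = 0"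
  by (simp add: F_def)

lemma F_comp_measurable [measurable]:
  assumes [measurable]: "u \<in> borel_measurable M"
  shows "(\<lambda>x. F x (u x)) \<in> borel_measurable M"
  unfolding F_def by measurable

lemma f_comp_measurable [measurable]:
  assumes [measurable]: "u \<in> borel_measurable M"
  shows "(\<lambda>x. f x (u x)) \<in> borel_measurable M"
  by measurable

text \<open>On a compact interval around \<open>t\<close> the continuous \<open>f x\<close> has some
  antiderivative \<open>H\<close>; the fundamental theorem of calculus along \<open>s * t'\<close>
  identifies \<open>F x\<close> with \<open>H\<close> up to a constant.\<close>

lemma F_has_derivative:
  assumes x: "x \<in> space M"
  shows "(F x has_real_derivative f x t) (at t)"
proof -
  define R where "R = \<bar>t\<bar> + 2"
  have "continuous_on {-R..R} (f x)"
    using f_continuous[OF x] continuous_on_subset by blast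
  then obtain H where H0: "\<And>s. s \<in> {-R..R} \<Longrightarrow> (H has_vector_derivative f x s) (at s within {-R..R})"
    using antiderivative_continuous by blast
  have H: "(H has_real_derivative f x s) (at s)" if "\<bar>s\<bar> < R" for s
  proof -
    have "s \<in> interior {-R..R}" using that by auto
    moreover have "(H has_real_derivative f x s) (at s within {-R..R})"
      using H0[of s] that
      by (auto simp: has_real_derivative_iff_has_vector_derivative abs_less_iff)
    ultimately show ?thesis by (metis at_within_interior)
  qed
  have F: "F x t' = H t' - H 0" if "\<bar>t'\<bar> < R" for t'
  proof -
    have "F x t' = H (1 * t') - H (0 * t')"
      unfolding F_def
    proof (rule integral_FTC_atLeastAtMost)
      fix s :: real assume s: "0 \<le> s" "s \<le> 1"
      have "\<bar>s * t'\<bar> \<le> \<bar>t'\<bar>" using s by (simp add: abs_mult mult_left_le_one_le)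
      then have "\<bar>s * t'\<bar> < R" using that by linarith
      then have "(H has_real_derivative f x (s * t')) (at (s * t'))" by (rule H)
      moreover have "((\<lambda>s. s * t') has_real_derivative t') (at s)"
        by (auto intro!: derivative_eq_intros)
      ultimately have "((\<lambda>s. H (s * t')) has_real_derivative f x (s * t') * t') (at s)"
        by (rule DERIV_chain2)
      then show "((\<lambda>s. H (s * t')) has_vector_derivative f x (s * t') * t') (at s within {0..1})"
        by (auto simp: has_real_derivative_iff_has_vector_derivative intro: has_vector_derivative_at_within)
    next
      show "continuous_on {0..1} (\<lambda>s. f x (s * t') * t')"
        by (intro continuous_intros continuous_on_compose2[OF f_continuous[OF x]]) auto
    qed simp
    then show ?thesis by simp
  qed
  have "((\<lambda>t. H t - H 0) has_real_derivative f x t) (at t)"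
    using H[of t] by (auto intro!: derivative_eq_intros simp: R_def)
  then show ?thesis
  proof (rule has_field_derivative_transform_within_open)
    show "open {-R<..<R}" "t \<in> {-R<..<R}" by (auto simp: R_def)
    show "H s - H 0 = F x s" if "s \<in> {-R<..<R}" for s
      using F[of s] that by (auto simp: abs_less_iff)
  qed
qed

lemma F_lipschitz:
  assumes x: "x \<in> space M" and R: "1 \<le> R" "\<bar>s\<bar> \<le> R" "\<bar>t\<bar> \<le> R"
  shows "\<bar>F x s - F x t\<bar> \<le> 2 * C * R powr (b - 1) * \<bar>s - t\<bar>"
proof -
  have "norm (F x s - F x t) \<le> (2 * C * R powr (b - 1)) * norm (s - t)"
  proof (rule field_differentiable_bound[of "{-R..R}" _ "f x"])
    show "(F x has_real_derivative f x z) (at z within {-R..R})" for z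
      by (rule has_field_derivative_at_within, rule F_has_derivative[OF x])
    show "norm (f x z) \<le> 2 * C * R powr (b - 1)" if "z \<in> {-R..R}" for z
    proof -
      have "\<bar>z\<bar> powr (b - 1) \<le> R powr (b - 1)"
        using that b_gt_1 by (intro powr_mono2) auto
      moreover have "1 \<le> R powr (b - 1)" using R b_gt_1 by (intro ge_one_powr_ge_zero) auto
      ultimately have "1 + \<bar>z\<bar> powr (b - 1) \<le> 2 * R powr (b - 1)" by linarith
      then have "C * (1 + \<bar>z\<bar> powr (b - 1)) \<le> C * (2 * R powr (b - 1))"
        using C_nonneg by (rule mult_left_mono)
      then show ?thesis using f_growth[OF x, of z] by simp
    qed
  qed (use R in \<open>auto simp: abs_le_iff\<close>)
  then show ?thesis by simp
qed

lemma F_powr_bound: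
  assumes x: "x \<in> space M" and R: "1 \<le> R" "\<bar>t\<bar> \<le> R"
  shows "\<bar>F x t\<bar> \<le> 2 * C * R powr b"
proof -
  have "\<bar>F x t - F x 0\<bar> \<le> 2 * C * R powr (b - 1) * \<bar>t - 0\<bar>"
    using R by (intro F_lipschitz x) auto
  also have "\<dots> \<le> 2 * C * R powr (b - 1) * R"
    using R C_nonneg by (intro mult_left_mono) auto
  also have "\<dots> = 2 * C * R powr b"
    using R powr_add[of R "b - 1" 1] by simp
  finally show ?thesis by simp
qed

text \<open>Because \<open>b < q\<close>, superposition with \<open>F\<close> is uniformly continuous in \<open>L\<^sup>1\<close> on \<open>L\<^sup>q\<close>-bounded sets.\<close>

lemma F_diff_bound:
  assumes e: "0 < e"
  obtains D where "0 \<le> D" "\<And>x s t. x \<in> space M \<Longrightarrow>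
     \<bar>F x s - F x t\<bar> \<le> e * (\<bar>s\<bar> powr q + \<bar>t\<bar> powr q) + D * \<bar>s - t\<bar>"
proof -
  \<comment> \<open>Outside the square of side \<open>R\<close> the difference is at most
    \<open>4 * C * m powr b\<close>, and this choice turns that into \<open>e * m powr q\<close>.
    The summand 1 covers \<open>C = 0\<close>.\<close>
  obtain R where R: "1 \<le> R" "\<And>m. R \<le> m \<Longrightarrow> m powr (b - q) \<le> e / (4 * C + 1)"
    using exists_large_powr_small[of "b - q" "e / (4 * C + 1)"] b_less e C_nonneg by auto
  show ?thesis
  proof (rule that[of "2 * C * R powr (b - 1)"])
    show "0 \<le> 2 * C * R powr (b - 1)" using C_nonneg by simp
    fix x s t assume x: "x \<in> space M"
    show "\<bar>F x s - F x t\<bar> \<le> e * (\<bar>s\<bar> powr q + \<bar>t\<bar> powr q) + 2 * C * R powr (b - 1) * \<bar>s - t\<bar>"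
    proof (cases "\<bar>s\<bar> \<le> R \<and> \<bar>t\<bar> \<le> R")
      case True
      then show ?thesis using F_lipschitz[OF x R(1), of s t] e by (simp add: add_increasing)
    next
      case False
      define m where "m = max \<bar>s\<bar> \<bar>t\<bar>"
      have m: "R \<le> m" "1 \<le> m" "\<bar>s\<bar> \<le> m" "\<bar>t\<bar> \<le> m" using False R by (auto simp: m_def)
      have "\<bar>F x s - F x t\<bar> \<le> 4 * C * m powr b"
        using F_powr_bound[OF x m(2) m(3)] F_powr_bound[OF x m(2) m(4)] by linarith
      also have "\<dots> = 4 * C * m powr (b - q) * m powr q"
        using m by (simp flip: powr_add)
      also have "\<dots> \<le> 4 * C * (e / (4 * C + 1)) * m powr q"
        using R(2)[OF m(1)] C_nonneg by (intro mult_right_mono mult_left_mono) auto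
      also have "\<dots> \<le> e * m powr q"
        using C_nonneg e by (intro mult_right_mono) (auto simp: field_simps)
      also have "\<dots> \<le> e * (\<bar>s\<bar> powr q + \<bar>t\<bar> powr q)"
        using e by (intro mult_left_mono) (auto simp: m_def max_def)
      finally show ?thesis using C_nonneg by (simp add: add_increasing2)
    qed
  qed
qed

text \<open>Comparison with the value at 0 through \<open>F_diff_bound\<close> leaves a linear term,
  which \<open>exists_le_powr\<close> absorbs into the power \<open>q\<close>.\<close>

lemma F_bound:
  assumes e: "0 < e"
  obtains D where "0 \<le> D" "\<And>x t. x \<in> space M \<Longrightarrow> \<bar>F x t\<bar> \<le> e * \<bar>t\<bar> powr q + D"
proof -
  obtain D1 where D1: "0 \<le> D1" "\<And>x s t. x \<in> space M \<Longrightarrow>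
     \<bar>F x s - F x t\<bar> \<le> (e/2) * (\<bar>s\<bar> powr q + \<bar>t\<bar> powr q) + D1 * \<bar>s - t\<bar>"
    using F_diff_bound[of "e/2"] e by auto
  obtain D2 where D2: "0 \<le> D2" "\<And>s. 0 \<le> s \<Longrightarrow> s \<le> (e / (2 * (D1 + 1))) * s powr q + D2"
    using exists_le_powr[of q "e / (2 * (D1 + 1))"] q_gt_1 e D1 by auto
  show ?thesis
  proof (rule that[of "D1 * D2"])
    show "0 \<le> D1 * D2" using D1 D2 by simp
    fix x t assume x: "x \<in> space M"
    have "\<bar>F x t\<bar> \<le> (e/2) * \<bar>t\<bar> powr q + D1 * \<bar>t\<bar>"
      using D1(2)[OF x, of t 0] by simp
    also have "\<dots> \<le> (e/2) * \<bar>t\<bar> powr q + D1 * ((e / (2 * (D1 + 1))) * \<bar>t\<bar> powr q + D2)"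
      using D1 D2(2)[of "\<bar>t\<bar>"] by (intro add_left_mono mult_left_mono) auto
    also have "D1 * ((e / (2 * (D1 + 1))) * \<bar>t\<bar> powr q + D2) \<le> (e/2) * \<bar>t\<bar> powr q + D1 * D2"
    proof -
      have "D1 * (e / (2 * (D1 + 1))) \<le> e/2" using D1 e by (simp add: field_simps)
      from mult_right_mono[OF this, of "\<bar>t\<bar> powr q"] show ?thesis by (simp add: algebra_simps)
    qed
    finally show "\<bar>F x t\<bar> \<le> e * \<bar>t\<bar> powr q + D1 * D2" by simp
  qed
qed

lemma F_integrable:
  assumes [measurable]: "u \<in> borel_measurable M" and u: "integrable M (\<lambda>x. \<bar>u x\<bar> powr q)"
  shows "integrable M (\<lambda>x. F x (u x))"
proof -
  obtain D where D: "0 \<le> D" "\<And>x t. x \<in> space M \<Longrightarrow> \<bar>F x t\<bar> \<le> 1 * \<bar>t\<bar> powr q + D"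
    using F_bound[of 1] by auto
  show ?thesis
  proof (rule Bochner_Integration.integrable_bound)
    show "integrable M (\<lambda>x. \<bar>u x\<bar> powr q + D)" using u by simp
    show "AE x in M. norm (F x (u x)) \<le> norm (\<bar>u x\<bar> powr q + D)"
      using D by (intro AE_I2) auto
  qed measurable
qed

definition \<Psi> :: "('a \<Rightarrow> real) \<Rightarrow> real" where
  "\<Psi> u = (\<integral>x. F x (u x) \<partial>M)"

lemma abs_integrable_if_powr_integrable:
  assumes [measurable]: "u \<in> borel_measurable M" and u: "integrable M (\<lambda>x. \<bar>u x\<bar> powr q)"
  shows "integrable M (\<lambda>x. u x :: real)"
proof (rule Bochner_Integration.integrable_bound)
  show "integrable M (\<lambda>x. 1 + \<bar>u x\<bar> powr q)" using u by simp
  show "AE x in M. norm (u x) \<le> norm (1 + \<bar>u x\<bar> powr q)"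
    using powr_exponent_le[of "\<bar>u _\<bar>" 1 q] q_gt_1 by (intro AE_I2) auto
qed measurable

text \<open>For bounded q-modulars the first term is uniformly small, and the second is governed by
  the L1 distance, the one for which Rellich's theorem gives convergence.\<close>

lemma \<Psi>_diff_bound:
  assumes e: "0 < e"
  obtains D where "0 \<le> D" "\<And>u v. u \<in> borel_measurable M \<Longrightarrow> v \<in> borel_measurable M \<Longrightarrow>
     integrable M (\<lambda>x. \<bar>u x\<bar> powr q) \<Longrightarrow> integrable M (\<lambda>x. \<bar>v x\<bar> powr q) \<Longrightarrow>
     \<bar>\<Psi> u - \<Psi> v\<bar> \<le> e * ((\<integral>x. \<bar>u x\<bar> powr q \<partial>M) + (\<integral>x. \<bar>v x\<bar> powr q \<partial>M)) + D * (\<integral>x. \<bar>u x - v x\<bar> \<partial>M)"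
proof -
  obtain D where D: "0 \<le> D" "\<And>x s t. x \<in> space M \<Longrightarrow>
     \<bar>F x s - F x t\<bar> \<le> e * (\<bar>s\<bar> powr q + \<bar>t\<bar> powr q) + D * \<bar>s - t\<bar>"
    using F_diff_bound[OF e] by blast
  show ?thesis
  proof (rule that[OF D(1)])
    fix u v assume [measurable]: "u \<in> borel_measurable M" "v \<in> borel_measurable M"
      and i: "integrable M (\<lambda>x. \<bar>u x\<bar> powr q)" "integrable M (\<lambda>x. \<bar>v x\<bar> powr q)"
    have iu: "integrable M u" "integrable M v"
      using i by (auto intro: abs_integrable_if_powr_integrable)
    have "\<bar>\<Psi> u - \<Psi> v\<bar> = \<bar>\<integral>x. F x (u x) - F x (v x) \<partial>M\<bar>"
      unfolding \<Psi>_def using i by (subst Bochner_Integration.integral_diff) (auto intro: F_integrable)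
    also have "\<dots> \<le> (\<integral>x. \<bar>F x (u x) - F x (v x)\<bar> \<partial>M)" by (rule integral_abs_bound)
    also have "\<dots> \<le> (\<integral>x. e * (\<bar>u x\<bar> powr q + \<bar>v x\<bar> powr q) + D * \<bar>u x - v x\<bar> \<partial>M)"
      using i iu D(2)
      by (intro integral_mono integrable_abs Bochner_Integration.integrable_diff F_integrable) auto
    also have "\<dots> = e * ((\<integral>x. \<bar>u x\<bar> powr q \<partial>M) + (\<integral>x. \<bar>v x\<bar> powr q \<partial>M)) + D * (\<integral>x. \<bar>u x - v x\<bar> \<partial>M)"
      using i iu by simp
    finally show "\<bar>\<Psi> u - \<Psi> v\<bar> \<le> e * ((\<integral>x. \<bar>u x\<bar> powr q \<partial>M) + (\<integral>x. \<bar>v x\<bar> powr q \<partial>M)) + D * (\<integral>x. \<bar>u x - v x\<bar> \<partial>M)" .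
  qed
qed


section \<open>Energy, coercivity and convexity defect\<close>

definition \<Phi> :: "('a \<Rightarrow> 'b) \<Rightarrow> real" where
  "\<Phi> g = (\<integral>x. norm (g x) powr p1 x / p1 x \<partial>M) + (\<integral>x. norm (g x) powr p2 x / p2 x \<partial>M)"

text \<open>Unlike \<open>\<Phi>\<close>, this sum of modulars carries no weights
  \<open>1 / p\<close>; it measures the size of a gradient in the coercivity and Cauchy
  estimates.\<close>

definition \<R> :: "('a \<Rightarrow> 'b) \<Rightarrow> real" where
  "\<R> g = (\<integral>x. norm (g x) powr p1 x \<partial>M) + (\<integral>x. norm (g x) powr p2 x \<partial>M)"

definition J :: "('a \<Rightarrow> real) \<Rightarrow> ('a \<Rightarrow> 'b) \<Rightarrow> real" where
  "J u g = \<Phi> g - \<Psi> u"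

lemma integrable_powr_div:
  fixes g :: "'a \<Rightarrow> 'b"
  assumes [measurable]: "p \<in> borel_measurable M" "g \<in> borel_measurable M"
    and p: "\<And>x. x \<in> space M \<Longrightarrow> q \<le> p x \<and> p x \<le> P"
    and i: "integrable M (\<lambda>x. norm (g x) powr p x)"
  shows "integrable M (\<lambda>x. norm (g x) powr p x / p x)"
proof (rule Bochner_Integration.integrable_bound[OF i])
  show "AE x in M. norm (norm (g x) powr p x / p x) \<le> norm (norm (g x) powr p x)"
  proof (rule AE_I2)
    fix x assume "x \<in> space M"
    then have "1 \<le> p x" using p[of x] q_gt_1 by linarith
    then show "norm (norm (g x) powr p x / p x) \<le> norm (norm (g x) powr p x)"
      using mult_left_mono[of 1 "p x" "norm (g x) powr p x"] by (simp add: divide_le_eq)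
  qed
qed measurable

lemma integral_powr_le_div:
  fixes g :: "'a \<Rightarrow> 'b"
  assumes [measurable]: "p \<in> borel_measurable M" "g \<in> borel_measurable M"
    and p: "\<And>x. x \<in> space M \<Longrightarrow> q \<le> p x \<and> p x \<le> P"
    and i: "integrable M (\<lambda>x. norm (g x) powr p x)"
  shows "(\<integral>x. norm (g x) powr p x \<partial>M) \<le> P * (\<integral>x. norm (g x) powr p x / p x \<partial>M)"
proof -
  have "(\<integral>x. norm (g x) powr p x \<partial>M) \<le> (\<integral>x. P * (norm (g x) powr p x / p x) \<partial>M)"
  proof (rule integral_mono[OF i])
    show "integrable M (\<lambda>x. P * (norm (g x) powr p x / p x))"
      by (intro Bochner_Integration.integrable_mult_right integrable_powr_div assms)
    fix x assume "x \<in> space M"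
    then have "1 < p x" "p x \<le> P" using p[of x] q_gt_1 by auto
    then show "norm (g x) powr p x \<le> P * (norm (g x) powr p x / p x)"
      by (simp add: field_simps mult_right_mono)
  qed
  then show ?thesis by (simp only: integral_mult_right_zero)
qed

lemma integrable_powr_q:
  fixes g :: "'a \<Rightarrow> 'b"
  assumes [measurable]: "p \<in> borel_measurable M" "g \<in> borel_measurable M"
    and p: "\<And>x. x \<in> space M \<Longrightarrow> q \<le> p x \<and> p x \<le> P"
    and i: "integrable M (\<lambda>x. norm (g x) powr p x)"
  shows "integrable M (\<lambda>x. norm (g x) powr q)"
    and "(\<integral>x. norm (g x) powr q \<partial>M) \<le> \<mu> + (\<integral>x. norm (g x) powr p x \<partial>M)"
proof -
  have le: "norm (g x) powr q \<le> 1 + norm (g x) powr p x" if "x \<in> space M" for x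
    using powr_exponent_le[of "norm (g x)" q "p x"] p[OF that] q_gt_1 by auto
  have i1: "integrable M (\<lambda>x. 1 + norm (g x) powr p x)" using i by simp
  show iq: "integrable M (\<lambda>x. norm (g x) powr q)"
    by (rule Bochner_Integration.integrable_bound[OF i1]) (use le in auto)
  have "(\<integral>x. norm (g x) powr q \<partial>M) \<le> (\<integral>x. 1 + norm (g x) powr p x \<partial>M)"
    using iq i1 le by (rule integral_mono)
  also have "\<dots> = \<mu> + (\<integral>x. norm (g x) powr p x \<partial>M)" using i by simp
  finally show "(\<integral>x. norm (g x) powr q \<partial>M) \<le> \<mu> + (\<integral>x. norm (g x) powr p x \<partial>M)" .
qed

lemma X_scale: "X u g \<Longrightarrow> X (\<lambda>x. c * u x) (\<lambda>x. c *\<^sub>R g x)"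
  using X_linear[OF X_zero, of u g c] by simp

lemma X_midpoint: "X u g \<Longrightarrow> X v h \<Longrightarrow> X (\<lambda>x. (1/2) * (u x + v x)) (\<lambda>x. (1/2) *\<^sub>R (g x + h x))"
  using X_scale[OF X_linear[of u g v h 1], of "1/2"] by simp

lemma X_diff: "X u g \<Longrightarrow> X v h \<Longrightarrow> X (\<lambda>x. u x - v x) (\<lambda>x. g x - h x)"
  using X_linear[of u g v h "-1"] by simp

lemma \<Phi>_nonneg: "0 \<le> \<Phi> g"
  unfolding \<Phi>_def
  by (intro add_nonneg_nonneg integral_nonneg_AE AE_I2 divide_nonneg_nonneg)
     (use p1_bounds p2_bounds q_gt_1 in \<open>force+\<close>)

lemma \<R>_le_\<Phi>:
  assumes "X u g"
  shows "\<R> g \<le> P * \<Phi> g"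
  unfolding \<R>_def \<Phi>_def distrib_left
  by (intro add_mono integral_powr_le_div p1_meas p2_meas X_grad_measurable[OF assms]
      X_integrable1[OF assms] X_integrable2[OF assms] p1_bounds p2_bounds)

text \<open>Poincare's inequality bounds the \<open>F\<close> term by a small multiple of the
  q-modular of the gradient, hence of \<open>\<R> g\<close> up to a constant, while
  \<open>\<Phi> g\<close> is at least \<open>\<R> g / P\<close>.\<close>

lemma J_coercive:
  obtains D where "\<And>u g. X u g \<Longrightarrow> \<R> g / (2 * P) - D \<le> J u g"
proof -
  have P: "1 < P" using q_gt_1 q_le_P by linarith
  \<comment> \<open>This makes \<open>e * K\<close> at most \<open>1 / (2 * P)\<close>, so the
    \<open>F\<close> term uses up at most half of \<open>\<R> g / P\<close>; the summand in
    \<open>K + 1\<close> avoids division by zero.\<close>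
  define e where "e = 1 / (2 * P * (K + 1))"
  have e: "0 < e" "e * K \<le> 1 / (2 * P)"
    using P K_nonneg by (auto simp: e_def divide_simps)
  obtain D0 where D0: "0 \<le> D0" "\<And>x t. x \<in> space M \<Longrightarrow> \<bar>F x t\<bar> \<le> e * \<bar>t\<bar> powr q + D0"
    using F_bound[OF e(1)] by blast
  show ?thesis
  proof (rule that)
    fix u g assume X: "X u g"
    note [measurable] = X_measurable[OF X] X_grad_measurable[OF X]
    have "\<Psi> u \<le> (\<integral>x. e * \<bar>u x\<bar> powr q + D0 \<partial>M)"
      unfolding \<Psi>_def using D0(2) X_integrable[OF X]
      by (intro integral_mono F_integrable) (auto simp: abs_le_iff)
    also have "\<dots> = e * (\<integral>x. \<bar>u x\<bar> powr q \<partial>M) + D0 * \<mu>"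
      using X_integrable[OF X] by simp
    also have "\<dots> \<le> e * (K * (\<integral>x. norm (g x) powr q \<partial>M)) + D0 * \<mu>"
      using X_poincare[OF X] e by (intro add_right_mono mult_left_mono) auto
    also have "e * (K * (\<integral>x. norm (g x) powr q \<partial>M)) \<le> 1 / (2 * P) * (\<integral>x. norm (g x) powr q \<partial>M)"
      using mult_right_mono[OF e(2), of "\<integral>x. norm (g x) powr q \<partial>M"] by simp
    also have "(\<integral>x. norm (g x) powr q \<partial>M) \<le> \<mu> + \<R> g"
    proof -
      have "0 \<le> (\<integral>x. norm (g x) powr p2 x \<partial>M)" by simp
      then show ?thesis
        using integrable_powr_q(2)[OF p1_meas X_grad_measurable[OF X] p1_bounds X_integrable1[OF X]]
        unfolding \<R>_def by linarith
    qed
    finally have "\<Psi> u \<le> \<R> g / (2 * P) + (\<mu> / (2 * P) + D0 * \<mu>)"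
      using P by (simp add: field_simps)
    moreover have "\<R> g / P \<le> \<Phi> g" using \<R>_le_\<Phi>[OF X] P by (simp add: field_simps)
    moreover have "\<R> g / P = 2 * (\<R> g / (2 * P))" using P by simp
    ultimately show "\<R> g / (2 * P) - (\<mu> / (2 * P) + D0 * \<mu>) \<le> J u g"
      unfolding J_def by linarith
  qed
qed

text \<open>The Jensen gap of the energy at the midpoint of \<open>g\<close> and \<open>h\<close>,
  for one exponent at a time.\<close>

definition defect :: "('a \<Rightarrow> real) \<Rightarrow> ('a \<Rightarrow> 'b) \<Rightarrow> ('a \<Rightarrow> 'b) \<Rightarrow> real" where
  "defect p g h = ((\<integral>x. norm (g x) powr p x / p x \<partial>M) + (\<integral>x. norm (h x) powr p x / p x \<partial>M)) / 2
     - (\<integral>x. norm ((1/2) *\<^sub>R (g x + h x)) powr p x / p x \<partial>M)"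

text \<open>Integration of \<open>norm_powr_uniformly_convex\<close>; the weight
  \<open>1 / p x\<close> of the energy costs the factor \<open>P\<close> in the constant.
  Nonnegativity of the defect is recorded as well, since later only the sum of two defects is
  bounded.\<close>

lemma integral_uniformly_convex:
  assumes e: "0 < e"
  obtains D where "0 \<le> D" "\<And>p g h. p \<in> borel_measurable M \<Longrightarrow> g \<in> borel_measurable M \<Longrightarrow> h \<in> borel_measurable M \<Longrightarrow>
     (\<And>x. x \<in> space M \<Longrightarrow> q \<le> p x \<and> p x \<le> P) \<Longrightarrow>
     integrable M (\<lambda>x. norm (g x) powr p x) \<Longrightarrow> integrable M (\<lambda>x. norm (h x) powr p x) \<Longrightarrow>
     integrable M (\<lambda>x. norm ((1/2) *\<^sub>R (g x + h x)) powr p x) \<Longrightarrow>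
     0 \<le> defect p g h \<and>
     (\<integral>x. norm (g x - h x) powr p x \<partial>M)
      \<le> e * ((\<integral>x. norm (g x) powr p x \<partial>M) + (\<integral>x. norm (h x) powr p x \<partial>M)) + D * defect p g h"
proof -
  obtain c where c: "0 \<le> c" "\<And>p (a::'b) b. q \<le> p \<Longrightarrow> p \<le> P \<Longrightarrow>
     norm (a - b) powr p \<le> e * (norm a powr p + norm b powr p)
       + c * ((norm a powr p + norm b powr p) / 2 - norm ((1/2) *\<^sub>R (a + b)) powr p)"
    using norm_powr_uniformly_convex[OF q_gt_1 e, of P] by blast
  show ?thesis
  proof (rule that[of "c * P"])
    show "0 \<le> c * P" using c q_gt_1 q_le_P by simp
    fix p :: "'a \<Rightarrow> real" and g h :: "'a \<Rightarrow> 'b"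
    assume pm [measurable]: "p \<in> borel_measurable M" and gm [measurable]: "g \<in> borel_measurable M"
      and hm [measurable]: "h \<in> borel_measurable M"
      and p: "\<And>x. x \<in> space M \<Longrightarrow> q \<le> p x \<and> p x \<le> P"
      and i: "integrable M (\<lambda>x. norm (g x) powr p x)" "integrable M (\<lambda>x. norm (h x) powr p x)"
        "integrable M (\<lambda>x. norm ((1/2) *\<^sub>R (g x + h x)) powr p x)"
    define d where "d x = (norm (g x) powr p x / p x + norm (h x) powr p x / p x) / 2
         - norm ((1/2) *\<^sub>R (g x + h x)) powr p x / p x" for x
    have mm [measurable]: "(\<lambda>x. (1/2) *\<^sub>R (g x + h x)) \<in> borel_measurable M" by measurable
    have id: "integrable M (\<lambda>x. norm (g x) powr p x / p x)" "integrable M (\<lambda>x. norm (h x) powr p x / p x)"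
      "integrable M (\<lambda>x. norm ((1/2) *\<^sub>R (g x + h x)) powr p x / p x)"
      by (intro integrable_powr_div pm gm hm mm p i; assumption)+
    have d: "integrable M d" "(\<integral>x. d x \<partial>M) = defect p g h"
      unfolding d_def defect_def using id by (simp_all del: norm_scaleR)
    have d_pos: "0 \<le> d x" if "x \<in> space M" for x
    proof -
      have "1 < p x" using p[OF that] q_gt_1 by linarith
      from norm_powr_midpoint_convex[OF this, of "g x" "h x"] this
      have "norm ((1/2) *\<^sub>R (g x + h x)) powr p x / p x \<le> (norm (g x) powr p x + norm (h x) powr p x) / 2 / p x"
        by (intro divide_right_mono) auto
      then show ?thesis unfolding d_def by (simp add: add_divide_distrib mult.commute del: norm_scaleR)
    qed
    have ineq: "norm (g x - h x) powr p x \<le> e * (norm (g x) powr p x + norm (h x) powr p x) + c * P * d x"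
      if x: "x \<in> space M" for x
    proof -
      have px: "1 < p x" "p x \<le> P" using p[OF x] q_gt_1 by auto
      define dd where "dd = (norm (g x) powr p x + norm (h x) powr p x) / 2 - norm ((1/2) *\<^sub>R (g x + h x)) powr p x"
      have "dd = p x * d x" using px by (simp add: d_def dd_def field_simps)
      then have "dd \<le> P * d x" using px d_pos[OF x] by (simp add: mult_right_mono)
      then have "c * dd \<le> c * P * d x" using c(1) mult_left_mono by (fastforce simp: mult.assoc)
      then show ?thesis using c(2)[of "p x" "g x" "h x"] p[OF x] unfolding dd_def by linarith
    qed
    have ib: "integrable M (\<lambda>x. e * (norm (g x) powr p x + norm (h x) powr p x) + c * P * d x)"
      using i d by simp
    have "(\<integral>x. norm (g x - h x) powr p x \<partial>M)
       \<le> (\<integral>x. e * (norm (g x) powr p x + norm (h x) powr p x) + c * P * d x \<partial>M)"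
    proof (rule integral_mono[OF _ ib ineq])
      show "integrable M (\<lambda>x. norm (g x - h x) powr p x)"
        by (rule Bochner_Integration.integrable_bound[OF ib]) (auto intro!: AE_I2 order_trans[OF ineq])
    qed
    also have "\<dots> = e * ((\<integral>x. norm (g x) powr p x \<partial>M) + (\<integral>x. norm (h x) powr p x \<partial>M)) + c * P * defect p g h"
      using i d by simp
    finally show "0 \<le> defect p g h \<and> (\<integral>x. norm (g x - h x) powr p x \<partial>M)
      \<le> e * ((\<integral>x. norm (g x) powr p x \<partial>M) + (\<integral>x. norm (h x) powr p x \<partial>M)) + c * P * defect p g h"
      using d_pos Bochner_Integration.integral_nonneg[of M d] d(2) by auto
  qed
qed

lemma defect_sum: "defect p1 g h + defect p2 g h = (\<Phi> g + \<Phi> h) / 2 - \<Phi> (\<lambda>x. (1/2) *\<^sub>R (g x + h x))"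
  by (simp add: defect_def \<Phi>_def field_simps)

text \<open>Along a minimising sequence that converges in \<open>L\<^sup>1\<close>, the lower order term \<open>\<Psi>\<close> has the same limit
  at the members and at their midpoints; minimality then forces the convexity defect of \<open>\<Phi>\<close> to vanish.\<close>

lemma minimising_defect_small:
  assumes X: "\<And>n::nat. X (u n) (g n)" and m: "\<And>v h. X v h \<Longrightarrow> m \<le> J v h"
    and J: "\<And>n. J (u n) (g n) \<le> m + 1 / real (Suc n)"
    and B: "\<And>n. (\<integral>x. \<bar>u n x\<bar> powr q \<partial>M) \<le> B"
    and cauchy: "\<forall>e>0. \<exists>N. \<forall>i\<ge>N. \<forall>j\<ge>N. (\<integral>x. \<bar>u i x - u j x\<bar> \<partial>M) < e"
    and \<eta>: "0 < \<eta>"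
  shows "\<exists>N. \<forall>i\<ge>N. \<forall>j\<ge>N. defect p1 (g i) (g j) + defect p2 (g i) (g j) \<le> \<eta>"
proof -
  have "0 \<le> (\<integral>x. \<bar>u 0 x\<bar> powr q \<partial>M)" by simp
  then have B0: "0 \<le> B" using B[of 0] by linarith
  obtain D where D: "0 \<le> D" "\<And>u v. u \<in> borel_measurable M \<Longrightarrow> v \<in> borel_measurable M \<Longrightarrow>
     integrable M (\<lambda>x. \<bar>u x\<bar> powr q) \<Longrightarrow> integrable M (\<lambda>x. \<bar>v x\<bar> powr q) \<Longrightarrow>
     \<bar>\<Psi> u - \<Psi> v\<bar> \<le> \<eta> / (8 * (B + 1)) * ((\<integral>x. \<bar>u x\<bar> powr q \<partial>M) + (\<integral>x. \<bar>v x\<bar> powr q \<partial>M)) + D * (\<integral>x. \<bar>u x - v x\<bar> \<partial>M)"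
    using \<Psi>_diff_bound[of "\<eta> / (8 * (B + 1))"] \<eta> B0 by auto
  have "0 < \<eta> / (2 * (D + 1))" using \<eta> D by simp
  with cauchy obtain N1 where N1: "\<And>i j. i \<ge> N1 \<Longrightarrow> j \<ge> N1 \<Longrightarrow> (\<integral>x. \<bar>u i x - u j x\<bar> \<partial>M) < \<eta> / (2 * (D + 1))"
    by meson
  obtain N2 where N2: "1 / real (Suc N2) < \<eta> / 2"
    using nat_approx_posE[of "\<eta> / 2"] \<eta> by auto
  have Jle: "J (u i) (g i) \<le> m + \<eta> / 2" if "i \<ge> N2" for i
  proof -
    have "1 / real (Suc i) \<le> 1 / real (Suc N2)" using that by (simp add: frac_le)
    then show ?thesis using J[of i] N2 by linarith
  qed
  have "defect p1 (g i) (g j) + defect p2 (g i) (g j) \<le> \<eta>" if ij: "i \<ge> max N1 N2" "j \<ge> max N1 N2" for i j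
  proof -
    define w where "w x = (1/2) * (u i x + u j x)" for x
    have Xw: "X w (\<lambda>x. (1/2) *\<^sub>R (g i x + g j x))"
      unfolding w_def using X_midpoint[OF X X] .
    have "(\<integral>x. \<bar>w x\<bar> powr q \<partial>M) \<le> (\<integral>x. (\<bar>u i x\<bar> powr q + \<bar>u j x\<bar> powr q) / 2 \<partial>M)"
    proof (rule integral_mono[OF X_integrable[OF Xw]])
      show "\<bar>w x\<bar> powr q \<le> (\<bar>u i x\<bar> powr q + \<bar>u j x\<bar> powr q) / 2" for x
        using norm_powr_midpoint_convex[OF q_gt_1, of "u i x" "u j x"] by (simp add: w_def abs_mult)
    qed (use X_integrable[OF X] in simp)
    also have "\<dots> = ((\<integral>x. \<bar>u i x\<bar> powr q \<partial>M) + (\<integral>x. \<bar>u j x\<bar> powr q \<partial>M)) / 2"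
      using X_integrable[OF X] by simp
    also have "\<dots> \<le> B" using B[of i] B[of j] by simp
    finally have wB: "(\<integral>x. \<bar>w x\<bar> powr q \<partial>M) \<le> B" .
    have key: "\<bar>\<Psi> (u k) - \<Psi> w\<bar> \<le> \<eta> / 2" if k: "k = i \<or> k = j" for k
    proof -
      have "\<bar>u k x - w x\<bar> = (1/2) * \<bar>u i x - u j x\<bar>" for x
        using k by (auto simp: w_def abs_if field_simps)
      then have eq: "(\<integral>x. \<bar>u k x - w x\<bar> \<partial>M) = (1/2) * (\<integral>x. \<bar>u i x - u j x\<bar> \<partial>M)"
        by (simp only: integral_mult_right_zero)
      have "(\<integral>x. \<bar>u i x - u j x\<bar> \<partial>M) \<le> \<eta> / (2 * (D + 1))"
        using N1[of i j] ij by simp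
      then have "(\<integral>x. \<bar>u k x - w x\<bar> \<partial>M) \<le> \<eta> / (4 * (D + 1))"
        unfolding eq using D by (simp add: field_simps)
      then have "D * (\<integral>x. \<bar>u k x - w x\<bar> \<partial>M) \<le> D * (\<eta> / (4 * (D + 1)))"
        using D(1) by (rule mult_left_mono)
      also have "\<dots> \<le> \<eta> / 4" using D \<eta> by (simp add: field_simps)
      finally have 1: "D * (\<integral>x. \<bar>u k x - w x\<bar> \<partial>M) \<le> \<eta> / 4" .
      have "\<eta> / (8 * (B + 1)) * ((\<integral>x. \<bar>u k x\<bar> powr q \<partial>M) + (\<integral>x. \<bar>w x\<bar> powr q \<partial>M)) \<le> \<eta> / (8 * (B + 1)) * (2 * B)"
        using B[of k] wB B0 \<eta> by (intro mult_left_mono) auto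
      also have "\<dots> \<le> \<eta> / 4" using B0 \<eta> by (simp add: field_simps)
      finally show ?thesis
        using D(2)[OF X_measurable[OF X] X_measurable[OF Xw] X_integrable[OF X] X_integrable[OF Xw], of k] 1
        by linarith
    qed
    have "m \<le> J w (\<lambda>x. (1/2) *\<^sub>R (g i x + g j x))" using m[OF Xw] .
    moreover have "J (u i) (g i) \<le> m + \<eta> / 2" "J (u j) (g j) \<le> m + \<eta> / 2" using Jle ij by auto
    moreover have "\<Psi> (u i) \<le> \<Psi> w + \<eta> / 2" "\<Psi> (u j) \<le> \<Psi> w + \<eta> / 2"
      using key[of i] key[of j] by linarith+
    \<comment> \<open>The members have \<open>J\<close> at most \<open>m + \<eta> / 2\<close>, their
      \<open>\<Psi>\<close> terms differ from \<open>\<Psi> w\<close> by at most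
      \<open>\<eta> / 2\<close>, and the midpoint has \<open>J\<close> at least \<open>m\<close>;
      averaging leaves a gap of at most \<open>\<eta>\<close>.\<close>
    ultimately show ?thesis
      unfolding defect_sum J_def by argo
  qed
  then show ?thesis by blast
qed

text \<open>Both defects are nonnegative, so each is small with their sum. In the uniform convexity
  estimate the part with the small factor is harmless, because the modulars are bounded by
  \<open>B\<close>.\<close>

lemma minimising_gradients_Cauchy:
  assumes X: "\<And>n::nat. X (u n) (g n)"
    and R: "\<And>n. \<R> (g n) \<le> B"
    and defect: "\<And>\<eta>. 0 < \<eta> \<Longrightarrow> \<exists>N. \<forall>i\<ge>N. \<forall>j\<ge>N. defect p1 (g i) (g j) + defect p2 (g i) (g j) \<le> \<eta>"
    and e: "0 < e"
  shows "\<exists>N. \<forall>i\<ge>N. \<forall>j\<ge>N. (\<integral>x. norm (g i x - g j x) powr p1 x \<partial>M) < e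
           \<and> (\<integral>x. norm (g i x - g j x) powr p2 x \<partial>M) < e"
proof -
  have nn: "0 \<le> (\<integral>x. norm (g n x) powr p1 x \<partial>M)" "0 \<le> (\<integral>x. norm (g n x) powr p2 x \<partial>M)" for n
    by auto
  have RB: "(\<integral>x. norm (g n x) powr p1 x \<partial>M) \<le> B" "(\<integral>x. norm (g n x) powr p2 x \<partial>M) \<le> B" for n
    using R[of n] nn[of n] unfolding \<R>_def by linarith+
  have B0: "0 \<le> B" using RB[of 0] nn[of 0] by linarith
  have e4: "0 < e / (4 * (B + 1))" using e B0 by simp
  obtain D where D: "0 \<le> D" "\<And>p g h. p \<in> borel_measurable M \<Longrightarrow> g \<in> borel_measurable M \<Longrightarrow> h \<in> borel_measurable M \<Longrightarrow>
     (\<And>x. x \<in> space M \<Longrightarrow> q \<le> p x \<and> p x \<le> P) \<Longrightarrow>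
     integrable M (\<lambda>x. norm (g x) powr p x) \<Longrightarrow> integrable M (\<lambda>x. norm (h x) powr p x) \<Longrightarrow>
     integrable M (\<lambda>x. norm ((1/2) *\<^sub>R (g x + h x)) powr p x) \<Longrightarrow>
     0 \<le> defect p g h \<and>
     (\<integral>x. norm (g x - h x) powr p x \<partial>M)
      \<le> e / (4 * (B + 1)) * ((\<integral>x. norm (g x) powr p x \<partial>M) + (\<integral>x. norm (h x) powr p x \<partial>M)) + D * defect p g h"
    using integral_uniformly_convex[OF e4] by blast
  obtain N where N: "\<And>i j. i \<ge> N \<Longrightarrow> j \<ge> N \<Longrightarrow> defect p1 (g i) (g j) + defect p2 (g i) (g j) \<le> e / (4 * (D + 1))"
    using defect[of "e / (4 * (D + 1))"] divide_pos_pos[of e "4 * (D + 1)"] e D(1) by fastforce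
  have "(\<integral>x. norm (g i x - g j x) powr p1 x \<partial>M) < e \<and> (\<integral>x. norm (g i x - g j x) powr p2 x \<partial>M) < e"
    if ij: "i \<ge> N" "j \<ge> N" for i j
  proof -
    note Xm = X_midpoint[OF X[of i] X[of j]]
    note d1 = D(2)[OF p1_meas X_grad_measurable[OF X] X_grad_measurable[OF X] p1_bounds
        X_integrable1[OF X] X_integrable1[OF X] X_integrable1[OF Xm]]
    note d2 = D(2)[OF p2_meas X_grad_measurable[OF X] X_grad_measurable[OF X] p2_bounds
        X_integrable2[OF X] X_integrable2[OF X] X_integrable2[OF Xm]]
    have small: "D * t \<le> e / 4" if "t \<le> e / (4 * (D + 1))" for t
    proof -
      have "D * t \<le> D * (e / (4 * (D + 1)))" using that D(1) by (rule mult_left_mono)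
      also have "\<dots> \<le> e / 4" using D e by (simp add: field_simps)
      finally show ?thesis .
    qed
    have small2: "e / (4 * (B + 1)) * (s + t) \<le> e / 2" if "s \<le> B" "t \<le> B" for s t
    proof -
      have "e / (4 * (B + 1)) * (s + t) \<le> e / (4 * (B + 1)) * (2 * B)"
        using that e4 by (intro mult_left_mono) auto
      also have "\<dots> \<le> e / 2" using B0 e by (simp add: field_simps)
      finally show ?thesis .
    qed
    have "defect p1 (g i) (g j) \<le> e / (4 * (D + 1))" "defect p2 (g i) (g j) \<le> e / (4 * (D + 1))"
      using N[OF ij] d1 d2 by linarith+
    then have "D * defect p1 (g i) (g j) \<le> e / 4" "D * defect p2 (g i) (g j) \<le> e / 4"
      using small by blast+
    then show ?thesis
      using d1 d2 small2[OF RB(1)[of i] RB(1)[of j]] small2[OF RB(2)[of i] RB(2)[of j]] e by linarith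
  qed
  then show ?thesis by blast
qed


text \<open>Almost everywhere limits along a common subsequence provide the candidates, the Cauchy
  property upgrades this to convergence of the whole sequence, \<open>X_closed\<close> makes the
  limit admissible, and Fatou's lemma gives lower semicontinuity of \<open>\<Phi>\<close>.\<close>

lemma J_minimiser_exists:
  obtains u g where "X u g" "\<And>v h. X v h \<Longrightarrow> J u g \<le> J v h"
proof -
  obtain D0 where D0: "\<And>u g. X u g \<Longrightarrow> \<R> g / (2 * P) - D0 \<le> J u g"
    using J_coercive by blast
  have P: "1 < P" using q_gt_1 q_le_P by linarith
  have R_nonneg: "0 \<le> \<R> g" for g by (simp add: \<R>_def)
  define S where "S = {J u g | u g. X u g}"
  define m where "m = Inf S"
  have S_ne: "S \<noteq> {}" using X_zero by (auto simp: S_def)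
  have S_bdd: "bdd_below S"
  proof (rule bdd_belowI)
    fix y assume "y \<in> S"
    then obtain u g where "X u g" "y = J u g" by (auto simp: S_def)
    moreover have "0 \<le> \<R> g / (2 * P)" using R_nonneg P by simp
    ultimately show "- D0 \<le> y" using D0[of u g] by linarith
  qed
  have m: "m \<le> J v h" if "X v h" for v h
    unfolding m_def using that S_bdd by (intro cInf_lower) (auto simp: S_def)
  have "\<exists>u g. X u g \<and> J u g < m + 1 / real (Suc n)" for n
  proof -
    have "Inf S < m + 1 / real (Suc n)" by (simp add: m_def)
    then obtain y where "y \<in> S" "y < m + 1 / real (Suc n)"
      using cInf_lessD[OF S_ne] by blast
    then show ?thesis by (auto simp: S_def)
  qed
  then obtain u0 g0 where X0: "\<And>n. X (u0 n) (g0 n)" and J0: "\<And>n. J (u0 n) (g0 n) < m + 1 / real (Suc n)"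
    by metis
  \<comment> \<open>Coercivity solved for \<open>\<R>\<close> at the level \<open>m + 1\<close>,
    which no member of the sequence exceeds.\<close>
  define B where "B = 2 * P * (m + 1 + D0)"
  have RB0: "\<R> (g0 n) \<le> B" for n
  proof -
    have "1 / real (Suc n) \<le> 1" by simp
    then have "\<R> (g0 n) / (2 * P) \<le> m + 1 + D0" using D0[OF X0[of n]] J0[of n] by linarith
    then show ?thesis using P by (simp add: B_def field_simps)
  qed
  have gq: "(\<integral>x. norm (g0 n x) powr q \<partial>M) \<le> \<mu> + B" for n
  proof -
    have "0 \<le> (\<integral>x. norm (g0 n x) powr p2 x \<partial>M)" by simp
    then show ?thesis
      using integrable_powr_q(2)[OF p1_meas X_grad_measurable[OF X0] p1_bounds X_integrable1[OF X0], of n] RB0[of n]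
      unfolding \<R>_def by linarith
  qed
  obtain r :: "nat \<Rightarrow> nat" where r: "strict_mono r"
      "\<forall>e>0. \<exists>N. \<forall>i\<ge>N. \<forall>j\<ge>N. (\<integral>x. \<bar>u0 (r i) x - u0 (r j) x\<bar> \<partial>M) < e"
    using X_compact[of u0 g0 "\<mu> + B", OF X0 gq] by blast
  define u g where "u n = u0 (r n)" and "g n = g0 (r n)" for n
  have X: "X (u n) (g n)" for n by (simp add: u_def g_def X0)
  have Jn: "J (u n) (g n) \<le> m + 1 / real (Suc n)" for n
  proof -
    have "1 / real (Suc (r n)) \<le> 1 / real (Suc n)" using seq_suble[OF r(1), of n] by (simp add: frac_le)
    then show ?thesis using J0[of "r n"] by (simp add: u_def g_def)
  qed
  have RB: "\<R> (g n) \<le> B" for n by (simp add: g_def RB0)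
  have uB: "(\<integral>x. \<bar>u n x\<bar> powr q \<partial>M) \<le> K * (\<mu> + B)" for n
    using X_poincare[OF X0[of "r n"]] mult_left_mono[OF gq[of "r n"] K_nonneg] by (simp add: u_def)
  have u_cauchy: "\<forall>e>0. \<exists>N. \<forall>i\<ge>N. \<forall>j\<ge>N. (\<integral>x. \<bar>u i x - u j x\<bar> \<partial>M) < e"
    using r(2) by (simp add: u_def)
  have g_cauchy: "\<exists>N. \<forall>i\<ge>N. \<forall>j\<ge>N. (\<integral>x. norm (g i x - g j x) powr p1 x \<partial>M) < e
           \<and> (\<integral>x. norm (g i x - g j x) powr p2 x \<partial>M) < e" if "0 < e" for e
  proof (rule minimising_gradients_Cauchy[of u g B])
    show "\<exists>N. \<forall>i\<ge>N. \<forall>j\<ge>N. defect p1 (g i) (g j) + defect p2 (g i) (g j) \<le> \<eta>" if "0 < \<eta>" for \<eta>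
      by (rule minimising_defect_small[of u g m "K * (\<mu> + B)"]) (fact X m Jn uB u_cauchy that)+
  qed (fact X RB that)+
  note u_meas [measurable] = X_measurable[OF X]
  note g_meas [measurable] = X_grad_measurable[OF X]
  have u_int: "integrable M (u n)" for n
    by (rule abs_integrable_if_powr_integrable[OF u_meas X_integrable[OF X]])
  have g_bound: "norm (g i x - g j x) \<le> \<delta> + \<delta> powr (1 - P) * norm (g i x - g j x) powr p1 x"
    if "x \<in> space M" "0 < \<delta>" "\<delta> \<le> 1" for i j x \<delta>
    using norm_powr_le_norm_powr[of 1 "p1 x" P \<delta> "g i x - g j x"] p1_bounds[OF that(1)] q_gt_1 that by auto
  have g_int: "integrable M (g n)" for n
  proof (rule Bochner_Integration.integrable_bound)
    show "integrable M (\<lambda>x. 1 + norm (g n x) powr p1 x)" using X_integrable1[OF X] by simp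
    show "AE x in M. norm (g n x) \<le> norm (1 + norm (g n x) powr p1 x)"
    proof (rule AE_I2)
      fix x assume "x \<in> space M"
      then show "norm (g n x) \<le> norm (1 + norm (g n x) powr p1 x)"
        using powr_exponent_le[of "norm (g n x)" 1 "p1 x"] p1_bounds[of x] q_gt_1 by auto
    qed
  qed measurable
  \<comment> \<open>The almost everywhere convergent subsequence is extracted in L1, so the Cauchy
    property is first carried over from the modular to exponent 1.\<close>
  have g_cauchy_L1: "\<exists>N. \<forall>i\<ge>N. \<forall>j\<ge>N. (\<integral>x. norm (g i x - g j x) \<partial>M) < e" if e: "0 < e" for e
  proof -
    \<comment> \<open>With this \<open>\<delta>\<close> the small values contribute at most
      \<open>e / 2\<close>; \<open>\<eta>\<close> is chosen afterwards to beat the large factor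
      \<open>\<delta> powr (1 - P)\<close> of the other term.\<close>
    define \<delta> where "\<delta> = min 1 (e / (2 * (\<mu> + 1)))"
    have \<mu>: "0 \<le> \<mu>" by simp
    have gen: "e / (2 * (t + 1)) * t \<le> e / 2" if "0 \<le> t" for t
      using e that by (simp add: divide_simps)
    have \<delta>: "0 < \<delta>" "\<delta> \<le> 1" "\<delta> * \<mu> \<le> e / 2"
    proof -
      show "0 < \<delta>" "\<delta> \<le> 1" using e \<mu> by (auto simp: \<delta>_def intro!: divide_pos_pos add_nonneg_pos)
      have "\<delta> * \<mu> \<le> (e / (2 * (\<mu> + 1))) * \<mu>" using \<mu> by (intro mult_right_mono) (auto simp: \<delta>_def)
      also have "\<dots> \<le> e / 2" by (rule gen[OF \<mu>])
      finally show "\<delta> * \<mu> \<le> e / 2" .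
    qed
    define \<eta> where "\<eta> = (e / 2) / \<delta> powr (1 - P)"
    have "0 < \<eta>" using e \<delta> by (simp add: \<eta>_def)
    then obtain N where N: "\<And>i j. i \<ge> N \<Longrightarrow> j \<ge> N \<Longrightarrow> (\<integral>x. norm (g i x - g j x) powr p1 x \<partial>M) < \<eta>"
      using g_cauchy by meson
    have "(\<integral>x. norm (g i x - g j x) \<partial>M) < e" if ij: "i \<ge> N" "j \<ge> N" for i j
    proof -
      have i1: "integrable M (\<lambda>x. norm (g i x - g j x) powr p1 x)"
        by (rule X_integrable1[OF X_diff[OF X X]])
      have "(\<integral>x. norm (g i x - g j x) \<partial>M) \<le> (\<integral>x. \<delta> + \<delta> powr (1 - P) * norm (g i x - g j x) powr p1 x \<partial>M)"
        using g_int i1 g_bound \<delta> by (intro integral_mono) auto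
      also have "\<dots> = \<delta> * \<mu> + \<delta> powr (1 - P) * (\<integral>x. norm (g i x - g j x) powr p1 x \<partial>M)"
        using i1 by simp
      also have "\<dots> < e / 2 + \<delta> powr (1 - P) * \<eta>"
        using \<delta> N[OF ij] by (intro add_le_less_mono mult_strict_left_mono) auto
      also have "\<dots> = e" using \<delta> by (simp add: \<eta>_def)
      finally show ?thesis .
    qed
    then show ?thesis by blast
  qed
  obtain r1 u' where r1: "strict_mono r1" "u' \<in> borel_measurable M" "AE x in M. (\<lambda>n. u (r1 n) x) \<longlonglongrightarrow> u' x"
    by (rule L1_Cauchy_AE_limit[of M u]) (use u_int u_cauchy in auto)
  have gr1: "\<exists>N. \<forall>i\<ge>N. \<forall>j\<ge>N. (\<integral>x. norm (g (r1 i) x - g (r1 j) x) \<partial>M) < e" if "0 < e" for e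
    using g_cauchy_L1[OF that] seq_suble[OF r1(1)] by (meson order_trans)
  \<comment> \<open>\<open>r2\<close> thins out \<open>r1\<close>, so that functions and gradients
    converge along the one subsequence \<open>s\<close>.\<close>
  obtain r2 g' where r2: "strict_mono r2" "g' \<in> borel_measurable M" "AE x in M. (\<lambda>n. g (r1 (r2 n)) x) \<longlonglongrightarrow> g' x"
    by (rule L1_Cauchy_AE_limit[of M "\<lambda>n. g (r1 n)"]) (use g_int gr1 in auto)
  define s where "s = r1 \<circ> r2"
  have s: "strict_mono s" unfolding s_def using r1(1) r2(1) by (rule strict_mono_o)
  have us: "AE x in M. (\<lambda>n. u (s n) x) \<longlonglongrightarrow> u' x"
    using r1(3)
  proof eventually_elim
    case (elim x)
    from LIMSEQ_subseq_LIMSEQ[OF this r2(1)] show ?case by (simp add: s_def comp_def)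
  qed
  have gs: "AE x in M. (\<lambda>n. g (s n) x) \<longlonglongrightarrow> g' x" using r2(3) by (simp add: s_def)
  note [measurable] = r1(2) r2(2)
  have u_lim: "(\<lambda>n. vmod M (\<lambda>x. 1) (\<lambda>x. u n x - u' x)) \<longlonglongrightarrow> 0"
  proof (rule vmod_Cauchy_tendsto_AE_limit[where w = u, OF u_meas _ _ s us])
    fix e :: real assume "e > 0"
    then obtain N where N: "\<And>i j. i \<ge> N \<Longrightarrow> j \<ge> N \<Longrightarrow> (\<integral>x. \<bar>u i x - u j x\<bar> \<partial>M) < e"
      using u_cauchy by meson
    have "vmod M (\<lambda>x. 1) (\<lambda>x. u i x - u j x) \<le> ennreal e" if "i \<ge> N" "j \<ge> N" for i j
      using N[OF that] u_int by (subst vmod_eq_integral) (auto intro!: ennreal_leI)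
    then show "\<exists>N. \<forall>i\<ge>N. \<forall>j\<ge>N. vmod M (\<lambda>x. 1) (\<lambda>x. u i x - u j x) \<le> ennreal e" by blast
  qed auto
  have g_lim1: "(\<lambda>n. vmod M p1 (\<lambda>x. g n x - g' x)) \<longlonglongrightarrow> 0"
  proof (rule vmod_Cauchy_tendsto_AE_limit[where w = g, OF g_meas p1_meas _ s gs])
    fix e :: real assume "e > 0"
    then obtain N where N: "\<And>i j. i \<ge> N \<Longrightarrow> j \<ge> N \<Longrightarrow> (\<integral>x. norm (g i x - g j x) powr p1 x \<partial>M) < e"
      using g_cauchy by meson
    have "vmod M p1 (\<lambda>x. g i x - g j x) \<le> ennreal e" if "i \<ge> N" "j \<ge> N" for i j
      using N[OF that] by (subst vmod_eq_integral[OF X_integrable1[OF X_diff[OF X X]]]) (auto intro!: ennreal_leI)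
    then show "\<exists>N. \<forall>i\<ge>N. \<forall>j\<ge>N. vmod M p1 (\<lambda>x. g i x - g j x) \<le> ennreal e" by blast
  next
    show "0 < p1 x" if "x \<in> space M" for x using p1_bounds[OF that] q_gt_1 by linarith
  qed
  have g_lim2: "(\<lambda>n. vmod M p2 (\<lambda>x. g n x - g' x)) \<longlonglongrightarrow> 0"
  proof (rule vmod_Cauchy_tendsto_AE_limit[where w = g, OF g_meas p2_meas _ s gs])
    fix e :: real assume "e > 0"
    then obtain N where N: "\<And>i j. i \<ge> N \<Longrightarrow> j \<ge> N \<Longrightarrow> (\<integral>x. norm (g i x - g j x) powr p2 x \<partial>M) < e"
      using g_cauchy by meson
    have "vmod M p2 (\<lambda>x. g i x - g j x) \<le> ennreal e" if "i \<ge> N" "j \<ge> N" for i j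
      using N[OF that] by (subst vmod_eq_integral[OF X_integrable2[OF X_diff[OF X X]]]) (auto intro!: ennreal_leI)
    then show "\<exists>N. \<forall>i\<ge>N. \<forall>j\<ge>N. vmod M p2 (\<lambda>x. g i x - g j x) \<le> ennreal e" by blast
  next
    show "0 < p2 x" if "x \<in> space M" for x using p2_bounds[OF that] q_gt_1 by linarith
  qed
  have X': "X u' g'"
    by (rule X_closed[of u g]) (fact X r1(2) r2(2) u_lim g_lim1 g_lim2)+
  have u'_int: "integrable M u'"
    by (rule abs_integrable_if_powr_integrable[OF _ X_integrable[OF X']]) measurable
  have u_lim': "(\<lambda>n. \<integral>x. \<bar>u n x - u' x\<bar> \<partial>M) \<longlonglongrightarrow> 0"
  proof -
    have "vmod M (\<lambda>x. 1) (\<lambda>x. u n x - u' x) = ennreal (\<integral>x. \<bar>u n x - u' x\<bar> \<partial>M)" for n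
      using u_int u'_int by (subst vmod_eq_integral) auto
    then show ?thesis using u_lim by (subst (asm) tendsto_cong[OF always_eventually]) (auto simp: ennreal_tendsto_0_iff)
  qed
  have \<Psi>_lim: "\<exists>N. \<forall>n\<ge>N. \<Psi> (u n) \<le> \<Psi> u' + e" if e: "0 < e" for e
  proof -
    define B2 where "B2 = K * (\<mu> + B) + (\<integral>x. \<bar>u' x\<bar> powr q \<partial>M)"
    have "0 \<le> (\<integral>x. \<bar>u 0 x\<bar> powr q \<partial>M)" "0 \<le> (\<integral>x. \<bar>u' x\<bar> powr q \<partial>M)" by simp_all
    then have B2: "0 \<le> B2" using uB[of 0] unfolding B2_def by linarith
    have "0 < e / (2 * (B2 + 1))" using e B2 by simp
    from \<Psi>_diff_bound[OF this] obtain D where D: "0 \<le> D" "\<And>u v. u \<in> borel_measurable M \<Longrightarrow> v \<in> borel_measurable M \<Longrightarrow>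
       integrable M (\<lambda>x. \<bar>u x\<bar> powr q) \<Longrightarrow> integrable M (\<lambda>x. \<bar>v x\<bar> powr q) \<Longrightarrow>
       \<bar>\<Psi> u - \<Psi> v\<bar> \<le> e / (2 * (B2 + 1)) * ((\<integral>x. \<bar>u x\<bar> powr q \<partial>M) + (\<integral>x. \<bar>v x\<bar> powr q \<partial>M)) + D * (\<integral>x. \<bar>u x - v x\<bar> \<partial>M)"
      by blast
    have "0 < e / (2 * (D + 1))" using e D by simp
    from order_tendstoD(2)[OF u_lim' this] obtain N
      where N: "\<And>n. n \<ge> N \<Longrightarrow> (\<integral>x. \<bar>u n x - u' x\<bar> \<partial>M) < e / (2 * (D + 1))"
      by (auto simp: eventually_sequentially)
    have "\<Psi> (u n) \<le> \<Psi> u' + e" if "n \<ge> N" for n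
    proof -
      have "D * (\<integral>x. \<bar>u n x - u' x\<bar> \<partial>M) \<le> D * (e / (2 * (D + 1)))"
        using D(1) N[OF that] by (intro mult_left_mono) auto
      also have "\<dots> \<le> e / 2" using D(1) e by (simp add: divide_simps)
      finally have 1: "D * (\<integral>x. \<bar>u n x - u' x\<bar> \<partial>M) \<le> e / 2" .
      have "e / (2 * (B2 + 1)) * ((\<integral>x. \<bar>u n x\<bar> powr q \<partial>M) + (\<integral>x. \<bar>u' x\<bar> powr q \<partial>M)) \<le> e / (2 * (B2 + 1)) * B2"
        using uB[of n] e B2 by (intro mult_left_mono) (auto simp: B2_def)
      also have "\<dots> \<le> e / 2" using B2 e by (simp add: divide_simps)
      finally show ?thesis
        using D(2)[OF u_meas[of n] r1(2) X_integrable[OF X] X_integrable[OF X']] 1 by linarith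
    qed
    then show ?thesis by blast
  qed
  \<comment> \<open>The integrand of \<open>\<Phi>\<close>; it is nonnegative and hence accessible
    to Fatou's lemma.\<close>
  define d where "d h x = norm (h x) powr p1 x / p1 x + norm (h x) powr p2 x / p2 x" for h :: "'a \<Rightarrow> 'b" and x
  have d_nonneg: "0 \<le> d h x" if "x \<in> space M" for h x
    using p1_bounds[OF that] p2_bounds[OF that] q_gt_1 by (auto simp: d_def intro!: add_nonneg_nonneg divide_nonneg_nonneg)
  have d_int: "(\<integral>\<^sup>+x. ennreal (d h x) \<partial>M) = ennreal (\<Phi> h)" if "X v h" for v h
  proof -
    have "integrable M (\<lambda>x. norm (h x) powr p1 x / p1 x)" "integrable M (\<lambda>x. norm (h x) powr p2 x / p2 x)"
      by (intro integrable_powr_div p1_meas p2_meas X_grad_measurable[OF that] X_integrable1[OF that]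
          X_integrable2[OF that] p1_bounds p2_bounds; assumption)+
    then have "integrable M (d h)" "(\<integral>x. d h x \<partial>M) = \<Phi> h"
      unfolding d_def \<Phi>_def by simp_all
    then show ?thesis by (subst nn_integral_eq_integral) (auto simp: d_nonneg)
  qed
  have d_meas [measurable]: "d (g n) \<in> borel_measurable M" for n unfolding d_def by measurable
  have "\<Phi> g' \<le> m + \<Psi> u' + e" if e: "0 < e" for e
  proof -
    obtain N1 where N1: "\<And>n. n \<ge> N1 \<Longrightarrow> \<Psi> (u n) \<le> \<Psi> u' + e / 2"
      using \<Psi>_lim[of "e / 2"] e by auto
    obtain N2 where N2: "1 / real (Suc N2) < e / 2" using nat_approx_posE[of "e / 2"] e by auto
    have le: "\<Phi> (g n) \<le> m + \<Psi> u' + e" if "n \<ge> max N1 N2" for n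
    proof -
      have "1 / real (Suc n) \<le> 1 / real (Suc N2)" using that by (simp add: frac_le)
      then show ?thesis using Jn[of n] N1[of n] N2 that unfolding J_def by simp
    qed
    \<comment> \<open>The comparison is made in \<open>ennreal\<close>, where a negative bound would
      be cut off to 0 and could not be read back as a real inequality.\<close>
    have nn: "0 \<le> m + \<Psi> u' + e" using le[of "max N1 N2"] \<Phi>_nonneg[of "g (max N1 N2)"] by simp
    have "ennreal (\<Phi> g') = (\<integral>\<^sup>+x. ennreal (d g' x) \<partial>M)" using d_int[OF X'] by simp
    also have "\<dots> \<le> (\<integral>\<^sup>+x. liminf (\<lambda>k. ennreal (d (g (s k)) x)) \<partial>M)"
    proof (rule nn_integral_mono_AE, use gs AE_space in eventually_elim)
      case (elim x)
      have "0 < p1 x" "0 < p2 x" using p1_bounds[of x] p2_bounds[of x] q_gt_1 elim by auto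
      then have "(\<lambda>k. ennreal (d (g (s k)) x)) \<longlonglongrightarrow> ennreal (d g' x)"
        unfolding d_def
        by (intro tendsto_ennrealI tendsto_add tendsto_divide tendsto_powr2 tendsto_norm tendsto_const elim always_eventually) auto
      then show ?case using lim_imp_Liminf[OF sequentially_bot] by (metis order_refl)
    qed
    also have "\<dots> \<le> liminf (\<lambda>k. \<integral>\<^sup>+x. ennreal (d (g (s k)) x) \<partial>M)"
      by (rule nn_integral_liminf) measurable
    also have "\<dots> = liminf (\<lambda>k. ennreal (\<Phi> (g (s k))))" by (simp add: d_int[OF X])
    also have "\<dots> \<le> ennreal (m + \<Psi> u' + e)"
    proof (rule Liminf_le)
      show "\<forall>\<^sub>F k in sequentially. ennreal (\<Phi> (g (s k))) \<le> ennreal (m + \<Psi> u' + e)"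
        using eventually_ge_at_top[of "max N1 N2"]
        by eventually_elim (use le seq_suble[OF s] in \<open>blast intro: order_trans ennreal_leI\<close>)
    qed simp
    finally show ?thesis using nn by (simp add: ennreal_le_iff)
  qed
  then have "\<Phi> g' \<le> m + \<Psi> u'" by (rule field_le_epsilon)
  then have "J u' g' \<le> m" by (simp add: J_def)
  then show ?thesis using that[OF X'] m by force
qed


section \<open>First variation of the energy\<close>

lemma powr_flux_bound:
  fixes w k :: 'b
  assumes "1 < p" "norm w \<le> s" "norm k \<le> s"
  shows "\<bar>norm w powr (p - 2) * (w \<bullet> k)\<bar> \<le> s powr p"
proof (cases "w = 0")
  case False
  then have w: "0 < norm w" by simp
  have s: "0 < s" using w assms by linarith
  have "\<bar>norm w powr (p - 2) * (w \<bullet> k)\<bar> \<le> norm w powr (p - 2) * (norm w * norm k)"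
    unfolding abs_mult using Cauchy_Schwarz_ineq2[of w k] by (intro mult_mono) auto
  also have "\<dots> = norm w powr (p - 1) * norm k"
    using w powr_add[of "norm w" "p - 2" 1] by simp
  also have "\<dots> \<le> s powr (p - 1) * s"
    using assms s by (intro mult_mono powr_mono2) auto
  also have "\<dots> = s powr p" using s powr_add[of s "p - 1" 1] by simp
  finally show ?thesis .
qed simp

text \<open>For \<open>\<bar>t\<bar> < 1\<close> the norms of \<open>g x + t *\<^sub>R h x\<close>
  and \<open>h x\<close> are at most \<open>norm (g x) + norm (h x)\<close>, and the integrable
  power \<open>p x\<close> of this sum dominates the derivative.\<close>

lemma energy_has_derivative:
  fixes g h :: "'a \<Rightarrow> 'b"
  assumes [measurable]: "p \<in> borel_measurable M" "g \<in> borel_measurable M" "h \<in> borel_measurable M"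
    and p: "\<And>x. x \<in> space M \<Longrightarrow> q \<le> p x \<and> p x \<le> P"
    and i: "integrable M (\<lambda>x. norm (g x) powr p x)" "integrable M (\<lambda>x. norm (h x) powr p x)"
      "\<And>t. integrable M (\<lambda>x. norm (g x + t *\<^sub>R h x) powr p x)"
  shows "integrable M (\<lambda>x. norm (g x) powr (p x - 2) * (g x \<bullet> h x))"
    and "((\<lambda>t. \<integral>x. norm (g x + t *\<^sub>R h x) powr p x / p x \<partial>M) has_real_derivative
          (\<integral>x. norm (g x) powr (p x - 2) * (g x \<bullet> h x) \<partial>M)) (at 0)"
proof -
  define B where "B x = 2 powr P * (norm (g x) powr p x + norm (h x) powr p x)" for x
  have B: "integrable M B" unfolding B_def using i by simp
  have bound: "\<bar>norm (g x + t *\<^sub>R h x) powr (p x - 2) * ((g x + t *\<^sub>R h x) \<bullet> h x)\<bar> \<le> B x"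
    if x: "x \<in> space M" and t: "\<bar>t\<bar> < 1" for x t
  proof -
    have px: "1 < p x" "p x \<le> P" using p[OF x] q_gt_1 by auto
    have "norm (t *\<^sub>R h x) \<le> norm (h x)" using t by (simp add: mult_left_le_one_le)
    then have "norm (g x + t *\<^sub>R h x) \<le> norm (g x) + norm (h x)"
      using norm_triangle_ineq[of "g x" "t *\<^sub>R h x"] by linarith
    then have "\<bar>norm (g x + t *\<^sub>R h x) powr (p x - 2) * ((g x + t *\<^sub>R h x) \<bullet> h x)\<bar>
        \<le> (norm (g x) + norm (h x)) powr p x"
      by (intro powr_flux_bound px) auto
    also have "\<dots> \<le> B x"
      using powr_norm_add_le[of "p x" P "norm (g x)" "norm (h x)"] px by (simp add: B_def)
    finally show ?thesis .
  qed
  show "integrable M (\<lambda>x. norm (g x) powr (p x - 2) * (g x \<bullet> h x))"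
    by (rule Bochner_Integration.integrable_bound[OF B])
       (use bound[of _ 0] in \<open>auto intro!: AE_I2 intro: order_trans[OF _ abs_ge_self]\<close>)
  have "((\<lambda>t. \<integral>x. norm (g x + t *\<^sub>R h x) powr p x / p x \<partial>M) has_real_derivative
      (\<integral>x. norm (g x + 0 *\<^sub>R h x) powr (p x - 2) * ((g x + 0 *\<^sub>R h x) \<bullet> h x) \<partial>M)) (at 0)"
  proof (rule has_real_derivative_lebesgue_integral[where B = B])
    show "integrable M (\<lambda>x. norm (g x + t *\<^sub>R h x) powr p x / p x)" for t
      by (rule integrable_powr_div) (use p i in auto)
    fix x t assume x: "x \<in> space M"
    have "1 < p x" using p[OF x] q_gt_1 by linarith
    note D = norm_powr_has_derivative[OF this, of "g x + t *\<^sub>R h x"]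
    have "((\<lambda>t. g x + t *\<^sub>R h x) has_derivative (\<lambda>s. s *\<^sub>R h x)) (at t)"
      by (auto intro!: derivative_eq_intros)
    from has_derivative_compose[OF this D]
    show "((\<lambda>t. norm (g x + t *\<^sub>R h x) powr p x / p x) has_real_derivative
        norm (g x + t *\<^sub>R h x) powr (p x - 2) * ((g x + t *\<^sub>R h x) \<bullet> h x)) (at t)"
      unfolding has_field_derivative_def by (rule has_derivative_eq_rhs) (auto simp: fun_eq_iff)
  qed (use bound B in auto)
  then show "((\<lambda>t. \<integral>x. norm (g x + t *\<^sub>R h x) powr p x / p x \<partial>M) has_real_derivative
          (\<integral>x. norm (g x) powr (p x - 2) * (g x \<bullet> h x) \<partial>M)) (at 0)" by simp
qed

text \<open>With \<open>s = \<bar>u x\<bar> + \<bar>v x\<bar>\<close> the derivative is at most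
  \<open>C * (s + s powr b)\<close>; since \<open>b < q\<close>, both powers are dominated by
  \<open>1 + s powr q\<close>.\<close>

lemma \<Psi>_has_derivative:
  assumes [measurable]: "u \<in> borel_measurable M" "v \<in> borel_measurable M"
    and i: "integrable M (\<lambda>x. \<bar>u x\<bar> powr q)" "integrable M (\<lambda>x. \<bar>v x\<bar> powr q)"
      "\<And>t. integrable M (\<lambda>x. \<bar>u x + t * v x\<bar> powr q)"
  shows "integrable M (\<lambda>x. f x (u x) * v x)"
    and "((\<lambda>t. \<Psi> (\<lambda>x. u x + t * v x)) has_real_derivative (\<integral>x. f x (u x) * v x \<partial>M)) (at 0)"
proof -
  define B where "B x = C * (2 + 2 * (2 powr q * (\<bar>u x\<bar> powr q + \<bar>v x\<bar> powr q)))" for x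
  have B: "integrable M B" unfolding B_def using i by simp
  have bound: "\<bar>f x (u x + t * v x) * v x\<bar> \<le> B x" if x: "x \<in> space M" and t: "\<bar>t\<bar> < 1" for x t
  proof -
    define s where "s = \<bar>u x\<bar> + \<bar>v x\<bar>"
    have s: "0 \<le> s" by (simp add: s_def)
    have "\<bar>t * v x\<bar> \<le> \<bar>v x\<bar>" using t by (simp add: abs_mult mult_left_le_one_le)
    then have ws: "\<bar>u x + t * v x\<bar> \<le> s" unfolding s_def by linarith
    have "\<bar>f x (u x + t * v x)\<bar> \<le> C * (1 + \<bar>u x + t * v x\<bar> powr (b - 1))" by (rule f_growth[OF x])
    also have "\<dots> \<le> C * (1 + s powr (b - 1))"
      using ws b_gt_1 C_nonneg by (intro mult_left_mono add_left_mono powr_mono2) auto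
    finally have "\<bar>f x (u x + t * v x) * v x\<bar> \<le> C * (1 + s powr (b - 1)) * s"
      unfolding abs_mult using s C_nonneg by (intro mult_mono) (auto simp: s_def)
    also have "\<dots> = C * (s powr 1 + s powr b)"
      using s powr_add[of s "b - 1" 1] by (cases "s = 0") (auto simp: algebra_simps)
    also have "\<dots> \<le> C * ((1 + s powr q) + (1 + s powr q))"
      using s C_nonneg b_gt_1 b_less by (intro mult_left_mono add_mono powr_exponent_le) auto
    also have "\<dots> \<le> B x"
      using powr_norm_add_le[of q q "\<bar>u x\<bar>" "\<bar>v x\<bar>"] q_gt_1 C_nonneg
      unfolding B_def by (intro mult_left_mono) (auto simp: s_def)
    finally show ?thesis .
  qed
  show "integrable M (\<lambda>x. f x (u x) * v x)"
    by (rule Bochner_Integration.integrable_bound[OF B])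
       (use bound[of _ 0] in \<open>auto intro!: AE_I2 intro: order_trans[OF _ abs_ge_self]\<close>)
  have "((\<lambda>t. \<integral>x. F x (u x + t * v x) \<partial>M) has_real_derivative
      (\<integral>x. f x (u x + 0 * v x) * v x \<partial>M)) (at 0)"
  proof (rule has_real_derivative_lebesgue_integral[where B = B])
    show "integrable M (\<lambda>x. F x (u x + t * v x))" for t
      by (rule F_integrable) (use i in auto)
    fix x t assume x: "x \<in> space M"
    have "((\<lambda>t. u x + t * v x) has_real_derivative v x) (at t)"
      by (auto intro!: derivative_eq_intros)
    with F_has_derivative[OF x] show "((\<lambda>t. F x (u x + t * v x)) has_real_derivative f x (u x + t * v x) * v x) (at t)"
      by (rule DERIV_chain2)
  qed (use bound B in auto)
  then show "((\<lambda>t. \<Psi> (\<lambda>x. u x + t * v x)) has_real_derivative (\<integral>x. f x (u x) * v x \<partial>M)) (at 0)"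
    by (simp add: \<Psi>_def)
qed

text \<open>The space is closed under \<open>u + t v\<close>, so \<open>J\<close> restricted to this
  line has a minimum at \<open>t = 0\<close> and its derivative there, computed term by term,
  vanishes.\<close>

theorem euler_lagrange:
  obtains u g where "X u g" "\<And>v h. X v h \<Longrightarrow>
     integrable M (\<lambda>x. norm (g x) powr (p1 x - 2) * (g x \<bullet> h x)) \<and>
     integrable M (\<lambda>x. norm (g x) powr (p2 x - 2) * (g x \<bullet> h x)) \<and>
     integrable M (\<lambda>x. f x (u x) * v x) \<and>
     (\<integral>x. norm (g x) powr (p1 x - 2) * (g x \<bullet> h x) \<partial>M) + (\<integral>x. norm (g x) powr (p2 x - 2) * (g x \<bullet> h x) \<partial>M)
       = (\<integral>x. f x (u x) * v x \<partial>M)"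
proof -
  obtain u g where X: "X u g" and min: "\<And>v h. X v h \<Longrightarrow> J u g \<le> J v h"
    using J_minimiser_exists by blast
  show ?thesis
  proof (rule that[OF X])
    fix v h assume Xv: "X v h"
    note Xt = X_linear[OF X Xv]
    note d1 = energy_has_derivative[OF p1_meas X_grad_measurable[OF X] X_grad_measurable[OF Xv] p1_bounds
        X_integrable1[OF X] X_integrable1[OF Xv] X_integrable1[OF Xt]]
    note d2 = energy_has_derivative[OF p2_meas X_grad_measurable[OF X] X_grad_measurable[OF Xv] p2_bounds
        X_integrable2[OF X] X_integrable2[OF Xv] X_integrable2[OF Xt]]
    note d3 = \<Psi>_has_derivative[OF X_measurable[OF X] X_measurable[OF Xv]
        X_integrable[OF X] X_integrable[OF Xv] X_integrable[OF Xt]]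
    have "((\<lambda>t. J (\<lambda>x. u x + t * v x) (\<lambda>x. g x + t *\<^sub>R h x)) has_real_derivative
       (\<integral>x. norm (g x) powr (p1 x - 2) * (g x \<bullet> h x) \<partial>M) + (\<integral>x. norm (g x) powr (p2 x - 2) * (g x \<bullet> h x) \<partial>M)
       - (\<integral>x. f x (u x) * v x \<partial>M)) (at 0)"
      unfolding J_def \<Phi>_def by (intro DERIV_add DERIV_diff d1(2) d2(2) d3(2))
    then have "(\<integral>x. norm (g x) powr (p1 x - 2) * (g x \<bullet> h x) \<partial>M) + (\<integral>x. norm (g x) powr (p2 x - 2) * (g x \<bullet> h x) \<partial>M)
       - (\<integral>x. f x (u x) * v x \<partial>M) = 0"
    proof (rule DERIV_local_min[where d = 1])
      show "\<forall>y. \<bar>0 - y\<bar> < 1 \<longrightarrow> J (\<lambda>x. u x + 0 * v x) (\<lambda>x. g x + 0 *\<^sub>R h x)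
          \<le> J (\<lambda>x. u x + y * v x) (\<lambda>x. g x + y *\<^sub>R h x)"
        using min[OF Xt] by simp
    qed simp
    then show "integrable M (\<lambda>x. norm (g x) powr (p1 x - 2) * (g x \<bullet> h x)) \<and>
     integrable M (\<lambda>x. norm (g x) powr (p2 x - 2) * (g x \<bullet> h x)) \<and>
     integrable M (\<lambda>x. f x (u x) * v x) \<and>
     (\<integral>x. norm (g x) powr (p1 x - 2) * (g x \<bullet> h x) \<partial>M) + (\<integral>x. norm (g x) powr (p2 x - 2) * (g x \<bullet> h x) \<partial>M)
       = (\<integral>x. f x (u x) * v x \<partial>M)"
      using d1(1) d2(1) d3(1) by simp
  qed
qed

end

section \<open>Translation estimates\<close>

lemma nn_integral_lborel_translate:
  fixes c :: "'a::euclidean_space"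
  assumes [measurable]: "f \<in> borel_measurable borel"
  shows "(\<integral>\<^sup>+x. f (c + x) \<partial>lborel) = (\<integral>\<^sup>+x. f x \<partial>lborel)"
proof -
  have "(\<integral>\<^sup>+x. f x \<partial>lborel) = (\<integral>\<^sup>+x. f x \<partial>distr lborel borel ((+) c))"
    by (simp add: lborel_distr_plus)
  also have "\<dots> = (\<integral>\<^sup>+x. f (c + x) \<partial>lborel)"
    by (rule nn_integral_distr) auto
  finally show ?thesis ..
qed

text \<open>Convexity on the open half-line gives the tangent bound for \<open>t > 0\<close>; at the
  boundary point \<open>t = 0\<close> it reduces to \<open>s \<ge> 1\<close>.\<close>

lemma powr_above_tangent:
  fixes s t m :: real
  assumes "1 \<le> s" "0 \<le> t" "0 < m"
  shows "m powr s + s * m powr (s - 1) * (t - m) \<le> t powr s"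
proof (cases "t = 0")
  case True
  have "m powr s = m powr (s - 1) * m" using powr_add[of m "s - 1" 1] assms by simp
  then show ?thesis using assms True by (simp add: algebra_simps mult_right_mono)
next
  case False
  have "s * m powr (s - 1) * (t - m) \<le> t powr s - m powr s"
  proof (rule convex_on_imp_above_tangent[OF powr_convex[OF assms(1)]])
    show "((\<lambda>x. x powr s) has_real_derivative s * m powr (s - 1)) (at m within {0<..})"
      by (rule has_field_derivative_at_within, rule has_real_derivative_powr[OF assms(3)])
  qed (use assms False in \<open>auto simp: interior_open\<close>)
  then show ?thesis by simp
qed

text \<open>Jensen's inequality, by integrating the tangent at the mean value, where the linear term
  cancels.\<close>

lemma (in finite_measure) powr_average_le:
  fixes h :: "'a \<Rightarrow> real"
  assumes V: "0 < measure M (space M)" and s: "1 \<le> s"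
    and i: "integrable M h" "integrable M (\<lambda>x. h x powr s)" and h: "\<And>x. x \<in> space M \<Longrightarrow> 0 \<le> h x"
  shows "((\<integral>x. h x \<partial>M) / measure M (space M)) powr s \<le> (\<integral>x. h x powr s \<partial>M) / measure M (space M)"
proof -
  define V where "V = measure M (space M)"
  define m where "m = (\<integral>x. h x \<partial>M) / V"
  have V0: "0 < V" using V by (simp add: V_def)
  have "0 \<le> (\<integral>x. h x \<partial>M)" using h by (intro integral_nonneg_AE AE_I2)
  then have "0 \<le> m" using V0 by (simp add: m_def)
  show ?thesis
  proof (cases "m = 0")
    case True
    moreover have "0 \<le> (\<integral>x. h x powr s \<partial>M) / V" using V0 by simp
    ultimately show ?thesis unfolding V_def[symmetric] m_def[symmetric] by simp
  next
    case False
    with \<open>0 \<le> m\<close> have m: "0 < m" by simp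
    have "(\<integral>x. m powr s + s * m powr (s - 1) * (h x - m) \<partial>M) \<le> (\<integral>x. h x powr s \<partial>M)"
      using i h powr_above_tangent[OF s _ m] by (intro integral_mono) auto
    also have "(\<integral>x. m powr s + s * m powr (s - 1) * (h x - m) \<partial>M)
        = m powr s * V + s * m powr (s - 1) * ((\<integral>x. h x \<partial>M) - m * V)"
      using i by (simp add: V_def)
    also have "(\<integral>x. h x \<partial>M) - m * V = 0" using V0 by (simp add: m_def)
    finally have "m powr s * V \<le> (\<integral>x. h x powr s \<partial>M)" by simp
    then show ?thesis using V0 by (simp add: m_def V_def field_simps)
  qed
qed

text \<open>Jensen's inequality prepared for two uses, averages over a segment and over a ball. The
  result is in \<open>ennreal\<close>, so that Tonelli's theorem can be applied directly
  afterwards.\<close>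

lemma powr_abs_average_le:
  fixes k :: "'c::euclidean_space \<Rightarrow> real" and h :: "'c \<Rightarrow> real"
  assumes A: "compact A" and V: "0 < measure lborel A" and s: "1 \<le> s"
    and k: "continuous_on A k" and h: "continuous_on A h" and le: "\<And>y. y \<in> A \<Longrightarrow> \<bar>k y\<bar> \<le> h y"
  shows "ennreal (\<bar>(LINT y|lborel. indicator A y *\<^sub>R k y) / measure lborel A\<bar> powr s)
     \<le> (\<integral>\<^sup>+y. ennreal (h y powr s) * indicator A y \<partial>lborel) / ennreal (measure lborel A)"
proof -
  define N where "N = restrict_space lborel A"
  have A_sets: "A \<in> sets lborel" using A by (simp add: borel_compact)
  have fin: "emeasure lborel A < \<infinity>" using A by (rule emeasure_compact_finite) 
  interpret N: finite_measure N
    using fin A_sets by (intro finite_measureI) (simp add: N_def emeasure_restrict_space space_restrict_space)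
  have NV: "measure N (space N) = measure lborel A"
    using A_sets by (simp add: N_def measure_restrict_space space_restrict_space)
  have int: "integrable N j" if "continuous_on A j" for j :: "'c \<Rightarrow> real"
    using borel_integrable_compact[OF A that] A_sets
    by (simp add: N_def integrable_restrict_space set_integrable_def)
  have hp: "continuous_on A (\<lambda>y. h y powr s)"
    using s le by (intro continuous_on_powr' h continuous_intros) (smt (verit))
  have h0: "0 \<le> h y" if "y \<in> A" for y using le[OF that] by linarith
  have "\<bar>LINT y|lborel. indicator A y *\<^sub>R k y\<bar> = \<bar>\<integral>y. k y \<partial>N\<bar>"
    using A_sets by (simp add: N_def integral_restrict_space)
  also have "\<dots> \<le> (\<integral>y. \<bar>k y\<bar> \<partial>N)" by (rule integral_abs_bound)
  also have "\<dots> \<le> (\<integral>y. h y \<partial>N)"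
    using int[OF k] int[OF h] le by (intro integral_mono) (auto simp: N_def space_restrict_space)
  finally have "\<bar>(LINT y|lborel. indicator A y *\<^sub>R k y) / measure lborel A\<bar> \<le> (\<integral>y. h y \<partial>N) / measure lborel A"
    using V by (simp add: abs_divide divide_right_mono)
  then have "\<bar>(LINT y|lborel. indicator A y *\<^sub>R k y) / measure lborel A\<bar> powr s
     \<le> ((\<integral>y. h y \<partial>N) / measure lborel A) powr s"
    using s by (intro powr_mono2) auto
  also have "\<dots> \<le> (\<integral>y. h y powr s \<partial>N) / measure lborel A"
    using N.powr_average_le[of s h] V s int[OF h] int[OF hp] h0
    by (simp add: NV) (simp add: N_def space_restrict_space)
  finally have "ennreal (\<bar>(LINT y|lborel. indicator A y *\<^sub>R k y) / measure lborel A\<bar> powr s)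
     \<le> ennreal ((\<integral>y. h y powr s \<partial>N) / measure lborel A)" by (rule ennreal_leI)
  also have "\<dots> = ennreal (\<integral>y. h y powr s \<partial>N) / ennreal (measure lborel A)"
    using V by (subst divide_ennreal) auto
  also have "ennreal (\<integral>y. h y powr s \<partial>N) = (\<integral>\<^sup>+y. ennreal (h y powr s) \<partial>N)"
    using int[OF hp] by (subst nn_integral_eq_integral) auto
  also have "\<dots> = (\<integral>\<^sup>+y. ennreal (h y powr s) * indicator A y \<partial>lborel)"
    using A_sets by (simp add: N_def nn_integral_restrict_space)
  finally show ?thesis .
qed

text \<open>The gradient \<open>G\<close> is a parameter, which allows a product of test functions
  to enter with its gradient written out by the product rule.\<close>

locale C1_function =
  fixes \<phi> :: "'a::euclidean_space \<Rightarrow> real" and G :: "'a \<Rightarrow> 'a"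
  assumes deriv: "\<And>x. (\<phi> has_derivative (\<lambda>h. G x \<bullet> h)) (at x)"
    and cont_G: "continuous_on UNIV G"
begin

lemma G_measurable [measurable]: "G \<in> borel_measurable borel"
  using cont_G by (rule borel_measurable_continuous_onI)

lemma cont: "continuous_on UNIV \<phi>"
  by (rule continuous_at_imp_continuous_on, rule ballI, rule has_derivative_continuous[OF deriv])

lemma measurable [measurable]: "\<phi> \<in> borel_measurable borel"
  using cont by (rule borel_measurable_continuous_onI)

text \<open>The fundamental theorem of calculus along the segment from \<open>x\<close> to
  \<open>x + y\<close>, followed by Jensen's inequality on the unit interval.\<close>

lemma translation_pointwise:
  assumes s: "1 \<le> s"
  shows "ennreal (\<bar>\<phi> (x + y) - \<phi> x\<bar> powr s)
    \<le> (\<integral>\<^sup>+t. ennreal ((norm y * norm (G (x + t *\<^sub>R y))) powr s) * indicator {0..1} t \<partial>lborel)"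
proof -
  have cGl: "continuous_on {0..1::real} (\<lambda>t. G (x + t *\<^sub>R y))"
    by (intro continuous_on_compose2[OF cont_G] continuous_intros) auto
  have "(LINT t|lborel. indicator {0..1} t *\<^sub>R (G (x + t *\<^sub>R y) \<bullet> y)) = \<phi> (x + 1 *\<^sub>R y) - \<phi> (x + 0 *\<^sub>R y)"
  proof (rule integral_FTC_atLeastAtMost)
    fix t :: real
    have "((\<lambda>t. x + t *\<^sub>R y) has_derivative (\<lambda>s. s *\<^sub>R y)) (at t within {0..1})"
      by (auto intro!: derivative_eq_intros)
    from has_derivative_compose[OF this deriv]
    show "((\<lambda>t. \<phi> (x + t *\<^sub>R y)) has_vector_derivative G (x + t *\<^sub>R y) \<bullet> y) (at t within {0..1})"
      by (simp add: has_vector_derivative_def)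
  next
    show "continuous_on {0..1} (\<lambda>t. G (x + t *\<^sub>R y) \<bullet> y)" by (intro continuous_intros cGl)
  qed simp
  moreover have "ennreal (\<bar>(LINT t|lborel. indicator {0..1} t *\<^sub>R (G (x + t *\<^sub>R y) \<bullet> y)) / measure lborel {0..1::real}\<bar> powr s)
     \<le> (\<integral>\<^sup>+t. ennreal ((norm y * norm (G (x + t *\<^sub>R y))) powr s) * indicator {0..1} t \<partial>lborel) / ennreal (measure lborel {0..1::real})"
    using s by (intro powr_abs_average_le)
      (auto intro!: continuous_intros cGl simp: mult.commute[of "norm y"] Cauchy_Schwarz_ineq2)
  ultimately show ?thesis by (simp add: divide_ennreal_def)
qed

text \<open>Tonelli's theorem brings the integral over \<open>x\<close> inside, where the
  translation by \<open>t *\<^sub>R y\<close> carries \<open>A\<close> into \<open>A'\<close>.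
  Keeping the two sets gives a local version for the integrability gain on balls.\<close>

lemma translation_estimate:
  assumes s: "1 \<le> s" and [measurable]: "A \<in> sets borel" "A' \<in> sets borel"
    and A': "\<And>x t. x \<in> A \<Longrightarrow> 0 \<le> t \<Longrightarrow> t \<le> 1 \<Longrightarrow> x + t *\<^sub>R y \<in> A'"
  shows "(\<integral>\<^sup>+x. ennreal (\<bar>\<phi> (x + y) - \<phi> x\<bar> powr s) * indicator A x \<partial>lborel)
    \<le> ennreal (norm y powr s) * (\<integral>\<^sup>+x. ennreal (norm (G x) powr s) * indicator A' x \<partial>lborel)"
proof -
  define I where "I = (\<integral>\<^sup>+x. ennreal (norm (G x) powr s) * indicator A' x \<partial>lborel)"
  define k where "k x t = ennreal ((norm y * norm (G (x + t *\<^sub>R y))) powr s) * indicator {0..1} t * indicator A x"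
    for x t
  have km [measurable]: "case_prod k \<in> borel_measurable (lborel \<Otimes>\<^sub>M lborel)"
    unfolding k_def by measurable

  have "(\<integral>\<^sup>+x. ennreal (\<bar>\<phi> (x + y) - \<phi> x\<bar> powr s) * indicator A x \<partial>lborel)
     \<le> (\<integral>\<^sup>+x. \<integral>\<^sup>+t. k x t \<partial>lborel \<partial>lborel)"
  proof (rule nn_integral_mono)
    fix x
    have "ennreal (\<bar>\<phi> (x + y) - \<phi> x\<bar> powr s) * indicator A x
       \<le> (\<integral>\<^sup>+t. ennreal ((norm y * norm (G (x + t *\<^sub>R y))) powr s) * indicator {0..1} t \<partial>lborel) * indicator A x"
      using translation_pointwise[OF s] by (rule mult_right_mono) simp
    also have "\<dots> = (\<integral>\<^sup>+t. k x t \<partial>lborel)"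
      unfolding k_def by (rule nn_integral_multc[symmetric]) measurable
    finally show "ennreal (\<bar>\<phi> (x + y) - \<phi> x\<bar> powr s) * indicator A x \<le> (\<integral>\<^sup>+t. k x t \<partial>lborel)" .
  qed
  also have "\<dots> = (\<integral>\<^sup>+t. \<integral>\<^sup>+x. k x t \<partial>lborel \<partial>lborel)"
    by (rule lborel_pair.Fubini'[symmetric]) (rule km)
  also have "\<dots> \<le> (\<integral>\<^sup>+t. ennreal (norm y powr s) * I * indicator {0..1::real} t \<partial>lborel)"
  proof (rule nn_integral_mono)
    fix t :: real
    have "(\<integral>\<^sup>+x. k x t \<partial>lborel) \<le> (\<integral>\<^sup>+x. (ennreal (norm y powr s) * indicator {0..1} t) *
         (ennreal (norm (G (t *\<^sub>R y + x)) powr s) * indicator A' (t *\<^sub>R y + x)) \<partial>lborel)"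
      using A' by (intro nn_integral_mono)
        (auto simp: k_def indicator_def powr_mult ennreal_mult add.commute)
    also have "\<dots> = (ennreal (norm y powr s) * indicator {0..1} t) *
         (\<integral>\<^sup>+x. ennreal (norm (G (t *\<^sub>R y + x)) powr s) * indicator A' (t *\<^sub>R y + x) \<partial>lborel)"
      by (rule nn_integral_cmult) measurable
    also have "(\<integral>\<^sup>+x. ennreal (norm (G (t *\<^sub>R y + x)) powr s) * indicator A' (t *\<^sub>R y + x) \<partial>lborel) = I"
      unfolding I_def by (rule nn_integral_lborel_translate[where f = "\<lambda>x. ennreal (norm (G x) powr s) * indicator A' x"]) measurable
    finally show "(\<integral>\<^sup>+x. k x t \<partial>lborel) \<le> ennreal (norm y powr s) * I * indicator {0..1} t"
      by (simp add: mult_ac)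
  qed
  also have "\<dots> = ennreal (norm y powr s) * I"
    by (subst nn_integral_cmult) auto
  finally show ?thesis by (simp add: I_def)
qed


section \<open>Averages over balls\<close>

definition avg :: "real \<Rightarrow> 'a \<Rightarrow> real" where
  "avg r x = (LINT y|lborel. indicator (cball 0 r) y *\<^sub>R \<phi> (x + y)) / measure lborel (cball (0::'a) r)"

lemma avg_measurable [measurable]: "avg r \<in> borel_measurable borel"
proof -
  have [measurable]: "cball (0::'a) r \<in> sets borel" by simp
  have "(\<lambda>x. (LINT y|lborel. indicator (cball 0 r) y *\<^sub>R \<phi> (x + y)) / measure lborel (cball (0::'a) r)) \<in> borel_measurable borel"
    by measurable
  then show ?thesis by (simp add: avg_def[abs_def])
qed

lemma cball_integrable: "integrable lborel (\<lambda>y. indicator (cball 0 r) y *\<^sub>R \<phi> (x + y))"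
  by (intro borel_integrable_compact compact_cball continuous_on_compose2[OF cont] continuous_intros) auto

lemma avg_minus:
  assumes "0 < r"
  shows "avg r x - \<phi> x = (LINT y|lborel. indicator (cball 0 r) y *\<^sub>R (\<phi> (x + y) - \<phi> x)) / measure lborel (cball (0::'a) r)"
proof -
  have V: "0 < measure lborel (cball (0::'a) r)" using assms by simp
  have "(LINT y|lborel. indicator (cball (0::'a) r) y *\<^sub>R (\<phi> (x + y) - \<phi> x))
     = (LINT y|lborel. indicator (cball 0 r) y *\<^sub>R \<phi> (x + y)) - (LINT y|lborel. indicator (cball (0::'a) r) y *\<^sub>R \<phi> x)"
    unfolding scaleR_diff_right
    by (intro Bochner_Integration.integral_diff cball_integrable borel_integrable_compact continuous_intros) auto
  also have "(LINT y|lborel. indicator (cball (0::'a) r) y *\<^sub>R \<phi> x) = measure lborel (cball (0::'a) r) * \<phi> x"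
    by simp
  finally show ?thesis using V by (simp add: avg_def diff_divide_distrib)
qed

text \<open>Jensen's inequality over the ball and Tonelli's theorem reduce this to the translation
  estimate for each \<open>y\<close> of norm at most \<open>r\<close>; averaging over
  \<open>y\<close> costs no constant.\<close>

lemma avg_estimate:
  assumes s: "1 \<le> s" and r: "0 < r" and [measurable]: "A \<in> sets borel" "A' \<in> sets borel"
    and A': "\<And>x y. x \<in> A \<Longrightarrow> norm y \<le> r \<Longrightarrow> x + y \<in> A'"
  shows "(\<integral>\<^sup>+x. ennreal (\<bar>avg r x - \<phi> x\<bar> powr s) * indicator A x \<partial>lborel)
    \<le> ennreal (r powr s) * (\<integral>\<^sup>+x. ennreal (norm (G x) powr s) * indicator A' x \<partial>lborel)"
proof -
  define I where "I = (\<integral>\<^sup>+x. ennreal (norm (G x) powr s) * indicator A' x \<partial>lborel)"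
  define V where "V = measure lborel (cball (0::'a) r)"
  have V: "0 < V" using r by (simp add: V_def)
  have [measurable]: "cball (0::'a) r \<in> sets borel" by simp
  define k where "k x y = ennreal (\<bar>\<phi> (x + y) - \<phi> x\<bar> powr s) * indicator (cball 0 r) y * indicator A x"
    for x y
  have km [measurable]: "case_prod k \<in> borel_measurable (lborel \<Otimes>\<^sub>M lborel)"
    unfolding k_def by measurable
  have "(\<integral>\<^sup>+x. ennreal (\<bar>avg r x - \<phi> x\<bar> powr s) * indicator A x \<partial>lborel)
     \<le> (\<integral>\<^sup>+x. (\<integral>\<^sup>+y. k x y \<partial>lborel) / ennreal V \<partial>lborel)"
  proof (rule nn_integral_mono)
    fix x
    have "ennreal (\<bar>avg r x - \<phi> x\<bar> powr s) * indicator A x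
       \<le> ((\<integral>\<^sup>+y. ennreal (\<bar>\<phi> (x + y) - \<phi> x\<bar> powr s) * indicator (cball 0 r) y \<partial>lborel) / ennreal V) * indicator A x"
      unfolding avg_minus[OF r] V_def using s r
      by (intro mult_right_mono powr_abs_average_le continuous_intros continuous_on_compose2[OF cont]) auto
    also have "\<dots> = ((\<integral>\<^sup>+y. ennreal (\<bar>\<phi> (x + y) - \<phi> x\<bar> powr s) * indicator (cball 0 r) y \<partial>lborel) * indicator A x) / ennreal V"
      by (simp add: divide_ennreal_def mult_ac)
    also have "\<dots> = (\<integral>\<^sup>+y. k x y \<partial>lborel) / ennreal V"
      unfolding k_def by (subst nn_integral_multc) auto
    finally show "ennreal (\<bar>avg r x - \<phi> x\<bar> powr s) * indicator A x \<le> (\<integral>\<^sup>+y. k x y \<partial>lborel) / ennreal V" .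
  qed
  also have "\<dots> = (\<integral>\<^sup>+x. \<integral>\<^sup>+y. k x y \<partial>lborel \<partial>lborel) / ennreal V"
    by (rule nn_integral_divide) measurable
  also have "(\<integral>\<^sup>+x. \<integral>\<^sup>+y. k x y \<partial>lborel \<partial>lborel) = (\<integral>\<^sup>+y. \<integral>\<^sup>+x. k x y \<partial>lborel \<partial>lborel)"
    by (rule lborel_pair.Fubini'[symmetric]) (rule km)
  also have "\<dots> \<le> (\<integral>\<^sup>+y. ennreal (r powr s) * I * indicator (cball (0::'a) r) y \<partial>lborel)"
  proof (rule nn_integral_mono)
    fix y :: 'a
    have "(\<integral>\<^sup>+x. k x y \<partial>lborel) = (\<integral>\<^sup>+x. ennreal (\<bar>\<phi> (x + y) - \<phi> x\<bar> powr s) * indicator A x \<partial>lborel) * indicator (cball 0 r) y"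
      unfolding k_def by (subst nn_integral_multc[symmetric]) (auto simp: mult_ac)
    also have "\<dots> \<le> ennreal (r powr s) * I * indicator (cball 0 r) y"
    proof (cases "norm y \<le> r")
      case True
      have "(\<integral>\<^sup>+x. ennreal (\<bar>\<phi> (x + y) - \<phi> x\<bar> powr s) * indicator A x \<partial>lborel) \<le> ennreal (norm y powr s) * I"
        unfolding I_def
      proof (rule translation_estimate[OF s])
        fix x t assume "x \<in> A" "0 \<le> t" "t \<le> (1::real)"
        moreover have "norm (t *\<^sub>R y) \<le> norm y" using \<open>0 \<le> t\<close> \<open>t \<le> 1\<close> by (simp add: mult_left_le_one_le)
        ultimately show "x + t *\<^sub>R y \<in> A'" using A' True by auto
      qed measurable
      also have "\<dots> \<le> ennreal (r powr s) * I"
        using True s by (intro mult_right_mono ennreal_leI powr_mono2) auto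
      finally show ?thesis by (rule mult_right_mono) simp
    qed simp
    finally show "(\<integral>\<^sup>+x. k x y \<partial>lborel) \<le> ennreal (r powr s) * I * indicator (cball 0 r) y" .
  qed
  also have "\<dots> = ennreal (r powr s) * I * ennreal V"
    using emeasure_lborel_cball_finite[of "0::'a" r]
    by (subst nn_integral_cmult) (auto simp: V_def emeasure_eq_ennreal_measure)
  also have "ennreal (r powr s) * I * ennreal V / ennreal V = ennreal (r powr s) * I"
    using V by (intro ennreal_mult_divide_eq) auto
  finally show ?thesis by (simp add: I_def divide_right_mono_ennreal)
qed

lemma avg_bound:
  assumes r: "0 < r" and L: "0 \<le> L" "(\<integral>\<^sup>+x. ennreal \<bar>\<phi> x\<bar> \<partial>lborel) \<le> ennreal L"
  shows "\<bar>avg r x\<bar> \<le> L / measure lborel (cball (0::'a) r)"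
proof -
  have V: "0 < measure lborel (cball (0::'a) r)" using r by simp
  have "ennreal (norm (LINT y|lborel. indicator (cball 0 r) y *\<^sub>R \<phi> (x + y)))
     \<le> (\<integral>\<^sup>+y. ennreal (norm (indicator (cball 0 r) y *\<^sub>R \<phi> (x + y))) \<partial>lborel)"
    by (rule integral_norm_bound_ennreal[OF cball_integrable])
  also have "\<dots> \<le> (\<integral>\<^sup>+y. ennreal \<bar>\<phi> (x + y)\<bar> \<partial>lborel)"
    by (intro nn_integral_mono ennreal_leI) (auto simp: indicator_def)
  also have "\<dots> = (\<integral>\<^sup>+y. ennreal \<bar>\<phi> y\<bar> \<partial>lborel)"
    by (rule nn_integral_lborel_translate[where f = "\<lambda>y. ennreal \<bar>\<phi> y\<bar>"]) measurable
  also have "\<dots> \<le> ennreal L" by (rule L(2))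
  finally have "ennreal (norm (LINT y|lborel. indicator (cball 0 r) y *\<^sub>R \<phi> (x + y))) \<le> ennreal L" .
  then have "\<bar>LINT y|lborel. indicator (cball 0 r) y *\<^sub>R \<phi> (x + y)\<bar> \<le> L"
    using L(1) by (simp add: ennreal_le_iff)
  then show ?thesis using V by (simp add: avg_def abs_divide divide_right_mono)
qed

text \<open>The difference of two averages is an average of differences along the vector
  \<open>x - z\<close>, so the translation estimate with exponent 1 applies. Together with
  \<open>avg_bound\<close> this is the equicontinuity behind Rellich's theorem.\<close>

lemma avg_lipschitz:
  assumes r: "0 < r" and L: "0 \<le> L" "(\<integral>\<^sup>+x. ennreal (norm (G x)) \<partial>lborel) \<le> ennreal L"
  shows "\<bar>avg r x - avg r z\<bar> \<le> norm (x - z) * L / measure lborel (cball (0::'a) r)"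
proof -
  have V: "0 < measure lborel (cball (0::'a) r)" using r by simp
  define D where "D = (LINT y|lborel. indicator (cball 0 r) y *\<^sub>R \<phi> (x + y) - indicator (cball 0 r) y *\<^sub>R \<phi> (z + y))"
  have "ennreal (norm D) \<le> (\<integral>\<^sup>+y. ennreal (norm (indicator (cball 0 r) y *\<^sub>R \<phi> (x + y) - indicator (cball 0 r) y *\<^sub>R \<phi> (z + y))) \<partial>lborel)"
    unfolding D_def by (intro integral_norm_bound_ennreal Bochner_Integration.integrable_diff cball_integrable)
  also have "\<dots> \<le> (\<integral>\<^sup>+y. ennreal \<bar>\<phi> ((z + y) + (x - z)) - \<phi> (z + y)\<bar> \<partial>lborel)"
    by (intro nn_integral_mono ennreal_leI) (auto simp: indicator_def add.commute)
  also have "\<dots> = (\<integral>\<^sup>+y. ennreal \<bar>\<phi> (y + (x - z)) - \<phi> y\<bar> \<partial>lborel)"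
    by (rule nn_integral_lborel_translate[where f = "\<lambda>y. ennreal \<bar>\<phi> (y + (x - z)) - \<phi> y\<bar>"]) measurable
  also have "\<dots> \<le> ennreal (norm (x - z)) * (\<integral>\<^sup>+x. ennreal (norm (G x)) \<partial>lborel)"
    using translation_estimate[of 1 UNIV UNIV "x - z"] by simp
  also have "\<dots> \<le> ennreal (norm (x - z)) * ennreal L" using L by (intro mult_left_mono) auto
  also have "\<dots> = ennreal (norm (x - z) * L)" using L by (simp add: ennreal_mult)
  finally have "\<bar>D\<bar> \<le> norm (x - z) * L"
    using L(1) by (simp add: ennreal_le_iff)
  moreover have "avg r x - avg r z = D / measure lborel (cball (0::'a) r)"
    unfolding D_def avg_def
    by (subst Bochner_Integration.integral_diff; (rule cball_integrable)?) (rule diff_divide_distrib[symmetric])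
  ultimately show ?thesis using V by (simp add: abs_divide divide_right_mono)
qed

lemma poincare:
  assumes s: "1 \<le> s" and R: "0 < R" and zero: "\<And>x. R \<le> norm x \<Longrightarrow> \<phi> x = 0"
  shows "(\<integral>\<^sup>+x. ennreal (\<bar>\<phi> x\<bar> powr s) \<partial>lborel)
    \<le> ennreal ((2 * R) powr s) * (\<integral>\<^sup>+x. ennreal (norm (G x) powr s) \<partial>lborel)"
proof -
  obtain e :: 'a where e: "norm e = 1" using vector_choose_size[of 1] by auto
  \<comment> \<open>A shift by \<open>2 * R\<close> moves the ball of radius \<open>R\<close> off
    itself, so \<open>\<phi> (x + y)\<close> vanishes for every \<open>x\<close> in the
    ball.\<close>
  define y where "y = (2 * R) *\<^sub>R e"
  have y: "norm y = 2 * R" using e R by (simp add: y_def)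
  have "(\<integral>\<^sup>+x. ennreal (\<bar>\<phi> x\<bar> powr s) \<partial>lborel)
     = (\<integral>\<^sup>+x. ennreal (\<bar>\<phi> (x + y) - \<phi> x\<bar> powr s) * indicator (ball 0 R) x \<partial>lborel)"
  proof (rule nn_integral_cong)
    fix x
    show "ennreal (\<bar>\<phi> x\<bar> powr s) = ennreal (\<bar>\<phi> (x + y) - \<phi> x\<bar> powr s) * indicator (ball 0 R) x"
    proof (cases "norm x < R")
      case True
      have "norm y \<le> norm (x + y) + norm x" using norm_triangle_ineq4[of "x + y" x] by simp
      then have "\<phi> (x + y) = 0" using True y by (intro zero) linarith
      then show ?thesis using True by (simp add: indicator_def)
    qed (use zero in \<open>simp add: indicator_def\<close>)
  qed
  also have "\<dots> \<le> ennreal (norm y powr s) * (\<integral>\<^sup>+x. ennreal (norm (G x) powr s) * indicator UNIV x \<partial>lborel)"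
    by (rule translation_estimate[OF s]) auto
  finally show ?thesis by (simp add: y)
qed

end

section \<open>Integrability gain and compactness\<close>

text \<open>At the level \<open>\<lambda>\<^sub>j = c 2\<^sup>j\<^sup>N\<close> the average over balls of radius
  \<open>r\<^sub>j = r\<^sub>1 2\<^sup>-\<^sup>j\<close> is at most \<open>\<lambda>\<^sub>j / 2\<close>, so where \<open>\<bar>\<phi>\<bar>\<close> exceeds \<open>\<lambda>\<^sub>j\<close> the deviation from that average
  is at least \<open>\<lambda>\<^sub>j / 2\<close>. Its \<open>s\<close>-th power integrates to at most \<open>r\<^sub>j\<^sup>s\<close> times that of the gradient,
  and the resulting series is geometric.\<close>

lemma local_gain:
  fixes z :: "'a::euclidean_space"
  assumes s: "1 \<le> s" "s \<le> t" and gain: "real DIM('a) * (t - s) < 1" and r0: "0 < r0" and L: "0 \<le> L"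
  obtains K where "0 \<le> K" "\<And>\<phi> G. C1_function \<phi> G \<Longrightarrow> (\<integral>\<^sup>+x. ennreal \<bar>\<phi> x\<bar> \<partial>lborel) \<le> ennreal L \<Longrightarrow>
     (\<integral>\<^sup>+x. ennreal (\<bar>\<phi> x\<bar> powr t) * indicator (ball z r0) x \<partial>lborel)
      \<le> ennreal K * (1 + (\<integral>\<^sup>+x. ennreal (norm (G x) powr s) * indicator (ball z (2 * r0)) x \<partial>lborel))"
proof -
  define N where "N = DIM('a)"
  \<comment> \<open>\<open>r1 < r0\<close> keeps the averaging balls around points of
    \<open>ball z r0\<close> inside \<open>ball z (2 * r0)\<close>; \<open>r1 \<le> 1\<close> allows
    \<open>r j powr s\<close> to be bounded by \<open>r j\<close>.\<close>
  define r1 where "r1 = min r0 1 / 2"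
  have r1: "0 < r1" "r1 < r0" "r1 \<le> 1" using r0 by (auto simp: r1_def)
  define r where "r j = r1 / 2 ^ j" for j :: nat
  have r: "0 < r j" "r j \<le> r1" "r j \<le> 1" for j
  proof -
    show "0 < r j" using r1 by (simp add: r_def)
    have "r1 * 1 \<le> r1 * 2 ^ j" using r1 by (intro mult_left_mono) auto
    then show "r j \<le> r1" by (simp add: r_def divide_le_eq)
    then show "r j \<le> 1" using r1 by linarith
  qed
  define V where "V \<rho> = measure lborel (cball (0::'a) \<rho>)" for \<rho>
  have Vpos: "0 < V \<rho>" if "0 < \<rho>" for \<rho> using that by (simp add: V_def)
  \<comment> \<open>The factor by which the volume of a ball shrinks when its radius is
    halved.\<close>
  define B where "B = (2::real) ^ N"
  have B: "2 \<le> B" unfolding B_def N_def using DIM_positive[where 'a = 'a]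
    by (metis Suc_leI one_le_numeral power_increasing power_one_right One_nat_def)
  have Vr: "V (r j) = V r1 / B ^ j" for j
    using r1 r by (simp add: V_def content_cball r_def B_def N_def power_divide power_mult[symmetric] mult.commute)
  \<comment> \<open>Chosen so that the bound of \<open>avg_bound\<close> at radius
    \<open>r j\<close> is at most \<open>l j / 2\<close>.\<close>
  define c where "c = 2 * (L + 1) / V r1"
  have c: "0 < c" using L Vpos[OF r1(1)] by (simp add: c_def)
  define l where "l j = c * B ^ j" for j
  have l: "0 < l j" "l (Suc j) = B * l j" for j using c B by (auto simp: l_def)
  \<comment> \<open>On the layer between \<open>l j\<close> and \<open>l (Suc j)\<close> the
    deviation from the average is at least \<open>l j / 2\<close>; \<open>A j\<close> converts its
    power \<open>s\<close> into a bound for \<open>\<bar>\<phi> x\<bar> powr t\<close>.\<close>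
  define A where "A j = (B * l j) powr t * (2 / l j) powr s" for j
  have A0: "0 \<le> A j" for j by (simp add: A_def)
  define C0 where "C0 = B powr t * 2 powr s * c powr (t - s)"
  \<comment> \<open>The ratio of the series: \<open>B powr (t - s)\<close> comes from the levels,
    one half from the radii. The assumption \<open>gain\<close> says precisely that
    \<open>B powr (t - s) < 2\<close>.\<close>
  define \<theta> where "\<theta> = B powr (t - s) / 2"
  have \<theta>: "0 \<le> \<theta>" "\<theta> < 1"
  proof -
    show "0 \<le> \<theta>" by (simp add: \<theta>_def)
    have "B powr (t - s) = 2 powr (real N * (t - s))"
      by (simp add: B_def powr_realpow[symmetric] powr_powr)
    also have "\<dots> < 2 powr 1" using gain by (intro powr_less_mono) (auto simp: N_def)
    finally show "\<theta> < 1" by (simp add: \<theta>_def)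
  qed
  have C0: "0 \<le> C0" by (simp add: C0_def)
  have Ar: "A j * r j powr s \<le> C0 * \<theta> ^ j" for j
  proof -
    have "A j = B powr t * 2 powr s * (l j powr t / l j powr s)"
      using l B by (simp add: A_def powr_mult powr_divide)
    also have "l j powr t / l j powr s = l j powr (t - s)" by (simp add: powr_diff)
    also have "l j powr (t - s) = c powr (t - s) * (B powr (t - s)) ^ j"
      using c B by (simp add: l_def powr_mult powr_realpow[symmetric] powr_powr powr_power mult.commute)
    finally have A: "A j = C0 * (B powr (t - s)) ^ j" by (simp add: C0_def)
    have "r j powr s \<le> r j powr 1" using r[of j] s by (intro powr_mono') auto
    also have "\<dots> \<le> 1 / 2 ^ j" using r1 r[of j] by (simp add: r_def divide_right_mono)
    finally have "A j * r j powr s \<le> A j * (1 / 2 ^ j)" using A0 by (rule mult_left_mono)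
    also have "\<dots> = C0 * \<theta> ^ j" by (simp add: A \<theta>_def power_divide)
    finally show ?thesis .
  qed
  define K where "K = c powr t * measure lborel (ball z r0) + C0 / (1 - \<theta>)"
  show ?thesis
  proof (rule that[of K])
    show "0 \<le> K" using \<theta> C0 by (auto simp: K_def intro!: add_nonneg_nonneg)
    fix \<phi> :: "'a \<Rightarrow> real" and G
    assume C1: "C1_function \<phi> G" and \<phi>L: "(\<integral>\<^sup>+x. ennreal \<bar>\<phi> x\<bar> \<partial>lborel) \<le> ennreal L"
    interpret C1_function \<phi> G by (fact C1)
    have [measurable]: "ball z r0 \<in> sets borel" by simp
    define I where "I = (\<integral>\<^sup>+x. ennreal (norm (G x) powr s) * indicator (ball z (2 * r0)) x \<partial>lborel)"
    have pt: "ennreal (\<bar>\<phi> x\<bar> powr t) \<le> ennreal (c powr t) + (\<Sum>j. ennreal (A j) * ennreal (\<bar>avg (r j) x - \<phi> x\<bar> powr s))"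
      for x
    proof (cases "\<bar>\<phi> x\<bar> \<le> c")
      case True
      then have "\<bar>\<phi> x\<bar> powr t \<le> c powr t" using s by (intro powr_mono2) auto
      then show ?thesis by (intro add_increasing2 ennreal_leI) auto
    next
      case False
      have "\<exists>n. \<bar>\<phi> x\<bar> \<le> l n"
      proof -
        obtain n where "\<bar>\<phi> x\<bar> / c < B ^ n" using real_arch_pow[of B "\<bar>\<phi> x\<bar> / c"] B by auto
        then have "\<bar>\<phi> x\<bar> \<le> l n" using c by (simp add: l_def field_simps)
        then show ?thesis by blast
      qed
      \<comment> \<open>The first level not below \<open>\<bar>\<phi> x\<bar>\<close>. It is not
        level 0, as \<open>l 0 = c\<close> lies below \<open>\<bar>\<phi> x\<bar>\<close> in this
        case, so there is a preceding level \<open>j\<close>.\<close>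
      define n where "n = (LEAST n. \<bar>\<phi> x\<bar> \<le> l n)"
      have n: "\<bar>\<phi> x\<bar> \<le> l n" unfolding n_def using \<open>\<exists>n. _\<close> by (rule LeastI_ex)
      have "n \<noteq> 0"
      proof
        assume "n = 0"
        then show False using n False by (simp add: l_def)
      qed
      then obtain j where j: "n = Suc j" using not0_implies_Suc by blast
      have lj: "l j < \<bar>\<phi> x\<bar>" using not_less_Least[of j "\<lambda>n. \<bar>\<phi> x\<bar> \<le> l n"] j by (simp add: n_def)
      have "\<bar>avg (r j) x\<bar> \<le> L / V (r j)" unfolding V_def using r L \<phi>L by (intro avg_bound) auto
      also have "\<dots> = L * (B ^ j / V r1)" by (simp add: Vr)
      also have "\<dots> \<le> (L + 1) * (B ^ j / V r1)"
        using Vpos[OF r1(1)] B by (intro mult_right_mono) auto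
      also have "\<dots> = l j / 2" using Vpos[OF r1(1)] by (simp add: l_def c_def field_simps)
      finally have dev: "l j / 2 \<le> \<bar>avg (r j) x - \<phi> x\<bar>" using lj by linarith
      have "\<bar>\<phi> x\<bar> powr t \<le> (B * l j) powr t" using n l j s by (intro powr_mono2) auto
      also have "\<dots> \<le> (B * l j) powr t * ((2 / l j) * \<bar>avg (r j) x - \<phi> x\<bar>) powr s"
      proof -
        have "1 \<le> (2 / l j) * \<bar>avg (r j) x - \<phi> x\<bar>" using dev l by (simp add: field_simps)
        then have "1 \<le> ((2 / l j) * \<bar>avg (r j) x - \<phi> x\<bar>) powr s" using s by (intro ge_one_powr_ge_zero) auto
        from mult_left_mono[OF this, of "(B * l j) powr t"] show ?thesis by simp
      qed
      also have "\<dots> = A j * \<bar>avg (r j) x - \<phi> x\<bar> powr s"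
        by (simp only: A_def powr_mult mult.assoc)
      finally have "ennreal (\<bar>\<phi> x\<bar> powr t) \<le> ennreal (A j) * ennreal (\<bar>avg (r j) x - \<phi> x\<bar> powr s)"
        using A0 by (simp add: ennreal_mult[symmetric] ennreal_leI)
      also have "\<dots> \<le> (\<Sum>j. ennreal (A j) * ennreal (\<bar>avg (r j) x - \<phi> x\<bar> powr s))"
        using sum_le_suminf[of "\<lambda>j. ennreal (A j) * ennreal (\<bar>avg (r j) x - \<phi> x\<bar> powr s)" "{j}"] by simp
      finally show ?thesis by (rule add_increasing[OF zero_le])
    qed
    have "(\<integral>\<^sup>+x. ennreal (\<bar>\<phi> x\<bar> powr t) * indicator (ball z r0) x \<partial>lborel)
      \<le> (\<integral>\<^sup>+x. ennreal (c powr t) * indicator (ball z r0) x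
          + (\<Sum>j. ennreal (A j) * (ennreal (\<bar>avg (r j) x - \<phi> x\<bar> powr s) * indicator (ball z r0) x)) \<partial>lborel)"
    proof (rule nn_integral_mono)
      fix x
      show "ennreal (\<bar>\<phi> x\<bar> powr t) * indicator (ball z r0) x \<le> ennreal (c powr t) * indicator (ball z r0) x
          + (\<Sum>j. ennreal (A j) * (ennreal (\<bar>avg (r j) x - \<phi> x\<bar> powr s) * indicator (ball z r0) x))"
        using pt[of x] by (cases "x \<in> ball z r0") (simp_all only: indicator_simps mult_1_right mult_zero_right zero_le not_False_eq_True)
    qed
    also have "\<dots> = (\<integral>\<^sup>+x. ennreal (c powr t) * indicator (ball z r0) x \<partial>lborel)
          + (\<integral>\<^sup>+x. (\<Sum>j. ennreal (A j) * (ennreal (\<bar>avg (r j) x - \<phi> x\<bar> powr s) * indicator (ball z r0) x)) \<partial>lborel)"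
      by (rule nn_integral_add) measurable
    also have "(\<integral>\<^sup>+x. (\<Sum>j. ennreal (A j) * (ennreal (\<bar>avg (r j) x - \<phi> x\<bar> powr s) * indicator (ball z r0) x)) \<partial>lborel)
       = (\<Sum>j. \<integral>\<^sup>+x. ennreal (A j) * (ennreal (\<bar>avg (r j) x - \<phi> x\<bar> powr s) * indicator (ball z r0) x) \<partial>lborel)"
      by (rule nn_integral_suminf) measurable
    also have "\<dots> \<le> (\<Sum>j. ennreal (C0 * \<theta> ^ j) * I)"
    proof (intro suminf_le summableI)
      fix j
      have "(\<integral>\<^sup>+x. ennreal (A j) * (ennreal (\<bar>avg (r j) x - \<phi> x\<bar> powr s) * indicator (ball z r0) x) \<partial>lborel)
         = ennreal (A j) * (\<integral>\<^sup>+x. ennreal (\<bar>avg (r j) x - \<phi> x\<bar> powr s) * indicator (ball z r0) x \<partial>lborel)"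
        by (rule nn_integral_cmult) measurable
      also have "\<dots> \<le> ennreal (A j) * (ennreal (r j powr s) * I)"
        unfolding I_def
      proof (intro mult_left_mono avg_estimate s r)
        fix x y :: 'a assume "x \<in> ball z r0" "norm y \<le> r j"
        then have "norm (x - z) < r0" "norm y < r0" using r(2)[of j] r1 by (auto simp: dist_norm norm_minus_commute)
        moreover have "norm ((x + y) - z) \<le> norm (x - z) + norm y"
          using norm_triangle_ineq[of "x - z" y] by (simp add: algebra_simps)
        ultimately show "x + y \<in> ball z (2 * r0)" by (simp add: dist_norm norm_minus_commute)
      qed auto
      also have "\<dots> = ennreal (A j * r j powr s) * I"
        using A0 by (simp add: ennreal_mult mult.assoc)
      also have "\<dots> \<le> ennreal (C0 * \<theta> ^ j) * I"
        using Ar by (intro mult_right_mono ennreal_leI) auto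
      finally show "(\<integral>\<^sup>+x. ennreal (A j) * (ennreal (\<bar>avg (r j) x - \<phi> x\<bar> powr s) * indicator (ball z r0) x) \<partial>lborel)
         \<le> ennreal (C0 * \<theta> ^ j) * I" .
    qed
    also have "\<dots> = ennreal (C0 / (1 - \<theta>)) * I"
    proof -
      have "(\<lambda>j. C0 * \<theta> ^ j) sums (C0 * (1 / (1 - \<theta>)))" using \<theta> by (intro sums_mult geometric_sums) auto
      then have "(\<Sum>j. ennreal (C0 * \<theta> ^ j)) = ennreal (C0 / (1 - \<theta>))"
        using \<theta> C0 by (intro suminf_ennreal_eq) auto
      then show ?thesis by simp
    qed
    also have "(\<integral>\<^sup>+x. ennreal (c powr t) * indicator (ball z r0) x \<partial>lborel) = ennreal (c powr t * measure lborel (ball z r0))"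
      using emeasure_lborel_ball_finite[of z r0]
      by (subst nn_integral_cmult_indicator) (auto simp: ennreal_mult emeasure_eq_ennreal_measure)
    also have "ennreal (c powr t * measure lborel (ball z r0)) + ennreal (C0 / (1 - \<theta>)) * I
       \<le> ennreal K * 1 + ennreal K * I"
      using \<theta> C0 by (intro add_mono mult_right_mono) (auto simp: K_def intro!: ennreal_leI)
    also have "\<dots> = ennreal K * (1 + I)" by (simp add: distrib_left)
    finally show "(\<integral>\<^sup>+x. ennreal (\<bar>\<phi> x\<bar> powr t) * indicator (ball z r0) x \<partial>lborel) \<le> ennreal K * (1 + I)"
      by (simp add: add_mono)
  qed
qed

text \<open>Averages over balls of a fixed radius are bounded and Lipschitz uniformly in
  \<open>n\<close>, so a diagonal argument makes them converge everywhere, for every radius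
  \<open>\<rho> k\<close>. They differ from \<open>\<phi> n\<close> in L1 by at most
  \<open>\<rho> k * L\<close>, again uniformly in \<open>n\<close>.\<close>

lemma rellich_L1:
  fixes \<phi> :: "nat \<Rightarrow> 'a::euclidean_space \<Rightarrow> real"
  assumes C1: "\<And>n. C1_function (\<phi> n) (G n)" and \<Omega>: "\<Omega> \<in> sets borel" "emeasure lborel \<Omega> < \<infinity>"
    and L: "0 \<le> L" "\<And>n. (\<integral>\<^sup>+x. ennreal \<bar>\<phi> n x\<bar> \<partial>lborel) \<le> ennreal L"
      "\<And>n. (\<integral>\<^sup>+x. ennreal (norm (G n x)) \<partial>lborel) \<le> ennreal L"
  obtains r :: "nat \<Rightarrow> nat" where "strict_mono r"
    "\<And>e. 0 < e \<Longrightarrow> \<exists>N. \<forall>i\<ge>N. \<forall>j\<ge>N. (\<integral>\<^sup>+x. ennreal \<bar>\<phi> (r i) x - \<phi> (r j) x\<bar> * indicator \<Omega> x \<partial>lborel) \<le> ennreal e"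
proof -
  interpret C1: C1_function "\<phi> n" "G n" for n by (rule C1)
  define \<rho> where "\<rho> k = 1 / real (Suc k)" for k
  have \<rho>: "0 < \<rho> k" for k by (simp add: \<rho>_def)
  define V where "V k = measure lborel (cball (0::'a) (\<rho> k))" for k
  have V: "0 < V k" for k using \<rho> by (simp add: V_def)
  define a where "a n k x = C1.avg n (\<rho> k) x" for n k x
  have a_bound: "\<bar>a n k x\<bar> \<le> L / V k" for n k x
    unfolding a_def V_def by (rule C1.avg_bound[OF \<rho> L(1) L(2)])
  have a_lip: "\<bar>a n k x - a n k y\<bar> \<le> norm (x - y) * L / V k" for n k x y
    unfolding a_def V_def by (rule C1.avg_lipschitz[OF \<rho> L(1) L(3)])
  have a_meas [measurable]: "a n k \<in> borel_measurable borel" for n k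
    unfolding a_def[abs_def] by measurable
  obtain D :: "'a set" where D: "countable D" "\<And>X. open X \<Longrightarrow> X \<noteq> {} \<Longrightarrow> \<exists>d\<in>D. d \<in> X"
    using countable_dense_exists by blast
  have cD: "countable ((UNIV :: nat set) \<times> D)" using D(1) by simp
  \<comment> \<open>The factor \<open>V k\<close> yields one bound \<open>L\<close> for all radii at
    once, as the diagonal selection over radii and dense points requires.\<close>
  have "norm (V k * a n k d) \<le> L" for n k d
    using a_bound[of n k d] V[of k] by (simp add: abs_mult field_simps)
  then have bd: "norm ((\<lambda>n (k, d). V k * a n k d) n z) \<le> L" if "z \<in> UNIV \<times> D" for n z
    by (cases z) auto
  obtain r where r: "strict_mono (r :: nat \<Rightarrow> nat)"
      "\<And>z. z \<in> UNIV \<times> D \<Longrightarrow> \<exists>l. (\<lambda>n. (\<lambda>n (k, d). V k * a n k d) (r n) z) \<longlonglongrightarrow> l"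
  proof (rule function_convergent_subsequence[of "UNIV \<times> D" "\<lambda>n (k, d). V k * a n k d" L, OF cD bd])
    fix k :: "nat \<Rightarrow> nat"
    assume "strict_mono k" "\<And>x. x \<in> UNIV \<times> D \<Longrightarrow> \<exists>l. (\<lambda>n. case x of (ka, d) \<Rightarrow> V ka * a (k n) ka d) \<longlonglongrightarrow> l"
    then show thesis by (rule that)
  qed
  have conv: "convergent (\<lambda>n. a (r n) k x)" for k x
  proof -
    have "Cauchy (\<lambda>n. a (r n) k x)"
      unfolding Cauchy_def
    proof (intro allI impI)
      fix e :: real assume e: "0 < e"
      \<comment> \<open>Within distance \<open>\<delta>\<close> the Lipschitz bound changes an
        average by less than \<open>e / 3\<close>, so the Cauchy property spreads from the dense set
        to every point.\<close>
      define \<delta> where "\<delta> = e * V k / (3 * (L + 1))"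
      have \<delta>: "0 < \<delta>" using e V L by (simp add: \<delta>_def)
      obtain d where d: "d \<in> D" "dist x d < \<delta>" using D(2)[of "ball x \<delta>"] \<delta> by auto
      have near: "\<bar>a n k x - a n k d\<bar> < e / 3" for n
      proof -
        have "\<bar>a n k x - a n k d\<bar> \<le> norm (x - d) * L / V k" by (rule a_lip)
        also have "\<dots> \<le> norm (x - d) * (L + 1) / V k"
          using V[of k] L by (intro divide_right_mono mult_left_mono) auto
        also have "\<dots> < \<delta> * (L + 1) / V k"
          using V[of k] L d by (intro divide_strict_right_mono mult_strict_right_mono) (auto simp: dist_norm)
        also have "\<dots> = e / 3" using V[of k] L(1) by (simp add: \<delta>_def divide_simps)
        finally show ?thesis .
      qed
      obtain l where "(\<lambda>n. V k * a (r n) k d) \<longlonglongrightarrow> l" using r(2)[of "(k, d)"] d by auto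
      then have "(\<lambda>n. (1 / V k) * (V k * a (r n) k d)) \<longlonglongrightarrow> (1 / V k) * l" by (intro tendsto_mult tendsto_const)
      then have "(\<lambda>n. a (r n) k d) \<longlonglongrightarrow> (1 / V k) * l" using V[of k] by simp
      then have "Cauchy (\<lambda>n. a (r n) k d)" by (rule LIMSEQ_imp_Cauchy)
      then obtain M where M: "\<And>m n. m \<ge> M \<Longrightarrow> n \<ge> M \<Longrightarrow> dist (a (r m) k d) (a (r n) k d) < e / 3"
        unfolding Cauchy_def using e by (meson divide_pos_pos zero_less_numeral)
      have "dist (a (r m) k x) (a (r n) k x) < e" if "m \<ge> M" "n \<ge> M" for m n
        using M[OF that] near[of "r m"] near[of "r n"] unfolding dist_real_def by linarith
      then show "\<exists>M. \<forall>m\<ge>M. \<forall>n\<ge>M. dist (a (r m) k x) (a (r n) k x) < e" by blast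
    qed
    then show ?thesis by (simp add: Cauchy_convergent_iff)
  qed
  define N where "N = restrict_space lborel \<Omega>"
  interpret N: finite_measure N
    using \<Omega> by (intro finite_measureI) (simp add: N_def emeasure_restrict_space space_restrict_space)
  have N_meas: "h \<in> borel_measurable N" if "h \<in> borel_measurable borel" for h :: "'a \<Rightarrow> real"
    using that by (simp add: N_def measurable_restrict_space1)
  define a' where "a' k x = lim (\<lambda>n. a (r n) k x)" for k x
  have a'_lim: "(\<lambda>n. a (r n) k x) \<longlonglongrightarrow> a' k x" for k x
    using conv[of k x] by (simp add: a'_def convergent_LIMSEQ_iff)
  have a'_meas [measurable]: "a' k \<in> borel_measurable borel" for k
    unfolding a'_def[abs_def] by measurable
  have a'_bound: "\<bar>a' k x\<bar> \<le> L / V k" for k x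
    using LIMSEQ_le_const2[OF tendsto_rabs[OF a'_lim]] a_bound by blast
  have int_lim: "(\<lambda>n. \<integral>x. \<bar>a (r n) k x - a' k x\<bar> \<partial>N) \<longlonglongrightarrow> 0" for k
  proof -
    have "(\<lambda>n. \<integral>x. \<bar>a (r n) k x - a' k x\<bar> \<partial>N) \<longlonglongrightarrow> (\<integral>x. 0 \<partial>N)"
    proof (rule integral_dominated_convergence[where w = "\<lambda>x. 2 * (L / V k)"])
      show "AE x in N. (\<lambda>n. \<bar>a (r n) k x - a' k x\<bar>) \<longlonglongrightarrow> 0"
        using tendsto_rabs_zero[OF LIM_zero[OF a'_lim]] by simp
      show "AE x in N. norm \<bar>a (r n) k x - a' k x\<bar> \<le> 2 * (L / V k)" for n
        using a_bound[of "r n" k] a'_bound[of k]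
        by (intro AE_I2) (smt (verit) real_norm_def)
    qed (auto intro!: N_meas)
    then show ?thesis by simp
  qed
  show ?thesis
  proof (rule that[OF r(1)])
    fix e :: real assume e: "0 < e"
    \<comment> \<open>The radius is fixed first, making the averaging error at most
      \<open>e / 4\<close> for every \<open>n\<close>; then \<open>M\<close> is taken from the
      convergence of the averages at that radius. Two errors of each kind add up to
      \<open>e\<close>.\<close>
    obtain k where k: "1 / real (Suc k) < e / (4 * (L + 1))"
      using nat_approx_posE[of "e / (4 * (L + 1))"] e L by auto
    have \<rho>L: "\<rho> k * L \<le> e / 4"
    proof -
      have "\<rho> k * L \<le> e / (4 * (L + 1)) * L" using k L by (intro mult_right_mono) (auto simp: \<rho>_def)
      also have "\<dots> \<le> e / 4" using L e by (simp add: divide_simps)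
      finally show ?thesis .
    qed
    have "0 < e / 4" using e by simp
    from order_tendstoD(2)[OF int_lim[of k] this] obtain M
      where M: "\<And>n. n \<ge> M \<Longrightarrow> (\<integral>x. \<bar>a (r n) k x - a' k x\<bar> \<partial>N) < e / 4"
      by (auto simp: eventually_sequentially)
    have int: "integrable N (\<lambda>x. \<bar>a (r n) k x - a' k x\<bar>)" for n
    proof (rule Bochner_Integration.integrable_bound[of N "\<lambda>x. 2 * (L / V k)"])
      show "AE x in N. norm \<bar>a (r n) k x - a' k x\<bar> \<le> norm (2 * (L / V k))"
        using a_bound[of "r n" k] a'_bound[of k]
        by (intro AE_I2) (smt (verit) real_norm_def)
    qed (auto intro!: N_meas)
    have part: "(\<integral>\<^sup>+x. ennreal \<bar>a (r n) k x - a' k x\<bar> * indicator \<Omega> x \<partial>lborel) \<le> ennreal (e / 4)" if "n \<ge> M" for n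
    proof -
      have "(\<integral>\<^sup>+x. ennreal \<bar>a (r n) k x - a' k x\<bar> * indicator \<Omega> x \<partial>lborel) = (\<integral>\<^sup>+x. ennreal \<bar>a (r n) k x - a' k x\<bar> \<partial>N)"
        using \<Omega> by (simp add: N_def nn_integral_restrict_space)
      also have "\<dots> = ennreal (\<integral>x. \<bar>a (r n) k x - a' k x\<bar> \<partial>N)" by (rule nn_integral_eq_integral[OF int]) simp
      also have "\<dots> \<le> ennreal (e / 4)" using M[OF that] by (intro ennreal_leI) auto
      finally show ?thesis .
    qed
    have dev: "(\<integral>\<^sup>+x. ennreal \<bar>a n k x - \<phi> n x\<bar> * indicator \<Omega> x \<partial>lborel) \<le> ennreal (e / 4)" for n
    proof -
      have "(\<integral>\<^sup>+x. ennreal \<bar>a n k x - \<phi> n x\<bar> * indicator \<Omega> x \<partial>lborel)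
          \<le> (\<integral>\<^sup>+x. ennreal (\<bar>a n k x - \<phi> n x\<bar> powr 1) * indicator UNIV x \<partial>lborel)"
        by (intro nn_integral_mono) (auto simp: indicator_def)
      also have "\<dots> \<le> ennreal (\<rho> k powr 1) * (\<integral>\<^sup>+x. ennreal (norm (G n x) powr 1) * indicator UNIV x \<partial>lborel)"
        unfolding a_def using \<rho> by (intro C1.avg_estimate) auto
      also have "\<dots> \<le> ennreal (\<rho> k) * ennreal L"
        using L(3)[of n] \<rho>[of k] by (intro mult_mono) auto
      also have "\<dots> = ennreal (\<rho> k * L)" using \<rho>[of k] L by (simp add: ennreal_mult)
      also have "\<dots> \<le> ennreal (e / 4)" by (rule ennreal_leI[OF \<rho>L])
      finally show ?thesis .
    qed
    have "(\<integral>\<^sup>+x. ennreal \<bar>\<phi> (r i) x - \<phi> (r j) x\<bar> * indicator \<Omega> x \<partial>lborel) \<le> ennreal e" if ij: "i \<ge> M" "j \<ge> M" for i j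
    proof -
      have [measurable]: "\<Omega> \<in> sets borel" by (fact \<Omega>)
      have "(\<integral>\<^sup>+x. ennreal \<bar>\<phi> (r i) x - \<phi> (r j) x\<bar> * indicator \<Omega> x \<partial>lborel)
        \<le> (\<integral>\<^sup>+x. (ennreal \<bar>a (r i) k x - \<phi> (r i) x\<bar> * indicator \<Omega> x + ennreal \<bar>a (r i) k x - a' k x\<bar> * indicator \<Omega> x)
            + (ennreal \<bar>a (r j) k x - a' k x\<bar> * indicator \<Omega> x + ennreal \<bar>a (r j) k x - \<phi> (r j) x\<bar> * indicator \<Omega> x) \<partial>lborel)"
        by (intro nn_integral_mono) (auto simp: indicator_def ennreal_plus[symmetric] simp del: ennreal_plus intro!: ennreal_leI)
      also have "\<dots> = ((\<integral>\<^sup>+x. ennreal \<bar>a (r i) k x - \<phi> (r i) x\<bar> * indicator \<Omega> x \<partial>lborel) + (\<integral>\<^sup>+x. ennreal \<bar>a (r i) k x - a' k x\<bar> * indicator \<Omega> x \<partial>lborel))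
            + ((\<integral>\<^sup>+x. ennreal \<bar>a (r j) k x - a' k x\<bar> * indicator \<Omega> x \<partial>lborel) + (\<integral>\<^sup>+x. ennreal \<bar>a (r j) k x - \<phi> (r j) x\<bar> * indicator \<Omega> x \<partial>lborel))"
        by (simp add: nn_integral_add)
      also have "\<dots> \<le> (ennreal (e / 4) + ennreal (e / 4)) + (ennreal (e / 4) + ennreal (e / 4))"
        by (intro add_mono dev part ij)
      also have "\<dots> = ennreal e" using e by (simp add: ennreal_plus[symmetric] del: ennreal_plus)
      finally show ?thesis .
    qed
    then show "\<exists>N. \<forall>i\<ge>N. \<forall>j\<ge>N. (\<integral>\<^sup>+x. ennreal \<bar>\<phi> (r i) x - \<phi> (r j) x\<bar> * indicator \<Omega> x \<partial>lborel) \<le> ennreal e" by blast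
  qed
qed

section \<open>Test functions\<close>

lemma smooth_funD:
  assumes "smooth_fun f"
  obtains f' where "\<And>x. (f has_derivative f' x) (at x)" "\<And>v. smooth_fun (\<lambda>x. f' x v)"
  using assms by (cases rule: smooth_fun.cases) blast

lemma smooth_fun_zero: "smooth_fun (\<lambda>x. 0)"
proof -
  define R where "R = (\<lambda>f :: 'a \<Rightarrow> real. f = (\<lambda>x. 0))"
  have "smooth_fun f" if "R f" for f
    using that
  proof (coinduct rule: smooth_fun.coinduct)
    case (smooth_fun f)
    then show ?case by (intro exI[of _ f] exI[of _ "\<lambda>x v. 0"]) (auto simp: R_def)
  qed
  then show ?thesis by (simp add: R_def)
qed

text \<open>Coinduction over all functions of this form with the given \<open>c\<close>: the
  derivative in a fixed direction has the same form again.\<close>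

lemma smooth_fun_add_scale:
  assumes "smooth_fun f" "smooth_fun g"
  shows "smooth_fun (\<lambda>x. f x + c * g x)"
proof -
  define R where "R = (\<lambda>h :: 'a \<Rightarrow> real. \<exists>f g. smooth_fun f \<and> smooth_fun g \<and> h = (\<lambda>x. f x + c * g x))"
  have *: "smooth_fun h" if "R h" for h
    using that
  proof (coinduct rule: smooth_fun.coinduct)
    case (smooth_fun h)
    then obtain f g where fg: "smooth_fun f" "smooth_fun g" "h = (\<lambda>x. f x + c * g x)" by (auto simp: R_def)
    obtain f' where f': "\<And>x. (f has_derivative f' x) (at x)" "\<And>v. smooth_fun (\<lambda>x. f' x v)"
      using smooth_funD[OF fg(1)] by blast
    obtain g' where g': "\<And>x. (g has_derivative g' x) (at x)" "\<And>v. smooth_fun (\<lambda>x. g' x v)"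
      using smooth_funD[OF fg(2)] by blast
    show ?case
    proof (intro exI conjI allI)
      show "h = h" ..
      show "(h has_derivative (\<lambda>v. f' x v + c * g' x v)) (at x)" for x
        unfolding fg(3) by (intro derivative_intros f' g' has_derivative_mult_right)
      show "R (\<lambda>x. f' x v + c * g' x v) \<or> smooth_fun (\<lambda>x. f' x v + c * g' x v)" for v
        using f'(2) g'(2) by (auto simp: R_def)
    qed
  qed
  show ?thesis by (rule *) (unfold R_def, rule exI[of _ f], rule exI[of _ g], simp add: assms)
qed

lemma grad_eqI:
  assumes "(f has_derivative (\<lambda>h. w \<bullet> h)) (at x)"
  shows "grad f x = w"
proof -
  have "frechet_derivative f (at x) = (\<lambda>h. w \<bullet> h)"
    using frechet_derivative_at[OF assms] by simp
  then show ?thesis by (simp add: grad_def euclidean_representation)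
qed

lemma smooth_fun_C1:
  assumes "smooth_fun f"
  shows "C1_function f (grad f)"
proof -
  obtain f' where f': "\<And>x. (f has_derivative f' x) (at x)" "\<And>v. smooth_fun (\<lambda>x. f' x v)"
    using smooth_funD[OF assms] by blast
  have fr: "frechet_derivative f (at x) = f' x" for x
    using frechet_derivative_at[OF f'(1)] by simp
  have eq: "grad f x \<bullet> h = f' x h" for x h
  proof -
    interpret linear "f' x" using f'(1) by (rule has_derivative_linear)
    have "f' x h = f' x (\<Sum>i\<in>Basis. (h \<bullet> i) *\<^sub>R i)" by (simp add: euclidean_representation)
    also have "\<dots> = (\<Sum>i\<in>Basis. (h \<bullet> i) * f' x i)" by (simp add: sum scale)
    finally show ?thesis
      by (simp add: grad_def fr inner_sum_left) (intro sum.cong refl, simp add: inner_commute)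
  qed
  show ?thesis
  proof
    show "(f has_derivative (\<lambda>h. grad f x \<bullet> h)) (at x)" for x
      using f'(1) by (simp add: eq)
    have "continuous_on UNIV (\<lambda>x. f' x v)" for v
    proof -
      obtain f'' where f'': "\<And>x. ((\<lambda>x. f' x v) has_derivative f'' x) (at x)"
        using smooth_funD[OF f'(2)] by blast
      show ?thesis
        by (rule continuous_at_imp_continuous_on, rule ballI, rule has_derivative_continuous[OF f''])
    qed
    then show "continuous_on UNIV (grad f)"
      unfolding grad_def[abs_def] fr by (intro continuous_intros)
  qed
qed

text \<open>The gradient vanishes outside \<open>\<Omega>\<close> because \<open>\<phi>\<close> is
  zero on the complement of its closed support, an open set.\<close>

lemma test_funD:
  assumes "test_fun \<Omega> \<phi>"
  shows "C1_function \<phi> (grad \<phi>)" and "x \<notin> \<Omega> \<Longrightarrow> \<phi> x = 0" and "x \<notin> \<Omega> \<Longrightarrow> grad \<phi> x = 0"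
proof -
  have t: "smooth_fun \<phi>" "closure {x. \<phi> x \<noteq> 0} \<subseteq> \<Omega>" using assms by (auto simp: test_fun_def)
  show "C1_function \<phi> (grad \<phi>)" by (rule smooth_fun_C1[OF t(1)])
  have out: "\<phi> y = 0" if "y \<notin> closure {x. \<phi> x \<noteq> 0}" for y
  proof (rule ccontr)
    assume "\<phi> y \<noteq> 0"
    then have "y \<in> {x. \<phi> x \<noteq> 0}" by simp
    then have "y \<in> closure {x. \<phi> x \<noteq> 0}" by (rule subsetD[OF closure_subset])
    then show False using that by simp
  qed
  show "\<phi> x = 0" if "x \<notin> \<Omega>" by (rule out[OF contra_subsetD[OF t(2) that]])
  show "grad \<phi> x = 0" if "x \<notin> \<Omega>"
  proof (rule grad_eqI)
    have "((\<lambda>x. 0) has_derivative (\<lambda>h. 0 \<bullet> h)) (at x)" by simp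
    then show "(\<phi> has_derivative (\<lambda>h. 0 \<bullet> h)) (at x)"
    proof (rule has_derivative_transform_within_open)
      show "open (- closure {x. \<phi> x \<noteq> 0})" by (rule open_Compl[OF closed_closure])
      show "x \<in> - closure {x. \<phi> x \<noteq> 0}" using contra_subsetD[OF t(2) that] by simp
      show "0 = \<phi> y" if "y \<in> - closure {x. \<phi> x \<noteq> 0}" for y
        using out[of y] that by simp
    qed
  qed
qed

lemma test_fun_zero: "test_fun \<Omega> (\<lambda>x. 0)"
  by (simp add: test_fun_def smooth_fun_zero)

lemma grad_zero [simp]: "grad (\<lambda>x. 0) x = 0"
  by (rule grad_eqI) simp

lemma test_fun_add_scale:
  assumes "test_fun \<Omega> \<phi>" "test_fun \<Omega> \<psi>"
  shows "test_fun \<Omega> (\<lambda>x. \<phi> x + c * \<psi> x)"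
proof -
  have sub: "closure {x. \<phi> x + c * \<psi> x \<noteq> 0} \<subseteq> closure {x. \<phi> x \<noteq> 0} \<union> closure {x. \<psi> x \<noteq> 0}"
    unfolding closure_Un[symmetric] by (rule closure_mono) auto
  have "compact (closure {x. \<phi> x \<noteq> 0} \<union> closure {x. \<psi> x \<noteq> 0})"
    using assms by (intro compact_Un) (auto simp: test_fun_def)
  then have "compact (closure {x. \<phi> x + c * \<psi> x \<noteq> 0})"
    using sub by (meson closed_closure compact_eq_bounded_closed bounded_subset)
  then show ?thesis
    using assms sub by (auto simp: test_fun_def intro: smooth_fun_add_scale)
qed

lemma grad_add_scale:
  assumes "test_fun \<Omega> \<phi>" "test_fun \<Omega> \<psi>"
  shows "grad (\<lambda>x. \<phi> x + c * \<psi> x) x = grad \<phi> x + c *\<^sub>R grad \<psi> x"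
proof (rule grad_eqI)
  interpret a: C1_function \<phi> "grad \<phi>" by (rule test_funD[OF assms(1)])
  interpret b: C1_function \<psi> "grad \<psi>" by (rule test_funD[OF assms(2)])
  have "((\<lambda>x. \<phi> x + c * \<psi> x) has_derivative (\<lambda>h. grad \<phi> x \<bullet> h + c * (grad \<psi> x \<bullet> h))) (at x)"
    by (intro derivative_intros a.deriv b.deriv has_derivative_mult_right)
  then show "((\<lambda>x. \<phi> x + c * \<psi> x) has_derivative (\<lambda>h. (grad \<phi> x + c *\<^sub>R grad \<psi> x) \<bullet> h)) (at x)"
    by (simp add: inner_add_left)
qed

lemma continuous_zero_outside_bounded:
  fixes w :: "'a::euclidean_space \<Rightarrow> 'b::real_normed_vector"
  assumes "continuous_on UNIV w" "bounded \<Omega>" "\<And>x. x \<notin> \<Omega> \<Longrightarrow> w x = 0"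
  obtains S where "0 \<le> S" "\<And>x. norm (w x) \<le> S"
proof -
  have "compact (w ` closure \<Omega>)"
    using assms by (intro compact_continuous_image) (auto intro: continuous_on_subset)
  then obtain S where S: "\<And>y. y \<in> w ` closure \<Omega> \<Longrightarrow> norm y \<le> S"
    using compact_imp_bounded bounded_iff by metis
  show ?thesis
  proof (rule that[of "max S 0"])
    show "norm (w x) \<le> max S 0" for x
      using S[of "w x"] assms(3)[of x] closure_subset[of \<Omega>] by (cases "x \<in> \<Omega>") auto
  qed simp
qed

text \<open>By translation invariance the integral of \<open>F (x + t *\<^sub>R e)\<close> does not
  depend on \<open>t\<close>; differentiation under the integral at \<open>t = 0\<close> gives the
  claim without iterated integrals.\<close>

lemma integral_partial_derivative_eq_0:
  assumes "C1_function F H" and bdd: "bounded \<Omega>" and zero: "\<And>x. x \<notin> \<Omega> \<Longrightarrow> F x = 0" "\<And>x. x \<notin> \<Omega> \<Longrightarrow> H x = 0"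
    and e: "norm e = 1"
  shows "(\<integral>x. H x \<bullet> e \<partial>lborel) = 0"
proof -
  interpret C1_function F H by fact
  obtain S where S: "0 \<le> S" "\<And>x. norm (H x) \<le> S"
    using continuous_zero_outside_bounded[OF cont_G bdd zero(2)] by blast
  obtain S' where S': "0 \<le> S'" "\<And>x. norm (F x) \<le> S'"
    using continuous_zero_outside_bounded[OF cont bdd zero(1)] by blast
  obtain R where R: "\<And>x. x \<in> \<Omega> \<Longrightarrow> norm x \<le> R" using bdd bounded_iff by metis
  have out: "norm x + 1 \<le> R + 2" if "x + t *\<^sub>R e \<in> \<Omega>" "\<bar>t\<bar> < 1" for x t
  proof -
    have "norm x \<le> norm (x + t *\<^sub>R e) + norm (t *\<^sub>R e)" using norm_triangle_ineq4[of "x + t *\<^sub>R e" "t *\<^sub>R e"] by simp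
    then show ?thesis using R[OF that(1)] that(2) e by simp
  qed
  \<comment> \<open>For \<open>\<bar>t\<bar> < 1\<close> the shifted functions live in
    \<open>cball 0 (R + 1)\<close>, so one constant on this ball dominates both the function and its
    derivative.\<close>
  define B where "B x = (S + S') * indicator (cball 0 (R + 1)) x" for x :: 'a
  have B: "integrable lborel B"
    unfolding B_def using emeasure_lborel_cball_finite[of "0::'a" "R + 1"] by (intro integrable_mult_right integrable_real_indicator) auto
  have "((\<lambda>t. \<integral>x. F (x + t *\<^sub>R e) \<partial>lborel) has_real_derivative (\<integral>x. H (x + 0 *\<^sub>R e) \<bullet> e \<partial>lborel)) (at 0)"
  proof (rule has_real_derivative_lebesgue_integral[where B = B])
    fix t :: real assume t: "\<bar>t\<bar> < 1"
    show "integrable lborel (\<lambda>x. F (x + t *\<^sub>R e))"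
    proof (rule Bochner_Integration.integrable_bound[OF B])
      show "AE x in lborel. norm (F (x + t *\<^sub>R e)) \<le> norm (B x)"
      proof (rule AE_I2)
        fix x
        show "norm (F (x + t *\<^sub>R e)) \<le> norm (B x)"
        proof (cases "x + t *\<^sub>R e \<in> \<Omega>")
          case True
          then have "x \<in> cball 0 (R + 1)" using out[OF True t] by simp
          then show ?thesis using S'(2)[of "x + t *\<^sub>R e"] S(1) S'(1) by (simp add: B_def)
        qed (simp add: zero)
      qed
    qed measurable
  next
    fix x t
    have "((\<lambda>t. x + t *\<^sub>R e) has_derivative (\<lambda>s. s *\<^sub>R e)) (at t)"
      by (auto intro!: derivative_eq_intros)
    from has_derivative_compose[OF this deriv]
    show "((\<lambda>t. F (x + t *\<^sub>R e)) has_real_derivative H (x + t *\<^sub>R e) \<bullet> e) (at t)"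
      unfolding has_field_derivative_def by (rule has_derivative_eq_rhs) (auto simp: fun_eq_iff)
  next
    fix x and t :: real assume t: "\<bar>t\<bar> < 1"
    show "\<bar>H (x + t *\<^sub>R e) \<bullet> e\<bar> \<le> B x"
    proof (cases "x + t *\<^sub>R e \<in> \<Omega>")
      case True
      then have "x \<in> cball 0 (R + 1)" using out[OF True t] by simp
      then have "B x = S + S'" by (simp add: B_def)
      moreover have "\<bar>H (x + t *\<^sub>R e) \<bullet> e\<bar> \<le> S"
        using Cauchy_Schwarz_ineq2[of "H (x + t *\<^sub>R e)" e] S(2)[of "x + t *\<^sub>R e"] e by simp
      ultimately show ?thesis using S' by simp
    qed (use S S' in \<open>simp add: zero B_def\<close>)
  qed (use B in simp_all)
  moreover have "(\<integral>x. F (x + t *\<^sub>R e) \<partial>lborel) = (\<integral>x. F x \<partial>lborel)" for t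
  proof -
    have "(\<integral>x. F x \<partial>lborel) = (\<integral>x. F x \<partial>distr lborel borel ((+) (t *\<^sub>R e)))"
      by (simp add: lborel_distr_plus)
    also have "\<dots> = (\<integral>x. F (t *\<^sub>R e + x) \<partial>lborel)" by (rule integral_distr) auto
    finally show ?thesis by (simp add: add.commute)
  qed
  ultimately have "((\<lambda>t::real. \<integral>x. F x \<partial>lborel) has_real_derivative (\<integral>x. H x \<bullet> e \<partial>lborel)) (at 0)" by simp
  then show ?thesis using DERIV_unique DERIV_const by blast
qed

text \<open>The product \<open>\<phi> * \<psi>\<close> is continuously differentiable and vanishes
  with its gradient outside \<open>\<Omega>\<close>, so its partial derivatives integrate to
  zero.\<close>

lemma test_fun_integration_by_parts:
  assumes \<phi>: "test_fun \<Omega> \<phi>" and \<psi>: "test_fun \<Omega> \<psi>" and bdd: "bounded \<Omega>" "open \<Omega>" and i: "i \<in> Basis"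
  shows "(LINT x:\<Omega>|lebesgue. \<phi> x * (grad \<psi> x \<bullet> i)) = - (LINT x:\<Omega>|lebesgue. (grad \<phi> x \<bullet> i) * \<psi> x)"
proof -
  interpret a: C1_function \<phi> "grad \<phi>" by (rule test_funD[OF \<phi>])
  interpret b: C1_function \<psi> "grad \<psi>" by (rule test_funD[OF \<psi>])
  note z = test_funD(2)[OF \<phi>] test_funD(2)[OF \<psi>] test_funD(3)[OF \<phi>] test_funD(3)[OF \<psi>]
  have C1: "C1_function (\<lambda>x. \<phi> x * \<psi> x) (\<lambda>x. \<phi> x *\<^sub>R grad \<psi> x + \<psi> x *\<^sub>R grad \<phi> x)"
  proof
    show "((\<lambda>x. \<phi> x * \<psi> x) has_derivative (\<lambda>h. (\<phi> x *\<^sub>R grad \<psi> x + \<psi> x *\<^sub>R grad \<phi> x) \<bullet> h)) (at x)" for x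
      by (rule has_derivative_eq_rhs[OF has_derivative_mult[OF a.deriv b.deriv]]) (auto simp: inner_add_left)
    show "continuous_on UNIV (\<lambda>x. \<phi> x *\<^sub>R grad \<psi> x + \<psi> x *\<^sub>R grad \<phi> x)"
      by (intro continuous_intros a.cont b.cont a.cont_G b.cont_G)
  qed
  have int: "integrable lborel w" if "continuous_on UNIV w" "\<And>x. x \<notin> \<Omega> \<Longrightarrow> w x = 0" for w :: "'a \<Rightarrow> real"
  proof -
    have "integrable lborel (\<lambda>x. indicator (closure \<Omega>) x *\<^sub>R w x)"
      using that bdd by (intro borel_integrable_compact) (auto intro: continuous_on_subset)
    moreover have "(\<lambda>x. indicator (closure \<Omega>) x *\<^sub>R w x) = w"
      using that(2) closure_subset[of \<Omega>] by (fastforce simp: indicator_def fun_eq_iff)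
    ultimately show ?thesis by simp
  qed
  have i1: "integrable lborel (\<lambda>x. \<phi> x * (grad \<psi> x \<bullet> i))"
    by (rule int) (auto intro!: continuous_intros a.cont b.cont_G simp: z)
  have i2: "integrable lborel (\<lambda>x. (grad \<phi> x \<bullet> i) * \<psi> x)"
    by (rule int) (auto intro!: continuous_intros b.cont a.cont_G simp: z)
  have "0 = (\<integral>x. (\<phi> x *\<^sub>R grad \<psi> x + \<psi> x *\<^sub>R grad \<phi> x) \<bullet> i \<partial>lborel)"
    using i by (intro integral_partial_derivative_eq_0[OF C1 bdd(1), symmetric]) (auto simp: z)
  also have "\<dots> = (\<integral>x. \<phi> x * (grad \<psi> x \<bullet> i) + (grad \<phi> x \<bullet> i) * \<psi> x \<partial>lborel)"
    by (simp add: inner_add_left mult.commute)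
  also have "\<dots> = (\<integral>x. \<phi> x * (grad \<psi> x \<bullet> i) \<partial>lborel) + (\<integral>x. (grad \<phi> x \<bullet> i) * \<psi> x \<partial>lborel)"
    using i1 i2 by simp
  finally have "(\<integral>x. \<phi> x * (grad \<psi> x \<bullet> i) \<partial>lborel) = - (\<integral>x. (grad \<phi> x \<bullet> i) * \<psi> x \<partial>lborel)" by simp
  moreover have "(LINT x:\<Omega>|lebesgue. w x) = (\<integral>x. w x \<partial>lborel)" if "\<And>x. x \<notin> \<Omega> \<Longrightarrow> w x = 0" "integrable lborel w" for w :: "'a \<Rightarrow> real"
  proof -
    have "(\<lambda>x. indicator \<Omega> x *\<^sub>R w x) = w" using that(1) by (auto simp: indicator_def fun_eq_iff)
    then show ?thesis using that(2) by (simp add: set_lebesgue_integral_def integral_completion)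
  qed
  ultimately show ?thesis using i1 i2 by (simp add: z)
qed

section \<open>Variable exponent spaces\<close>

text \<open>A substitute for homogeneity: with the factor bounded by \<open>C \<ge> 1\<close>, the
  worst exponent is \<open>P\<close>.\<close>

lemma vmod_scale_le:
  fixes w :: "'a \<Rightarrow> 'b::euclidean_space"
  assumes [measurable]: "w \<in> borel_measurable M" "p \<in> borel_measurable M"
    and p: "\<And>x. x \<in> space M \<Longrightarrow> 0 \<le> p x \<and> p x \<le> P" and c: "\<bar>c\<bar> \<le> C" "1 \<le> C"
  shows "vmod M p (\<lambda>x. c *\<^sub>R w x) \<le> ennreal (C powr P) * vmod M p w"
proof -
  have "vmod M p (\<lambda>x. c *\<^sub>R w x) \<le> (\<integral>\<^sup>+x. ennreal (C powr P) * ennreal (norm (w x) powr p x) \<partial>M)"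
    unfolding vmod_def
  proof (rule nn_integral_mono)
    fix x assume x: "x \<in> space M"
    have "norm (c *\<^sub>R w x) powr p x = \<bar>c\<bar> powr p x * norm (w x) powr p x" by (simp add: powr_mult)
    also have "\<bar>c\<bar> powr p x \<le> C powr p x" using p[OF x] c by (intro powr_mono2) auto
    also have "C powr p x \<le> C powr P" using p[OF x] c by (intro powr_mono) auto
    finally show "ennreal (norm (c *\<^sub>R w x) powr p x) \<le> ennreal (C powr P) * ennreal (norm (w x) powr p x)"
      by (simp add: ennreal_mult[symmetric] ennreal_leI mult_right_mono)
  qed
  also have "\<dots> = ennreal (C powr P) * vmod M p w"
    unfolding vmod_def by (rule nn_integral_cmult) measurable
  finally show ?thesis .
qed

text \<open>For a factor at most 1 the worst exponent is 1, so shrinking the function gains at least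
  linearly.\<close>

lemma vmod_scale_small:
  fixes w :: "'a \<Rightarrow> 'b::euclidean_space"
  assumes [measurable]: "w \<in> borel_measurable M" "p \<in> borel_measurable M"
    and p: "\<And>x. x \<in> space M \<Longrightarrow> 1 \<le> p x" and c: "0 < c" "c \<le> 1"
  shows "vmod M p (\<lambda>x. c *\<^sub>R w x) \<le> ennreal c * vmod M p w"
proof -
  have "vmod M p (\<lambda>x. c *\<^sub>R w x) \<le> (\<integral>\<^sup>+x. ennreal c * ennreal (norm (w x) powr p x) \<partial>M)"
    unfolding vmod_def
  proof (rule nn_integral_mono)
    fix x assume x: "x \<in> space M"
    have "norm (c *\<^sub>R w x) powr p x = c powr p x * norm (w x) powr p x" using c by (simp add: powr_mult)
    also have "c powr p x \<le> c powr 1" using p[OF x] c by (intro powr_mono') auto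
    finally show "ennreal (norm (c *\<^sub>R w x) powr p x) \<le> ennreal c * ennreal (norm (w x) powr p x)"
      using c by (simp add: ennreal_mult[symmetric] ennreal_leI mult_right_mono)
  qed
  also have "\<dots> = ennreal c * vmod M p w"
    unfolding vmod_def by (rule nn_integral_cmult) measurable
  finally show ?thesis .
qed

lemma vmod_add_le:
  fixes v w :: "'a \<Rightarrow> 'b::euclidean_space"
  assumes [measurable]: "v \<in> borel_measurable M" "w \<in> borel_measurable M" "p \<in> borel_measurable M"
    and p: "\<And>x. x \<in> space M \<Longrightarrow> 0 \<le> p x \<and> p x \<le> P"
  shows "vmod M p (\<lambda>x. v x + w x) \<le> ennreal (2 powr P) * (vmod M p v + vmod M p w)"
proof -
  have "vmod M p (\<lambda>x. v x + w x)
     \<le> (\<integral>\<^sup>+x. ennreal (2 powr P) * (ennreal (norm (v x) powr p x) + ennreal (norm (w x) powr p x)) \<partial>M)"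
    unfolding vmod_def
  proof (rule nn_integral_mono)
    fix x assume x: "x \<in> space M"
    show "ennreal (norm (v x + w x) powr p x) \<le> ennreal (2 powr P) * (ennreal (norm (v x) powr p x) + ennreal (norm (w x) powr p x))"
      using powr_norm_add_le[of "p x" P "v x" "w x"] p[OF x]
      by (simp add: ennreal_mult[symmetric] ennreal_plus[symmetric] ennreal_leI del: ennreal_plus)
  qed
  also have "\<dots> = ennreal (2 powr P) * (vmod M p v + vmod M p w)"
    unfolding vmod_def by (subst nn_integral_cmult, measurable, subst nn_integral_add, auto)
  finally show ?thesis .
qed

lemma vmod_diff_triangle:
  fixes u v w :: "'a \<Rightarrow> 'b::euclidean_space"
  assumes "u \<in> borel_measurable M" "v \<in> borel_measurable M" "w \<in> borel_measurable M" "p \<in> borel_measurable M"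
    and p: "\<And>x. x \<in> space M \<Longrightarrow> 0 \<le> p x \<and> p x \<le> P"
  shows "vmod M p (\<lambda>x. u x - w x) \<le> ennreal (2 powr P) * (vmod M p (\<lambda>x. u x - v x) + vmod M p (\<lambda>x. v x - w x))"
  using vmod_add_le[of "\<lambda>x. u x - v x" M "\<lambda>x. v x - w x" p P] assms by simp

lemma ennreal_cmult_tendsto_0:
  fixes f :: "'c \<Rightarrow> ennreal"
  assumes "(f \<longlongrightarrow> 0) F"
  shows "((\<lambda>n. ennreal c * f n) \<longlongrightarrow> 0) F"
  using ennreal_tendsto_cmult[of "ennreal c" f 0 F] assms by simp

lemma ennreal_tendsto_0_le:
  fixes f g :: "'c \<Rightarrow> ennreal"
  assumes "(g \<longlongrightarrow> 0) F" "\<And>n. f n \<le> g n"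
  shows "(f \<longlongrightarrow> 0) F"
  using assms by (intro tendsto_sandwich[of "\<lambda>_. 0" f F g 0]) auto

text \<open>Integration of \<open>norm_powr_le_norm_powr\<close>: first \<open>\<delta>\<close>
  makes the term with the total mass at most \<open>e / 2\<close>, then the modular beats the factor
  \<open>\<delta> powr (s - P)\<close>.\<close>

lemma (in finite_measure) vmod_tendsto_0_lower_exponent:
  fixes w :: "nat \<Rightarrow> 'a \<Rightarrow> 'b::euclidean_space"
  assumes [measurable]: "\<And>n. w n \<in> borel_measurable M" "p \<in> borel_measurable M"
    and s: "0 < s" and p: "\<And>x. x \<in> space M \<Longrightarrow> s \<le> p x \<and> p x \<le> P"
    and lim: "(\<lambda>n. vmod M p (w n)) \<longlonglongrightarrow> 0"
  shows "(\<lambda>n. vmod M (\<lambda>x. s) (w n)) \<longlonglongrightarrow> 0"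
  unfolding ennreal_tendsto_0_iff_eventually_le
proof (intro allI impI)
  fix e :: real assume e: "0 < e"
  define \<mu> where "\<mu> = measure M (space M)"
  have \<mu>: "0 \<le> \<mu>" by (simp add: \<mu>_def)
  define \<delta> where "\<delta> = min 1 ((e / (2 * (\<mu> + 1))) powr (1 / s))"
  have \<delta>: "0 < \<delta>" "\<delta> \<le> 1" using e \<mu> by (auto simp: \<delta>_def)
  have "\<delta> powr s \<le> ((e / (2 * (\<mu> + 1))) powr (1 / s)) powr s"
    using s \<delta> by (intro powr_mono2) (auto simp: \<delta>_def)
  also have "\<dots> = e / (2 * (\<mu> + 1))" using s e \<mu> by (simp add: powr_powr)
  finally have "\<delta> powr s * \<mu> \<le> e / (2 * (\<mu> + 1)) * \<mu>" using \<mu> by (rule mult_right_mono)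
  also have "\<dots> \<le> e / 2" using e \<mu> by (simp add: divide_simps)
  finally have \<delta>s: "\<delta> powr s * \<mu> \<le> e / 2" .
  have le: "vmod M (\<lambda>x. s) (w n) \<le> ennreal (e / 2) + ennreal (\<delta> powr (s - P)) * vmod M p (w n)" for n
  proof -
    have "vmod M (\<lambda>x. s) (w n) \<le> (\<integral>\<^sup>+x. ennreal (\<delta> powr s) + ennreal (\<delta> powr (s - P)) * ennreal (norm (w n x) powr p x) \<partial>M)"
      unfolding vmod_def
    proof (rule nn_integral_mono)
      fix x assume x: "x \<in> space M"
      show "ennreal (norm (w n x) powr s) \<le> ennreal (\<delta> powr s) + ennreal (\<delta> powr (s - P)) * ennreal (norm (w n x) powr p x)"
        using norm_powr_le_norm_powr[of s "p x" P \<delta> "w n x"] p[OF x] s \<delta>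
        by (simp add: ennreal_mult[symmetric] ennreal_plus[symmetric] ennreal_leI del: ennreal_plus)
    qed
    also have "\<dots> = ennreal (\<delta> powr s) * emeasure M (space M) + ennreal (\<delta> powr (s - P)) * vmod M p (w n)"
      unfolding vmod_def by (subst nn_integral_add; (measurable)?) (simp add: nn_integral_cmult)
    also have "ennreal (\<delta> powr s) * emeasure M (space M) = ennreal (\<delta> powr s * \<mu>)"
      by (simp add: \<mu>_def emeasure_eq_measure ennreal_mult)
    also have "\<dots> \<le> ennreal (e / 2)" by (rule ennreal_leI[OF \<delta>s])
    finally show ?thesis by (simp add: add_right_mono)
  qed
  have "(\<lambda>n. ennreal (\<delta> powr (s - P)) * vmod M p (w n)) \<longlonglongrightarrow> 0" by (rule ennreal_cmult_tendsto_0[OF lim])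
  then have "\<forall>\<^sub>F n in sequentially. ennreal (\<delta> powr (s - P)) * vmod M p (w n) \<le> ennreal (e / 2)"
    using e unfolding ennreal_tendsto_0_iff_eventually_le by simp
  then show "\<forall>\<^sub>F n in sequentially. vmod M (\<lambda>x. s) (w n) \<le> ennreal e"
  proof eventually_elim
    case (elim n)
    have "vmod M (\<lambda>x. s) (w n) \<le> ennreal (e / 2) + ennreal (e / 2)"
      using le[of n] elim by (meson add_left_mono order_trans)
    also have "\<dots> = ennreal e" using e by (simp add: ennreal_plus[symmetric] del: ennreal_plus)
    finally show ?case .
  qed
qed

text \<open>The theory of one exponent; it is interpreted later for \<open>p1\<close> and for
  \<open>p2\<close> with common bounds \<open>q\<close> and \<open>P\<close>.\<close>

locale variable_exponent =
  fixes \<Omega> :: "'a::euclidean_space set" and p :: "'a \<Rightarrow> real" and q P :: real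
  assumes open_\<Omega>: "open \<Omega>" and bounded_\<Omega>: "bounded \<Omega>"
    and cont_p: "continuous_on (closure \<Omega>) p"
    and p_bounds: "\<And>x. x \<in> closure \<Omega> \<Longrightarrow> q \<le> p x \<and> p x \<le> P" and q_gt_1: "1 < q"
begin

abbreviation "M \<equiv> lebesgue_on \<Omega>"

lemma \<Omega>_lebesgue [measurable]: "\<Omega> \<in> sets lebesgue" "\<Omega> \<in> sets borel"
  using open_\<Omega> by auto

lemma space_M [simp]: "space M = \<Omega>"
  by (simp add: space_restrict_space)

lemma finite_M: "finite_measure M"
proof
  have "emeasure lborel \<Omega> < \<infinity>" using bounded_\<Omega> by (rule emeasure_bounded_finite)
  then show "emeasure M (space M) \<noteq> \<infinity>"
    by (simp add: emeasure_restrict_space)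
qed

sublocale finite_measure M by (rule finite_M)

lemma p_on: "x \<in> \<Omega> \<Longrightarrow> q \<le> p x \<and> p x \<le> P"
  using p_bounds closure_subset by blast

lemma p_measurable [measurable]: "p \<in> borel_measurable M"
  by (intro continuous_imp_measurable_on_sets_lebesgue continuous_on_subset[OF cont_p closure_subset] \<Omega>_lebesgue)

lemma vmod_M_eq: "vmod M r w = (\<integral>\<^sup>+x. ennreal (norm (w x) powr r x) * indicator \<Omega> x \<partial>lborel)"
  unfolding vmod_def by (simp add: nn_integral_restrict_space nn_integral_completion)

lemma modular_eq_vmod: "modular \<Omega> p (\<lambda>x. norm (w x) / c) = vmod M p (\<lambda>x. (1 / c) *\<^sub>R w x)" if "0 < c" for w :: "'a \<Rightarrow> 'b::real_normed_vector"
  unfolding modular_def vmod_def using that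
  by (simp add: nn_integral_restrict_space)

lemma borel_measurable_M: "w \<in> borel_measurable borel \<Longrightarrow> w \<in> borel_measurable M"
  by (simp add: measurable_restrict_space1 measurable_completion)

end

text \<open>A weak gradient is known to be integrable over compact subsets of the open set; along a
  compact exhaustion its restrictions converge to it pointwise.\<close>

lemma weak_grad_measurable:
  assumes "weak_grad \<Omega> u g" "open \<Omega>"
  shows "g \<in> borel_measurable (lebesgue_on \<Omega>)"
proof -
  obtain C :: "nat \<Rightarrow> 'a set" where C: "\<And>n. compact (C n)" "\<And>n. C n \<subseteq> \<Omega>" "\<And>n. C n \<subseteq> interior (C (Suc n))" "\<Union>(range C) = \<Omega>"
    using open_Union_compact_subsets[OF assms(2)] by metis
  have C_step: "C n \<subseteq> C (Suc n)" for n
    using C(3)[of n] interior_subset[of "C (Suc n)"] by (rule order_trans)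
  have mono: "C m \<subseteq> C n" if "m \<le> n" for m n
    using that
  proof (induction rule: dec_induct)
    case (step k)
    show ?case by (rule order_trans[OF step.IH C_step])
  qed simp
  show ?thesis
  proof (rule borel_measurable_LIMSEQ_metric[where f = "\<lambda>n x. indicator (C n) x *\<^sub>R g x"])
    show "(\<lambda>x. indicator (C n) x *\<^sub>R g x) \<in> borel_measurable (lebesgue_on \<Omega>)" for n
    proof -
      have "set_integrable lebesgue (C n) g" using assms(1) C(1,2)[of n] by (simp add: weak_grad_def)
      then show ?thesis
        unfolding set_integrable_def by (intro measurable_restrict_space1) (rule borel_measurable_integrable)
    qed
    show "(\<lambda>n. indicator (C n) x *\<^sub>R g x) \<longlonglongrightarrow> g x" if "x \<in> space (lebesgue_on \<Omega>)" for x
    proof -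
      have "x \<in> \<Union>(range C)" using that C(4) by (simp add: space_restrict_space)
      then obtain m where "x \<in> C m" by blast
      then have "\<forall>\<^sub>F n in sequentially. indicator (C n) x *\<^sub>R g x = g x"
        using mono by (auto simp: eventually_sequentially indicator_def)
      then show ?thesis by (rule tendsto_eventually)
    qed
  qed
qed

context variable_exponent begin

section \<open>Luxemburg norm against modular\<close>

lemma lux_norm_norm: "lux_norm \<Omega> p u = lux_norm \<Omega> p (\<lambda>x. norm (u x))"
  by (simp add: lux_norm_def modular_def)

lemma lux_norm_eq:
  fixes w :: "'a \<Rightarrow> 'b::euclidean_space"
  shows "lux_norm \<Omega> p (\<lambda>x. norm (w x)) = Inf {c. 0 < c \<and> vmod M p (\<lambda>x. (1 / c) *\<^sub>R w x) \<le> 1}"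
proof -
  have "{c. c > 0 \<and> modular \<Omega> p (\<lambda>x. norm (w x) / c) \<le> 1} = {c. 0 < c \<and> vmod M p (\<lambda>x. (1 / c) *\<^sub>R w x) \<le> 1}"
    using modular_eq_vmod[where w = w] by auto
  then show ?thesis by (simp only: lux_norm_def)
qed

lemma p_nonneg_bound: "x \<in> space M \<Longrightarrow> 0 \<le> p x \<and> p x \<le> P"
  using p_on[of x] q_gt_1 by auto

lemma p_ge_1: "x \<in> space M \<Longrightarrow> 1 \<le> p x"
  using p_on[of x] q_gt_1 by auto

text \<open>The Luxemburg norm is the infimum of this set, and \<open>Inf\<close> carries no
  information for an empty set of reals. Any \<open>c \<ge> 1\<close> above the modular belongs to
  it, since scaling by \<open>1 / c\<close> gains at least that factor.\<close>

lemma lux_set_nonempty: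
  fixes w :: "'a \<Rightarrow> 'b::euclidean_space"
  assumes w: "w \<in> borel_measurable M" and fin: "vmod M p w < \<infinity>"
  shows "{c. 0 < c \<and> vmod M p (\<lambda>x. (1 / c) *\<^sub>R w x) \<le> 1} \<noteq> {}"
proof -
  obtain A where A: "vmod M p w = ennreal A" "0 \<le> A" using fin by (cases "vmod M p w") auto
  define c where "c = max 1 A"
  have c: "1 \<le> c" "A \<le> c" by (auto simp: c_def)
  have "vmod M p (\<lambda>x. (1 / c) *\<^sub>R w x) \<le> ennreal (1 / c) * vmod M p w"
    using c by (intro vmod_scale_small w p_measurable p_ge_1) auto
  also have "\<dots> = ennreal (1 / c * A)" unfolding A(1) using A c by (intro ennreal_mult[symmetric]) auto
  also have "\<dots> \<le> 1" using c A by (simp add: divide_le_eq_1)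
  finally have "c \<in> {c. 0 < c \<and> vmod M p (\<lambda>x. (1 / c) *\<^sub>R w x) \<le> 1}" using c by auto
  then show ?thesis by blast
qed

lemma lux_norm_nonneg:
  fixes w :: "'a \<Rightarrow> 'b::euclidean_space"
  assumes "w \<in> borel_measurable M" "vmod M p w < \<infinity>"
  shows "0 \<le> lux_norm \<Omega> p (\<lambda>x. norm (w x))"
  unfolding lux_norm_eq by (rule cInf_greatest[OF lux_set_nonempty[OF assms]]) auto

text \<open>Some \<open>c < e \<le> 1\<close> lies in the defining set, and scaling back by
  \<open>c\<close> multiplies a modular of at most 1 by no more than \<open>c\<close>.\<close>

lemma vmod_le_if_lux_norm_less:
  fixes w :: "'a \<Rightarrow> 'b::euclidean_space"
  assumes w: "w \<in> borel_measurable M" "vmod M p w < \<infinity>" and e: "e \<le> 1"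
    and lux: "lux_norm \<Omega> p (\<lambda>x. norm (w x)) < e"
  shows "vmod M p w \<le> ennreal e"
proof -
  obtain c where c: "0 < c" "vmod M p (\<lambda>x. (1 / c) *\<^sub>R w x) \<le> 1" "c < e"
    using cInf_lessD[OF lux_set_nonempty[OF w]] lux unfolding lux_norm_eq by blast
  have "vmod M p w = vmod M p (\<lambda>x. c *\<^sub>R ((1 / c) *\<^sub>R w x))" using c by simp
  also have "\<dots> \<le> ennreal c * vmod M p (\<lambda>x. (1 / c) *\<^sub>R w x)"
    using c e w by (intro vmod_scale_small p_measurable p_ge_1) auto
  also have "\<dots> \<le> ennreal c * 1" using c(2) by (rule mult_left_mono) simp
  also have "\<dots> \<le> ennreal e" using c by (simp add: ennreal_leI)
  finally show ?thesis .
qed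

text \<open>Scaling by \<open>1 / e\<close> costs at most the factor \<open>(1 / e) powr P\<close>,
  hence the smallness in the form \<open>e powr P\<close>.\<close>

lemma lux_norm_le_if_vmod_le:
  fixes w :: "'a \<Rightarrow> 'b::euclidean_space"
  assumes w: "w \<in> borel_measurable M" and e: "0 < e" "e \<le> 1" and le: "vmod M p w \<le> ennreal (e powr P)"
  shows "lux_norm \<Omega> p (\<lambda>x. norm (w x)) \<le> e"
proof -
  have "vmod M p (\<lambda>x. (1 / e) *\<^sub>R w x) \<le> ennreal ((1 / e) powr P) * vmod M p w"
    using e by (intro vmod_scale_le w p_measurable p_nonneg_bound) auto
  also have "\<dots> \<le> ennreal ((1 / e) powr P) * ennreal (e powr P)" using le by (rule mult_left_mono) simp
  also have "\<dots> = 1" using e by (simp add: ennreal_mult[symmetric] powr_divide)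
  finally have "e \<in> {c. 0 < c \<and> vmod M p (\<lambda>x. (1 / c) *\<^sub>R w x) \<le> 1}" using e by simp
  then show ?thesis unfolding lux_norm_eq by (rule cInf_lower) (auto intro: bdd_belowI[of _ 0])
qed

text \<open>Here the bounded exponent pays off: the norm convergence in the definition of the space
  may be replaced by modular convergence.\<close>

lemma lux_norm_tendsto_0_iff:
  fixes w :: "nat \<Rightarrow> 'a \<Rightarrow> 'b::euclidean_space"
  assumes w: "\<And>n. w n \<in> borel_measurable M" "\<And>n. vmod M p (w n) < \<infinity>"
  shows "(\<lambda>n. lux_norm \<Omega> p (\<lambda>x. norm (w n x))) \<longlonglongrightarrow> 0 \<longleftrightarrow> (\<lambda>n. vmod M p (w n)) \<longlonglongrightarrow> 0"
proof
  assume lim: "(\<lambda>n. lux_norm \<Omega> p (\<lambda>x. norm (w n x))) \<longlonglongrightarrow> 0"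
  show "(\<lambda>n. vmod M p (w n)) \<longlonglongrightarrow> 0"
    unfolding ennreal_tendsto_0_iff_eventually_le
  proof (intro allI impI)
    fix e :: real assume "0 < e"
    then have "0 < min 1 e" by simp
    from order_tendstoD(2)[OF lim this] show "\<forall>\<^sub>F n in sequentially. vmod M p (w n) \<le> ennreal e"
    proof eventually_elim
      case (elim n)
      have "vmod M p (w n) \<le> ennreal (min 1 e)" using vmod_le_if_lux_norm_less[OF w _ elim] by simp
      also have "\<dots> \<le> ennreal e" by (rule ennreal_leI) simp
      finally show ?case .
    qed
  qed
next
  assume lim: "(\<lambda>n. vmod M p (w n)) \<longlonglongrightarrow> 0"
  show "(\<lambda>n. lux_norm \<Omega> p (\<lambda>x. norm (w n x))) \<longlonglongrightarrow> 0"
  proof (rule LIMSEQ_I)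
    fix r :: real assume r: "0 < r"
    define e where "e = min 1 (r / 2)"
    have e: "0 < e" "e \<le> 1" "e < r" using r by (auto simp: e_def)
    have "\<forall>\<^sub>F n in sequentially. vmod M p (w n) \<le> ennreal (e powr P)"
      using lim e unfolding ennreal_tendsto_0_iff_eventually_le by simp
    then have "\<forall>\<^sub>F n in sequentially. norm (lux_norm \<Omega> p (\<lambda>x. norm (w n x)) - 0) < r"
    proof eventually_elim
      case (elim n)
      show ?case
        using lux_norm_le_if_vmod_le[OF w(1) e(1,2) elim] lux_norm_nonneg[OF w, of n] e(3) by simp
    qed
    then show "\<exists>no. \<forall>n\<ge>no. norm (lux_norm \<Omega> p (\<lambda>x. norm (w n x)) - 0) < r"
      by (simp add: eventually_sequentially)
  qed
qed

lemma vmod_finite_bounded: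
  fixes w :: "'a \<Rightarrow> 'b::euclidean_space"
  assumes "\<And>x. norm (w x) \<le> S"
  shows "vmod M p w < \<infinity>"
proof -
  have "vmod M p w \<le> (\<integral>\<^sup>+x. ennreal (max 1 S powr P) \<partial>M)"
    unfolding vmod_def
  proof (intro nn_integral_mono ennreal_leI)
    fix x assume x: "x \<in> space M"
    have "norm (w x) powr p x \<le> max 1 S powr p x"
      using assms[of x] p_nonneg_bound[OF x] by (intro powr_mono2) auto
    also have "\<dots> \<le> max 1 S powr P" using p_nonneg_bound[OF x] by (intro powr_mono) auto
    finally show "norm (w x) powr p x \<le> max 1 S powr P" .
  qed
  also have "\<dots> < \<infinity>" by (simp add: less_top[symmetric] ennreal_mult_eq_top_iff emeasure_finite)
  finally show ?thesis .
qed

section \<open>Closure of the test functions in the modular\<close>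

lemma test_fun_M:
  assumes "test_fun \<Omega> \<phi>"
  shows "\<phi> \<in> borel_measurable M" "grad \<phi> \<in> borel_measurable M" "vmod M p \<phi> < \<infinity>" "vmod M p (grad \<phi>) < \<infinity>"
proof -
  interpret C1_function \<phi> "grad \<phi>" by (rule test_funD[OF assms])
  show "\<phi> \<in> borel_measurable M" "grad \<phi> \<in> borel_measurable M"
    using measurable G_measurable by (auto intro: borel_measurable_M)
  obtain S where "\<And>x. norm (\<phi> x) \<le> S"
    using continuous_zero_outside_bounded[OF cont bounded_\<Omega> test_funD(2)[OF assms]] by blast
  then show "vmod M p \<phi> < \<infinity>" by (rule vmod_finite_bounded)
  obtain S where "\<And>x. norm (grad \<phi> x) \<le> S"
    using continuous_zero_outside_bounded[OF cont_G bounded_\<Omega> test_funD(3)[OF assms]] by blast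
  then show "vmod M p (grad \<phi>) < \<infinity>" by (rule vmod_finite_bounded)
qed

lemma vmod_diff_finite:
  fixes v w :: "'a \<Rightarrow> 'b::euclidean_space"
  assumes "v \<in> borel_measurable M" "w \<in> borel_measurable M" "vmod M p v < \<infinity>" "vmod M p w < \<infinity>"
  shows "vmod M p (\<lambda>x. v x - w x) < \<infinity>"
proof -
  have "vmod M p (\<lambda>x. v x + (- 1) *\<^sub>R w x) \<le> ennreal (2 powr P) * (vmod M p v + vmod M p (\<lambda>x. (- 1) *\<^sub>R w x))"
    using assms by (intro vmod_add_le p_measurable p_nonneg_bound) auto
  moreover have "vmod M p (\<lambda>x. (- 1) *\<^sub>R w x) = vmod M p w" by (simp add: vmod_def)
  ultimately show ?thesis using assms
    by (simp add: ennreal_mult_less_top order_le_less_trans)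
qed

text \<open>The space in terms of modulars. Finite modulars and the weak gradient identity are
  consequences of the approximation, and \<open>W0_iff_W0_vmod\<close> proves the equivalence with
  \<open>W0\<close>.\<close>

definition W0_vmod :: "('a \<Rightarrow> real) \<Rightarrow> ('a \<Rightarrow> 'a) \<Rightarrow> bool" where
  "W0_vmod u g \<longleftrightarrow> u \<in> borel_measurable M \<and> g \<in> borel_measurable M \<and>
     (\<exists>\<phi>s. (\<forall>n. test_fun \<Omega> (\<phi>s n)) \<and> (\<lambda>n. vmod M p (\<lambda>x. \<phi>s n x - u x)) \<longlonglongrightarrow> 0
        \<and> (\<lambda>n. vmod M p (\<lambda>x. grad (\<phi>s n) x - g x)) \<longlonglongrightarrow> 0)"

lemma W0_vmodE:
  assumes "W0_vmod u g"
  obtains \<phi>s where "u \<in> borel_measurable M" "g \<in> borel_measurable M" "\<And>n. test_fun \<Omega> (\<phi>s n)"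
    "(\<lambda>n. vmod M p (\<lambda>x. \<phi>s n x - u x)) \<longlonglongrightarrow> 0" "(\<lambda>n. vmod M p (\<lambda>x. grad (\<phi>s n) x - g x)) \<longlonglongrightarrow> 0"
  using assms unfolding W0_vmod_def by blast

text \<open>A single member at modular distance at most 1 already bounds the modular of the
  limit.\<close>

lemma vmod_limit_finite:
  fixes w :: "nat \<Rightarrow> 'a \<Rightarrow> 'b::euclidean_space"
  assumes w: "\<And>n. w n \<in> borel_measurable M" "\<And>n. vmod M p (w n) < \<infinity>" and v: "v \<in> borel_measurable M"
    and lim: "(\<lambda>n. vmod M p (\<lambda>x. w n x - v x)) \<longlonglongrightarrow> 0"
  shows "vmod M p v < \<infinity>"
proof -
  have "\<forall>\<^sub>F n in sequentially. vmod M p (\<lambda>x. w n x - v x) \<le> ennreal 1"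
    using lim unfolding ennreal_tendsto_0_iff_eventually_le by (meson zero_less_one)
  then obtain n where n: "vmod M p (\<lambda>x. w n x - v x) \<le> ennreal 1" by (auto simp: eventually_sequentially)
  have "vmod M p (\<lambda>x. w n x - (w n x - v x)) < \<infinity>"
    by (intro vmod_diff_finite w v borel_measurable_diff order_le_less_trans[OF n]) simp
  then show ?thesis by simp
qed

lemma W0_vmod_finite:
  assumes "W0_vmod u g"
  shows "vmod M p u < \<infinity>" "vmod M p g < \<infinity>"
proof -
  obtain \<phi>s where \<phi>: "u \<in> borel_measurable M" "g \<in> borel_measurable M" "\<And>n. test_fun \<Omega> (\<phi>s n)"
    "(\<lambda>n. vmod M p (\<lambda>x. \<phi>s n x - u x)) \<longlonglongrightarrow> 0" "(\<lambda>n. vmod M p (\<lambda>x. grad (\<phi>s n) x - g x)) \<longlonglongrightarrow> 0"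
    using W0_vmodE[OF assms] by blast
  show "vmod M p u < \<infinity>" by (rule vmod_limit_finite[OF test_fun_M(1,3)[OF \<phi>(3)] \<phi>(1,4)])
  show "vmod M p g < \<infinity>" by (rule vmod_limit_finite[OF test_fun_M(2,4)[OF \<phi>(3)] \<phi>(2,5)])
qed

lemma integrable_if_vmod:
  fixes w :: "'a \<Rightarrow> 'b::euclidean_space"
  assumes [measurable]: "w \<in> borel_measurable M" and "vmod M p w < \<infinity>"
  shows "integrable M w"
proof (rule Bochner_Integration.integrable_bound)
  show "integrable M (\<lambda>x. 1 + norm (w x) powr p x)"
    using integrable_if_vmod_finite[OF assms(1) p_measurable assms(2)] by simp
  show "AE x in M. norm (w x) \<le> norm (1 + norm (w x) powr p x)"
  proof (rule AE_I2)
    fix x assume "x \<in> space M"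
    then show "norm (w x) \<le> norm (1 + norm (w x) powr p x)"
      using powr_exponent_le[of "norm (w x)" 1 "p x"] p_ge_1[of x] by auto
  qed
qed measurable

text \<open>Integration by parts holds for the approximating test functions. Modular convergence
  implies L1 convergence on a domain of finite measure, so both sides, tested against bounded
  functions, pass to the limit.\<close>

lemma weak_grad_if_W0_vmod:
  assumes "W0_vmod u g"
  shows "weak_grad \<Omega> u g"
  unfolding weak_grad_def
proof (intro conjI allI impI ballI)
  obtain \<phi>s where \<phi>: "u \<in> borel_measurable M" "g \<in> borel_measurable M" "\<And>n. test_fun \<Omega> (\<phi>s n)"
    "(\<lambda>n. vmod M p (\<lambda>x. \<phi>s n x - u x)) \<longlonglongrightarrow> 0" "(\<lambda>n. vmod M p (\<lambda>x. grad (\<phi>s n) x - g x)) \<longlonglongrightarrow> 0"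
    using W0_vmodE[OF assms] by blast
  note [measurable] = \<phi>(1,2) test_fun_M(1,2)[OF \<phi>(3)]
  have ui: "integrable M u" and gi: "integrable M g"
    using W0_vmod_finite[OF assms] \<phi> by (auto intro: integrable_if_vmod)
  have su: "set_integrable lebesgue \<Omega> u" and sg: "set_integrable lebesgue \<Omega> g"
    using ui gi by (auto simp: integrable_restrict_space set_integrable_def)
  {
    fix K assume "compact K \<and> K \<subseteq> \<Omega>"
    then have K: "K \<in> sets lebesgue" "K \<subseteq> \<Omega>" by (auto simp: borel_compact)
    show "set_integrable lebesgue K u" by (rule set_integrable_subset[OF su K])
    show "set_integrable lebesgue K g" by (rule set_integrable_subset[OF sg K])
  }
  fix \<psi> i assume \<psi>: "test_fun \<Omega> \<psi>" and i: "i \<in> (Basis :: 'a set)"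
  interpret C1_function \<psi> "grad \<psi>" by (rule test_funD[OF \<psi>])
  note [measurable] = test_fun_M(1,2)[OF \<psi>]
  obtain S1 where S1: "0 \<le> S1" "\<And>x. norm (\<psi> x) \<le> S1"
    using continuous_zero_outside_bounded[OF cont bounded_\<Omega> test_funD(2)[OF \<psi>]] by blast
  obtain S2 where S2: "0 \<le> S2" "\<And>x. norm (grad \<psi> x) \<le> S2"
    using continuous_zero_outside_bounded[OF cont_G bounded_\<Omega> test_funD(3)[OF \<psi>]] by blast
  have lim1: "(\<lambda>n. vmod M (\<lambda>x. 1) (\<lambda>x. \<phi>s n x - u x)) \<longlonglongrightarrow> 0"
    by (rule vmod_tendsto_0_lower_exponent[OF _ p_measurable _ _ \<phi>(4)]) (use p_ge_1 p_nonneg_bound in auto)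
  have lim2: "(\<lambda>n. vmod M (\<lambda>x. 1) (\<lambda>x. grad (\<phi>s n) x - g x)) \<longlonglongrightarrow> 0"
    by (rule vmod_tendsto_0_lower_exponent[OF _ p_measurable _ _ \<phi>(5)]) (use p_ge_1 p_nonneg_bound in auto)
  have b2: "\<bar>grad \<psi> x \<bullet> i\<bar> \<le> S2" for x
    using Cauchy_Schwarz_ineq2[of "grad \<psi> x" i] S2(2)[of x] i by simp
  have phi_int: "integrable M (\<phi>s n)" "integrable M (grad (\<phi>s n))" for n
    using test_fun_M[OF \<phi>(3)] by (auto intro: integrable_if_vmod)
  have I1: "integrable M (\<lambda>x. w x * (grad \<psi> x \<bullet> i))" if "integrable M w" for w
  proof (rule Bochner_Integration.integrable_bound)
    show "integrable M (\<lambda>x. S2 * w x)" using that by simp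
    show "(\<lambda>x. w x * (grad \<psi> x \<bullet> i)) \<in> borel_measurable M"
      using that by (intro borel_measurable_times borel_measurable_inner) auto
    show "AE x in M. norm (w x * (grad \<psi> x \<bullet> i)) \<le> norm (S2 * w x)"
    proof (rule AE_I2)
      fix x
      show "norm (w x * (grad \<psi> x \<bullet> i)) \<le> norm (S2 * w x)"
        using mult_left_mono[OF b2[of x] abs_ge_zero[of "w x"]] S2(1) by (simp add: abs_mult mult.commute)
    qed
  qed
  have I2: "integrable M (\<lambda>x. (w x \<bullet> i) * \<psi> x)" if "integrable M w" for w
  proof (rule Bochner_Integration.integrable_bound)
    show "integrable M (\<lambda>x. S1 * norm (w x))" using that by simp
    show "(\<lambda>x. (w x \<bullet> i) * \<psi> x) \<in> borel_measurable M"
      using that by (intro borel_measurable_times borel_measurable_inner) auto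
    show "AE x in M. norm ((w x \<bullet> i) * \<psi> x) \<le> norm (S1 * norm (w x))"
    proof (rule AE_I2)
      fix x
      have "\<bar>w x \<bullet> i\<bar> \<le> norm (w x)" using Cauchy_Schwarz_ineq2[of "w x" i] i by simp
      then have "\<bar>w x \<bullet> i\<bar> * \<bar>\<psi> x\<bar> \<le> norm (w x) * S1" using S1(2)[of x] S1(1) by (intro mult_mono) auto
      then show "norm ((w x \<bullet> i) * \<psi> x) \<le> norm (S1 * norm (w x))" using S1(1) by (simp add: abs_mult mult.commute)
    qed
  qed
  have L1: "(\<lambda>n. \<integral>x. \<phi>s n x * (grad \<psi> x \<bullet> i) \<partial>M) \<longlonglongrightarrow> (\<integral>x. u x * (grad \<psi> x \<bullet> i) \<partial>M)"
  proof (rule tendsto_L1_int[OF I1[OF phi_int(1)] I1[OF ui]])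
    show "(\<lambda>n. \<integral>\<^sup>+x. ennreal (norm (\<phi>s n x * (grad \<psi> x \<bullet> i) - u x * (grad \<psi> x \<bullet> i))) \<partial>M) \<longlonglongrightarrow> 0"
    proof (rule ennreal_tendsto_0_le[OF ennreal_cmult_tendsto_0[OF lim1, of S2]])
      fix n
      have "(\<integral>\<^sup>+x. ennreal (norm (\<phi>s n x * (grad \<psi> x \<bullet> i) - u x * (grad \<psi> x \<bullet> i))) \<partial>M)
        \<le> (\<integral>\<^sup>+x. ennreal S2 * ennreal (norm (\<phi>s n x - u x) powr 1) \<partial>M)"
      proof (rule nn_integral_mono)
        fix x
        have "norm (\<phi>s n x * (grad \<psi> x \<bullet> i) - u x * (grad \<psi> x \<bullet> i)) = \<bar>\<phi>s n x - u x\<bar> * \<bar>grad \<psi> x \<bullet> i\<bar>"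
          by (simp add: abs_mult[symmetric] left_diff_distrib)
        also have "\<dots> \<le> \<bar>\<phi>s n x - u x\<bar> * S2" using b2 by (intro mult_left_mono) auto
        finally show "ennreal (norm (\<phi>s n x * (grad \<psi> x \<bullet> i) - u x * (grad \<psi> x \<bullet> i))) \<le> ennreal S2 * ennreal (norm (\<phi>s n x - u x) powr 1)"
          using S2(1) by (simp add: ennreal_mult[symmetric] ennreal_leI mult.commute)
      qed
      also have "\<dots> = ennreal S2 * vmod M (\<lambda>x. 1) (\<lambda>x. \<phi>s n x - u x)"
        unfolding vmod_def by (rule nn_integral_cmult) measurable
      finally show "(\<integral>\<^sup>+x. ennreal (norm (\<phi>s n x * (grad \<psi> x \<bullet> i) - u x * (grad \<psi> x \<bullet> i))) \<partial>M) \<le> ennreal S2 * vmod M (\<lambda>x. 1) (\<lambda>x. \<phi>s n x - u x)" .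
    qed
  qed
  have L2: "(\<lambda>n. \<integral>x. (grad (\<phi>s n) x \<bullet> i) * \<psi> x \<partial>M) \<longlonglongrightarrow> (\<integral>x. (g x \<bullet> i) * \<psi> x \<partial>M)"
  proof (rule tendsto_L1_int[OF I2[OF phi_int(2)] I2[OF gi]])
    show "(\<lambda>n. \<integral>\<^sup>+x. ennreal (norm ((grad (\<phi>s n) x \<bullet> i) * \<psi> x - (g x \<bullet> i) * \<psi> x)) \<partial>M) \<longlonglongrightarrow> 0"
    proof (rule ennreal_tendsto_0_le[OF ennreal_cmult_tendsto_0[OF lim2, of S1]])
      fix n
      have "(\<integral>\<^sup>+x. ennreal (norm ((grad (\<phi>s n) x \<bullet> i) * \<psi> x - (g x \<bullet> i) * \<psi> x)) \<partial>M)
        \<le> (\<integral>\<^sup>+x. ennreal S1 * ennreal (norm (grad (\<phi>s n) x - g x) powr 1) \<partial>M)"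
      proof (rule nn_integral_mono)
        fix x
        have "norm ((grad (\<phi>s n) x \<bullet> i) * \<psi> x - (g x \<bullet> i) * \<psi> x) = \<bar>(grad (\<phi>s n) x - g x) \<bullet> i\<bar> * \<bar>\<psi> x\<bar>"
          by (simp add: abs_mult[symmetric] left_diff_distrib inner_diff_left)
        also have "\<dots> \<le> norm (grad (\<phi>s n) x - g x) * S1"
          using Cauchy_Schwarz_ineq2[of "grad (\<phi>s n) x - g x" i] i S1(2)[of x] by (intro mult_mono) auto
        finally show "ennreal (norm ((grad (\<phi>s n) x \<bullet> i) * \<psi> x - (g x \<bullet> i) * \<psi> x)) \<le> ennreal S1 * ennreal (norm (grad (\<phi>s n) x - g x) powr 1)"
          using S1(1) by (simp add: ennreal_mult[symmetric] ennreal_leI mult.commute)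
      qed
      also have "\<dots> = ennreal S1 * vmod M (\<lambda>x. 1) (\<lambda>x. grad (\<phi>s n) x - g x)"
        unfolding vmod_def by (rule nn_integral_cmult) measurable
      finally show "(\<integral>\<^sup>+x. ennreal (norm ((grad (\<phi>s n) x \<bullet> i) * \<psi> x - (g x \<bullet> i) * \<psi> x)) \<partial>M) \<le> ennreal S1 * vmod M (\<lambda>x. 1) (\<lambda>x. grad (\<phi>s n) x - g x)" .
    qed
  qed
  have set_eq: "(LINT x:\<Omega>|lebesgue. w x) = (\<integral>x. w x \<partial>M)" for w :: "'a \<Rightarrow> real"
    by (simp add: set_lebesgue_integral_def integral_restrict_space)
  have eq: "(\<lambda>n. \<integral>x. \<phi>s n x * (grad \<psi> x \<bullet> i) \<partial>M) = (\<lambda>n. - (\<integral>x. (grad (\<phi>s n) x \<bullet> i) * \<psi> x \<partial>M))"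
    using test_fun_integration_by_parts[OF \<phi>(3) \<psi> bounded_\<Omega> open_\<Omega> i] by (simp add: set_eq)
  have "(\<integral>x. u x * (grad \<psi> x \<bullet> i) \<partial>M) = - (\<integral>x. (g x \<bullet> i) * \<psi> x \<partial>M)"
    by (rule LIMSEQ_unique[OF L1]) (unfold eq, rule tendsto_minus[OF L2])
  then show "(LINT x:\<Omega>|lebesgue. u x * (grad \<psi> x \<bullet> i)) = - (LINT x:\<Omega>|lebesgue. (g x \<bullet> i) * \<psi> x)"
    by (simp add: set_eq)
qed

lemma Lvar_iff:
  fixes w :: "'a \<Rightarrow> 'b::euclidean_space"
  assumes w: "w \<in> borel_measurable M"
  shows "Lvar \<Omega> p (\<lambda>x. norm (w x)) \<longleftrightarrow> vmod M p w < \<infinity>"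
proof
  assume "vmod M p w < \<infinity>"
  then show "Lvar \<Omega> p (\<lambda>x. norm (w x))"
    unfolding Lvar_def using w modular_eq_vmod[of 1 w] by (intro conjI exI[of _ 1]) auto
next
  assume "Lvar \<Omega> p (\<lambda>x. norm (w x))"
  then obtain c where c: "0 < c" "vmod M p (\<lambda>x. (1 / c) *\<^sub>R w x) < \<infinity>"
    unfolding Lvar_def using modular_eq_vmod by metis
  have "vmod M p w = vmod M p (\<lambda>x. c *\<^sub>R ((1 / c) *\<^sub>R w x))" using c by simp
  also have "\<dots> \<le> ennreal (max 1 c powr P) * vmod M p (\<lambda>x. (1 / c) *\<^sub>R w x)"
    using c w by (intro vmod_scale_le p_measurable p_nonneg_bound) auto
  also have "\<dots> < \<infinity>" using c(2) by (simp add: ennreal_mult_less_top)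
  finally show "vmod M p w < \<infinity>" .
qed

lemma Lvar_iff_real:
  "Lvar \<Omega> p u \<longleftrightarrow> u \<in> borel_measurable M \<and> vmod M p u < \<infinity>"
proof (cases "u \<in> borel_measurable M")
  case True
  have "modular \<Omega> p (\<lambda>x. \<bar>u x\<bar> / c) = modular \<Omega> p (\<lambda>x. u x / c)" for c
    by (simp add: modular_def)
  then have "Lvar \<Omega> p u \<longleftrightarrow> Lvar \<Omega> p (\<lambda>x. norm (u x))"
    using True by (simp add: Lvar_def)
  then show ?thesis using Lvar_iff[OF True] True by blast
qed (simp add: Lvar_def)

lemma W0_iff_W0_vmod: "W0 \<Omega> p u g \<longleftrightarrow> W0_vmod u g"
proof
  assume W: "W0 \<Omega> p u g"
  have um: "u \<in> borel_measurable M" "vmod M p u < \<infinity>" using W by (auto simp: W0_def Lvar_iff_real)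
  have gm: "g \<in> borel_measurable M" using W weak_grad_measurable[OF _ open_\<Omega>] by (auto simp: W0_def)
  have gf: "vmod M p g < \<infinity>" using W Lvar_iff[OF gm] by (auto simp: W0_def)
  obtain \<phi>s where \<phi>: "\<And>n. test_fun \<Omega> (\<phi>s n)" and lim:
    "(\<lambda>n. lux_norm \<Omega> p (\<lambda>x. \<phi>s n x - u x) + lux_norm \<Omega> p (\<lambda>x. norm (grad (\<phi>s n) x - g x))) \<longlonglongrightarrow> 0"
    using W by (auto simp: W0_def)
  note t = test_fun_M[OF \<phi>]
  have m1: "(\<lambda>x. \<phi>s n x - u x) \<in> borel_measurable M" and m2: "(\<lambda>x. grad (\<phi>s n) x - g x) \<in> borel_measurable M" for n
    using t um gm by auto
  have f1: "vmod M p (\<lambda>x. \<phi>s n x - u x) < \<infinity>" and f2: "vmod M p (\<lambda>x. grad (\<phi>s n) x - g x) < \<infinity>" for n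
    by (intro vmod_diff_finite t um gm gf)+
  have n1: "0 \<le> lux_norm \<Omega> p (\<lambda>x. norm (\<phi>s n x - u x))" and n2: "0 \<le> lux_norm \<Omega> p (\<lambda>x. norm (grad (\<phi>s n) x - g x))" for n
    by (intro lux_norm_nonneg m1 f1 m2 f2)+
  have lim': "(\<lambda>n. lux_norm \<Omega> p (\<lambda>x. norm (\<phi>s n x - u x)) + lux_norm \<Omega> p (\<lambda>x. norm (grad (\<phi>s n) x - g x))) \<longlonglongrightarrow> 0"
    using lim by (subst (asm) lux_norm_norm)
  have "(\<lambda>n. lux_norm \<Omega> p (\<lambda>x. norm (\<phi>s n x - u x))) \<longlonglongrightarrow> 0"
    by (rule tendsto_sandwich[OF _ _ tendsto_const lim']) (use n1 n2 in auto)
  moreover have "(\<lambda>n. lux_norm \<Omega> p (\<lambda>x. norm (grad (\<phi>s n) x - g x))) \<longlonglongrightarrow> 0"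
    by (rule tendsto_sandwich[OF _ _ tendsto_const lim']) (use n1 n2 in auto)
  ultimately show "W0_vmod u g"
    unfolding W0_vmod_def lux_norm_tendsto_0_iff[OF m1 f1] lux_norm_tendsto_0_iff[OF m2 f2]
    by (intro conjI exI[of _ \<phi>s] allI um gm \<phi>)
next
  assume W: "W0_vmod u g"
  obtain \<phi>s where \<phi>: "u \<in> borel_measurable M" "g \<in> borel_measurable M" "\<And>n. test_fun \<Omega> (\<phi>s n)"
    "(\<lambda>n. vmod M p (\<lambda>x. \<phi>s n x - u x)) \<longlonglongrightarrow> 0" "(\<lambda>n. vmod M p (\<lambda>x. grad (\<phi>s n) x - g x)) \<longlonglongrightarrow> 0"
    using W0_vmodE[OF W] by blast
  note fin = W0_vmod_finite[OF W]
  note t = test_fun_M[OF \<phi>(3)]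
  have m1: "(\<lambda>x. \<phi>s n x - u x) \<in> borel_measurable M" and m2: "(\<lambda>x. grad (\<phi>s n) x - g x) \<in> borel_measurable M" for n
    using t \<phi> by auto
  have f1: "vmod M p (\<lambda>x. \<phi>s n x - u x) < \<infinity>" and f2: "vmod M p (\<lambda>x. grad (\<phi>s n) x - g x) < \<infinity>" for n
    by (intro vmod_diff_finite t \<phi>(1,2) fin)+
  have "(\<lambda>n. lux_norm \<Omega> p (\<lambda>x. norm (\<phi>s n x - u x)) + lux_norm \<Omega> p (\<lambda>x. norm (grad (\<phi>s n) x - g x))) \<longlonglongrightarrow> 0 + 0"
    using \<phi>(4,5)
    by (intro tendsto_add) (simp_all only: lux_norm_tendsto_0_iff[OF m1 f1] lux_norm_tendsto_0_iff[OF m2 f2])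
  then have "(\<lambda>n. lux_norm \<Omega> p (\<lambda>x. \<phi>s n x - u x) + lux_norm \<Omega> p (\<lambda>x. norm (grad (\<phi>s n) x - g x))) \<longlonglongrightarrow> 0"
    by (subst lux_norm_norm) simp
  moreover have "Lvar \<Omega> p u" "Lvar \<Omega> p (\<lambda>x. norm (g x))"
    using \<phi>(1) fin Lvar_iff_real[of u] Lvar_iff[OF \<phi>(2)] by auto
  ultimately show "W0 \<Omega> p u g"
    unfolding W0_def by (intro conjI exI[of _ \<phi>s] allI \<phi>(3) weak_grad_if_W0_vmod[OF W])
qed


section \<open>Poincare inequalities for test functions\<close>

abbreviation "\<mu> \<equiv> Sigma_Algebra.measure M \<Omega>"

lemma emeasure_\<Omega>: "emeasure M \<Omega> = ennreal \<mu>"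
  by (rule emeasure_eq_measure)

lemma vmod_const_eq:
  fixes w :: "'a \<Rightarrow> 'b::real_normed_vector"
  assumes "\<And>x. x \<notin> \<Omega> \<Longrightarrow> w x = 0"
  shows "vmod M (\<lambda>x. s) w = (\<integral>\<^sup>+x. ennreal (norm (w x) powr s) \<partial>lborel)"
  unfolding vmod_M_eq by (rule nn_integral_cong) (auto simp: indicator_def assms)

lemma vmod_const_le:
  fixes w :: "'a \<Rightarrow> 'b::euclidean_space"
  assumes [measurable]: "w \<in> borel_measurable M" "r \<in> borel_measurable M"
    and s: "0 \<le> s" "\<And>x. x \<in> \<Omega> \<Longrightarrow> s \<le> r x"
  shows "vmod M (\<lambda>x. s) w \<le> ennreal \<mu> + vmod M r w"
proof -
  have "vmod M (\<lambda>x. s) w \<le> (\<integral>\<^sup>+x. 1 + ennreal (norm (w x) powr r x) \<partial>M)"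
    unfolding vmod_def
  proof (rule nn_integral_mono)
    fix x assume x: "x \<in> space M"
    have "ennreal (norm (w x) powr s) \<le> ennreal (1 + norm (w x) powr r x)"
      using s(1) s(2)[of x] x by (intro ennreal_leI powr_exponent_le) auto
    then show "ennreal (norm (w x) powr s) \<le> 1 + ennreal (norm (w x) powr r x)" by simp
  qed
  also have "\<dots> = (\<integral>\<^sup>+x. 1 \<partial>M) + vmod M r w"
    unfolding vmod_def by (rule nn_integral_add) measurable
  also have "(\<integral>\<^sup>+x. 1 \<partial>M) = ennreal \<mu>" using emeasure_\<Omega> by simp
  finally show ?thesis .
qed

lemma test_fun_poincare:
  assumes s: "1 \<le> s"
  obtains D where "0 \<le> D" "\<And>\<psi>. test_fun \<Omega> \<psi> \<Longrightarrow> vmod M (\<lambda>x. s) \<psi> \<le> ennreal D * vmod M (\<lambda>x. s) (grad \<psi>)"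
proof -
  obtain R where R: "0 < R" "\<And>x. x \<in> \<Omega> \<Longrightarrow> norm x < R"
    using bounded_\<Omega> unfolding bounded_pos_less by blast
  show ?thesis
  proof (rule that[of "(2 * R) powr s"])
    fix \<psi> assume \<psi>: "test_fun \<Omega> \<psi>"
    interpret C1_function \<psi> "grad \<psi>" by (rule test_funD[OF \<psi>])
    have "\<psi> x = 0" if "R \<le> norm x" for x using R(2)[of x] that test_funD(2)[OF \<psi>] by force
    from poincare[OF s R(1) this]
    show "vmod M (\<lambda>x. s) \<psi> \<le> ennreal ((2 * R) powr s) * vmod M (\<lambda>x. s) (grad \<psi>)"
      by (simp add: vmod_const_eq test_funD(2,3)[OF \<psi>])
  qed simp
qed

text \<open>On a ball where \<open>p\<close> varies by less than \<open>\<delta>\<close>,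
  \<open>local_gain\<close> leads from an exponent just below \<open>p\<close> to one just above.
  The gradient integral with the lower exponent is controlled by the modular, and the function
  integral with the upper exponent controls the modular. Finitely many such balls cover the
  domain.\<close>

lemma test_fun_vmod_bounded:
  obtains K where "0 \<le> K" "\<And>\<psi>. test_fun \<Omega> \<psi> \<Longrightarrow> vmod M p (grad \<psi>) \<le> 1 \<Longrightarrow> vmod M p \<psi> \<le> ennreal K"
proof -
  have \<mu>0: "0 \<le> \<mu>" by simp
  \<comment> \<open>\<open>\<delta> \<le> q - 1\<close> keeps \<open>p z - \<delta>\<close> at least
    1; the other bound makes the dimension times the exponent gap \<open>2 * \<delta>\<close> at
    most one half, below the 1 that \<open>local_gain\<close> demands.\<close>
  define \<delta> where "\<delta> = min (q - 1) (1 / (4 * real DIM('a)))"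
  have \<delta>: "0 < \<delta>" "\<delta> \<le> q - 1" "4 * real DIM('a) * \<delta> \<le> 1"
  proof -
    show "0 < \<delta>" "\<delta> \<le> q - 1" using q_gt_1 by (auto simp: \<delta>_def)
    have "\<delta> \<le> 1 / (4 * real DIM('a))" by (simp add: \<delta>_def)
    then show "4 * real DIM('a) * \<delta> \<le> 1" by (simp add: field_simps)
  qed
  have cl: "compact (closure \<Omega>)" using bounded_\<Omega> by simp
  have "uniformly_continuous_on (closure \<Omega>) p" using cont_p cl by (rule compact_uniformly_continuous)
  then obtain d where d: "0 < d" "\<And>x y. x \<in> closure \<Omega> \<Longrightarrow> y \<in> closure \<Omega> \<Longrightarrow> dist y x < d \<Longrightarrow> dist (p y) (p x) < \<delta>"
    using \<delta>(1) unfolding uniformly_continuous_on_def by metis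
  \<comment> \<open>The exponent has to be nearly constant on the doubled balls, over which the
    gradient is integrated; hence half of \<open>d\<close>.\<close>
  define r0 where "r0 = d / 2"
  have r0: "0 < r0" using d by (simp add: r0_def)
  obtain Z where Z: "finite Z" "Z \<subseteq> closure \<Omega>" "closure \<Omega> \<subseteq> (\<Union>z\<in>Z. ball z r0)"
    using compactE_image[OF cl, of "closure \<Omega>" "\<lambda>z. ball z r0"] r0 by force
  have near: "p z - \<delta> \<le> p x \<and> p x \<le> p z + \<delta>" if "z \<in> Z" "x \<in> \<Omega>" "x \<in> ball z (2 * r0)" for z x
  proof -
    have "x \<in> closure \<Omega>" "z \<in> closure \<Omega>" using that Z(2) closure_subset by auto
    then have "dist (p x) (p z) < \<delta>" using that(3) by (intro d(2)) (auto simp: r0_def dist_commute)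
    then show ?thesis by (simp add: dist_real_def abs_less_iff)
  qed
  obtain D where D: "0 \<le> D" "\<And>\<psi>. test_fun \<Omega> \<psi> \<Longrightarrow> vmod M (\<lambda>x. 1) \<psi> \<le> ennreal D * vmod M (\<lambda>x. 1) (grad \<psi>)"
    using test_fun_poincare[of 1] by auto
  \<comment> \<open>An L1 bound for all functions in question: the Poincare constant
    \<open>D\<close> times \<open>\<mu> + 1\<close>, which bounds the L1 norm of the
    gradient.\<close>
  define L where "L = D * (\<mu> + 1)"
  have L: "0 \<le> L" using D \<mu>0 by (simp add: L_def)
  \<comment> \<open>This packages the outcome of \<open>local_gain\<close> at the centre
    \<open>z\<close>, so that one constant per centre can be chosen.\<close>
  define Q where "Q z K \<longleftrightarrow> 0 \<le> K \<and> (\<forall>\<phi> G. C1_function \<phi> G \<longrightarrow> (\<integral>\<^sup>+x. ennreal \<bar>\<phi> x\<bar> \<partial>lborel) \<le> ennreal L \<longrightarrow>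
     (\<integral>\<^sup>+x. ennreal (\<bar>\<phi> x\<bar> powr (p z + \<delta>)) * indicator (ball z r0) x \<partial>lborel)
      \<le> ennreal K * (1 + (\<integral>\<^sup>+x. ennreal (norm (G x) powr (p z - \<delta>)) * indicator (ball z (2 * r0)) x \<partial>lborel)))"
    for z K
  have "\<exists>K. Q z K" if "z \<in> Z" for z
  proof -
    have "q \<le> p z" using p_bounds[of z] Z(2) that by auto
    then have "1 \<le> p z - \<delta>" using \<delta> by linarith
    moreover have "p z - \<delta> \<le> p z + \<delta>" using \<delta> by simp
    moreover have "real DIM('a) * ((p z + \<delta>) - (p z - \<delta>)) < 1" using \<delta>(3) by (simp add: algebra_simps)
    ultimately show ?thesis
      by (rule local_gain[of "p z - \<delta>" "p z + \<delta>" r0 L z, OF _ _ _ r0 L]) (unfold Q_def, blast)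
  qed
  then obtain k where "\<forall>z\<in>Z. Q z (k z)" using bchoice[of Z Q] by blast
  then have k: "\<And>z. z \<in> Z \<Longrightarrow> 0 \<le> k z" "\<And>z \<phi> G. z \<in> Z \<Longrightarrow> C1_function \<phi> G \<Longrightarrow> (\<integral>\<^sup>+x. ennreal \<bar>\<phi> x\<bar> \<partial>lborel) \<le> ennreal L \<Longrightarrow>
     (\<integral>\<^sup>+x. ennreal (\<bar>\<phi> x\<bar> powr (p z + \<delta>)) * indicator (ball z r0) x \<partial>lborel)
      \<le> ennreal (k z) * (1 + (\<integral>\<^sup>+x. ennreal (norm (G x) powr (p z - \<delta>)) * indicator (ball z (2 * r0)) x \<partial>lborel))"
    by (simp_all only: Q_def)
  \<comment> \<open>The first \<open>\<mu>\<close> pays for the summand 1 in raising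
    \<open>p x\<close> to \<open>p z + \<delta>\<close>; each \<open>2 + \<mu>\<close> is the 1 from
    \<open>local_gain\<close> plus the bound \<open>\<mu> + 1\<close> of the gradient
    integral.\<close>
  define K where "K = \<mu> + (\<Sum>z\<in>Z. k z * (2 + \<mu>))"
  show ?thesis
  proof (rule that[of K])
    show "0 \<le> K" unfolding K_def using k(1) \<mu>0 by (intro add_nonneg_nonneg sum_nonneg mult_nonneg_nonneg) auto
    fix \<psi> assume \<psi>: "test_fun \<Omega> \<psi>" and g1: "vmod M p (grad \<psi>) \<le> 1"
    interpret C1_function \<psi> "grad \<psi>" by (rule test_funD[OF \<psi>])
    note t = test_fun_M[OF \<psi>]
    have "vmod M (\<lambda>x. 1) (grad \<psi>) \<le> ennreal \<mu> + 1"
      using vmod_const_le[OF t(2) p_measurable, of 1] p_ge_1 g1 by (auto intro: order_trans add_left_mono)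
    also have "\<dots> = ennreal (\<mu> + 1)" using \<mu>0 by simp
    finally have "vmod M (\<lambda>x. 1) \<psi> \<le> ennreal D * ennreal (\<mu> + 1)"
      using D(2)[OF \<psi>] by (meson mult_left_mono order_trans zero_le)
    also have "\<dots> = ennreal L" using D(1) \<mu>0 unfolding L_def by (intro ennreal_mult[symmetric]) auto
    finally have \<psi>L: "(\<integral>\<^sup>+x. ennreal \<bar>\<psi> x\<bar> \<partial>lborel) \<le> ennreal L"
      by (simp add: vmod_const_eq test_funD(2)[OF \<psi>])
    have gz: "(\<integral>\<^sup>+x. ennreal (norm (grad \<psi> x) powr (p z - \<delta>)) * indicator (ball z (2 * r0)) x \<partial>lborel) \<le> ennreal (\<mu> + 1)"
      if z: "z \<in> Z" for z
    proof -
      have "q \<le> p z" using p_bounds[of z] Z(2) z by auto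
      then have s1: "1 \<le> p z - \<delta>" using \<delta> by linarith
      have "(\<integral>\<^sup>+x. ennreal (norm (grad \<psi> x) powr (p z - \<delta>)) * indicator (ball z (2 * r0)) x \<partial>lborel)
         \<le> (\<integral>\<^sup>+x. (1 + ennreal (norm (grad \<psi> x) powr p x)) * indicator \<Omega> x \<partial>lborel)"
      proof (rule nn_integral_mono)
        fix x
        show "ennreal (norm (grad \<psi> x) powr (p z - \<delta>)) * indicator (ball z (2 * r0)) x
            \<le> (1 + ennreal (norm (grad \<psi> x) powr p x)) * indicator \<Omega> x"
        proof (cases "x \<in> \<Omega> \<and> x \<in> ball z (2 * r0)")
          case True
          then have "norm (grad \<psi> x) powr (p z - \<delta>) \<le> 1 + norm (grad \<psi> x) powr p x"
            using near[OF z, of x] s1 by (intro powr_exponent_le) auto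
          then have "ennreal (norm (grad \<psi> x) powr (p z - \<delta>)) \<le> ennreal (1 + norm (grad \<psi> x) powr p x)"
            by (rule ennreal_leI)
          then show ?thesis using True by simp
        next
          case False
          then show ?thesis using test_funD(3)[OF \<psi>, of x] s1 by (cases "x \<in> \<Omega>") auto
        qed
      qed
      also have "\<dots> = (\<integral>\<^sup>+x. 1 + ennreal (norm (grad \<psi> x) powr p x) \<partial>M)"
        by (simp add: nn_integral_restrict_space nn_integral_completion)
      also have "\<dots> = (\<integral>\<^sup>+x. 1 \<partial>M) + vmod M p (grad \<psi>)"
        unfolding vmod_def using t(2) by (intro nn_integral_add) auto
      also have "\<dots> \<le> ennreal \<mu> + 1" using g1 emeasure_\<Omega> by (intro add_mono) auto
      finally show ?thesis using \<mu>0 by simp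
    qed
    have [measurable]: "ball z r0 \<in> sets borel" for z by simp
    have "vmod M p \<psi> \<le> (\<integral>\<^sup>+x. indicator \<Omega> x + (\<Sum>z\<in>Z. ennreal (\<bar>\<psi> x\<bar> powr (p z + \<delta>)) * indicator (ball z r0) x) \<partial>lborel)"
      unfolding vmod_M_eq
    proof (rule nn_integral_mono)
      fix x
      show "ennreal (norm (\<psi> x) powr p x) * indicator \<Omega> x
         \<le> indicator \<Omega> x + (\<Sum>z\<in>Z. ennreal (\<bar>\<psi> x\<bar> powr (p z + \<delta>)) * indicator (ball z r0) x)"
      proof (cases "x \<in> \<Omega>")
        case True
        then obtain z where z: "z \<in> Z" "x \<in> ball z r0" using Z(3) closure_subset by blast
        then have "x \<in> ball z (2 * r0)" using r0 by auto
        then have "\<bar>\<psi> x\<bar> powr p x \<le> 1 + \<bar>\<psi> x\<bar> powr (p z + \<delta>)"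
          using near[OF z(1) True] p_on[OF True] q_gt_1 by (intro powr_exponent_le) auto
        then have "ennreal (norm (\<psi> x) powr p x) \<le> 1 + ennreal (\<bar>\<psi> x\<bar> powr (p z + \<delta>))"
          using ennreal_leI by fastforce
        also have "\<dots> \<le> 1 + (\<Sum>z\<in>Z. ennreal (\<bar>\<psi> x\<bar> powr (p z + \<delta>)) * indicator (ball z r0) x)"
          using member_le_sum[OF z(1), of "\<lambda>z. ennreal (\<bar>\<psi> x\<bar> powr (p z + \<delta>)) * indicator (ball z r0) x"] Z(1) z(2)
          by (intro add_left_mono) simp
        finally show ?thesis using True by simp
      qed simp
    qed
    also have "\<dots> = (\<integral>\<^sup>+x. indicator \<Omega> x \<partial>lborel) + (\<Sum>z\<in>Z. \<integral>\<^sup>+x. ennreal (\<bar>\<psi> x\<bar> powr (p z + \<delta>)) * indicator (ball z r0) x \<partial>lborel)"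
      by (subst nn_integral_add, measurable, subst nn_integral_sum, auto)
    also have "(\<integral>\<^sup>+x. indicator \<Omega> x \<partial>lborel) = ennreal \<mu>"
      using emeasure_\<Omega> by (simp add: emeasure_restrict_space)
    also have "(\<Sum>z\<in>Z. \<integral>\<^sup>+x. ennreal (\<bar>\<psi> x\<bar> powr (p z + \<delta>)) * indicator (ball z r0) x \<partial>lborel) \<le> (\<Sum>z\<in>Z. ennreal (k z * (2 + \<mu>)))"
    proof (rule sum_mono)
      fix z assume z: "z \<in> Z"
      have "(\<integral>\<^sup>+x. ennreal (\<bar>\<psi> x\<bar> powr (p z + \<delta>)) * indicator (ball z r0) x \<partial>lborel)
        \<le> ennreal (k z) * (1 + (\<integral>\<^sup>+x. ennreal (norm (grad \<psi> x) powr (p z - \<delta>)) * indicator (ball z (2 * r0)) x \<partial>lborel))"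
        by (rule k(2)[OF z test_funD(1)[OF \<psi>] \<psi>L])
      also have "\<dots> \<le> ennreal (k z) * (1 + ennreal (\<mu> + 1))"
        by (intro mult_left_mono add_left_mono gz z) auto
      also have "1 + ennreal (\<mu> + 1) = ennreal (2 + \<mu>)"
        using \<mu>0 by (simp add: ennreal_1[symmetric] ennreal_plus[symmetric] del: ennreal_plus ennreal_1)
      also have "ennreal (k z) * ennreal (2 + \<mu>) = ennreal (k z * (2 + \<mu>))"
        using k(1)[OF z] \<mu>0 by (intro ennreal_mult[symmetric]) auto
      finally show "(\<integral>\<^sup>+x. ennreal (\<bar>\<psi> x\<bar> powr (p z + \<delta>)) * indicator (ball z r0) x \<partial>lborel) \<le> ennreal (k z * (2 + \<mu>))" .
    qed
    also have "(\<Sum>z\<in>Z. ennreal (k z * (2 + \<mu>))) = ennreal (\<Sum>z\<in>Z. k z * (2 + \<mu>))"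
      using k(1) \<mu>0 by (intro sum_ennreal) (auto intro!: mult_nonneg_nonneg)
    also have "ennreal \<mu> + ennreal (\<Sum>z\<in>Z. k z * (2 + \<mu>)) = ennreal K"
      unfolding K_def using k(1) \<mu>0 by (intro ennreal_plus[symmetric]) (auto intro!: sum_nonneg mult_nonneg_nonneg)
    finally show "vmod M p \<psi> \<le> ennreal K" by (simp add: add_left_mono)
  qed
qed

text \<open>The bounded version is applied to \<open>\<psi>\<close> divided by \<open>c\<close>: the
  bound \<open>c powr P\<close> brings its gradient modular down to 1, and scaling back gains the
  factor \<open>c\<close>.\<close>

lemma test_fun_vmod_small:
  assumes e: "0 < e"
  obtains \<delta> where "0 < \<delta>" "\<And>\<psi>. test_fun \<Omega> \<psi> \<Longrightarrow> vmod M p (grad \<psi>) \<le> ennreal \<delta> \<Longrightarrow> vmod M p \<psi> \<le> ennreal e"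
proof -
  obtain K where K: "0 \<le> K" "\<And>\<psi>. test_fun \<Omega> \<psi> \<Longrightarrow> vmod M p (grad \<psi>) \<le> 1 \<Longrightarrow> vmod M p \<psi> \<le> ennreal K"
    using test_fun_vmod_bounded by blast
  define c where "c = min 1 (e / (K + 1))"
  have c: "0 < c" "c \<le> 1" "c * K \<le> e"
  proof -
    show "0 < c" "c \<le> 1" using e K by (auto simp: c_def)
    have "c * K \<le> e / (K + 1) * K" using K by (intro mult_right_mono) (auto simp: c_def)
    also have "\<dots> \<le> e" using e K by (simp add: divide_simps)
    finally show "c * K \<le> e" .
  qed
  show ?thesis
  proof (rule that[of "c powr P"])
    show "0 < c powr P" using c by simp
    fix \<psi> assume \<psi>: "test_fun \<Omega> \<psi>" and g: "vmod M p (grad \<psi>) \<le> ennreal (c powr P)"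
    note t = test_fun_M[OF \<psi>]
    define \<psi>' where "\<psi>' = (\<lambda>x. 0 + (1 / c) * \<psi> x)"
    have t': "test_fun \<Omega> \<psi>'" unfolding \<psi>'_def by (rule test_fun_add_scale[OF test_fun_zero \<psi>])
    have g': "grad \<psi>' = (\<lambda>x. (1 / c) *\<^sub>R grad \<psi> x)"
      unfolding \<psi>'_def fun_eq_iff grad_add_scale[OF test_fun_zero \<psi>] by simp
    have "vmod M p (grad \<psi>') \<le> ennreal ((1 / c) powr P) * vmod M p (grad \<psi>)"
      unfolding g' using c by (intro vmod_scale_le t p_measurable p_nonneg_bound) auto
    also have "\<dots> \<le> ennreal ((1 / c) powr P) * ennreal (c powr P)" using g by (rule mult_left_mono) simp
    also have "\<dots> = 1" using c by (simp add: ennreal_mult[symmetric] powr_divide)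
    finally have "vmod M p \<psi>' \<le> ennreal K" by (rule K(2)[OF t'])
    have "vmod M p \<psi> = vmod M p (\<lambda>x. c *\<^sub>R \<psi>' x)" using c by (simp add: \<psi>'_def)
    also have "\<dots> \<le> ennreal c * vmod M p \<psi>'"
      using c test_fun_M[OF t'] by (intro vmod_scale_small p_measurable p_ge_1) auto
    also have "\<dots> \<le> ennreal c * ennreal K" using \<open>vmod M p \<psi>' \<le> _\<close> by (rule mult_left_mono) simp
    also have "\<dots> = ennreal (c * K)" using c K by (intro ennreal_mult[symmetric]) auto
    also have "\<dots> \<le> ennreal e" by (rule ennreal_leI[OF c(3)])
    finally show "vmod M p \<psi> \<le> ennreal e" .
  qed
qed


section \<open>Linear structure, closedness and compactness of the space\<close>

lemma W0_vmod_zero: "W0_vmod (\<lambda>x. 0) (\<lambda>x. 0)"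
  unfolding W0_vmod_def
  by (intro conjI exI[of _ "\<lambda>n x. 0"]) (auto simp: test_fun_zero vmod_def)

lemma W0_vmod_linear:
  assumes ug: "W0_vmod u g" and vh: "W0_vmod v h"
  shows "W0_vmod (\<lambda>x. u x + c * v x) (\<lambda>x. g x + c *\<^sub>R h x)"
proof -
  obtain \<phi>s where \<phi>: "u \<in> borel_measurable M" "g \<in> borel_measurable M" "\<And>n. test_fun \<Omega> (\<phi>s n)"
    "(\<lambda>n. vmod M p (\<lambda>x. \<phi>s n x - u x)) \<longlonglongrightarrow> 0" "(\<lambda>n. vmod M p (\<lambda>x. grad (\<phi>s n) x - g x)) \<longlonglongrightarrow> 0"
    using W0_vmodE[OF ug] by blast
  obtain \<psi>s where \<psi>: "v \<in> borel_measurable M" "h \<in> borel_measurable M" "\<And>n. test_fun \<Omega> (\<psi>s n)"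
    "(\<lambda>n. vmod M p (\<lambda>x. \<psi>s n x - v x)) \<longlonglongrightarrow> 0" "(\<lambda>n. vmod M p (\<lambda>x. grad (\<psi>s n) x - h x)) \<longlonglongrightarrow> 0"
    using W0_vmodE[OF vh] by blast
  have comb: "(\<lambda>n. vmod M p (\<lambda>x. (a n x + c *\<^sub>R b n x) - (a' x + c *\<^sub>R b' x))) \<longlonglongrightarrow> 0"
    if [measurable]: "\<And>n. a n \<in> borel_measurable M" "\<And>n. b n \<in> borel_measurable M" "a' \<in> borel_measurable M" "b' \<in> borel_measurable M"
      and la: "(\<lambda>n. vmod M p (\<lambda>x. a n x - a' x)) \<longlonglongrightarrow> 0" and lb: "(\<lambda>n. vmod M p (\<lambda>x. b n x - b' x)) \<longlonglongrightarrow> 0"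
    for a b :: "nat \<Rightarrow> 'a \<Rightarrow> 'b::euclidean_space" and a' b'
  proof -
    define C where "C = max 1 \<bar>c\<bar>"
    have le: "vmod M p (\<lambda>x. (a n x + c *\<^sub>R b n x) - (a' x + c *\<^sub>R b' x))
      \<le> ennreal (2 powr P) * (vmod M p (\<lambda>x. a n x - a' x) + ennreal (C powr P) * vmod M p (\<lambda>x. b n x - b' x))" for n
    proof -
      have "vmod M p (\<lambda>x. (a n x + c *\<^sub>R b n x) - (a' x + c *\<^sub>R b' x)) = vmod M p (\<lambda>x. (a n x - a' x) + c *\<^sub>R (b n x - b' x))"
        by (simp add: algebra_simps)
      also have "\<dots> \<le> ennreal (2 powr P) * (vmod M p (\<lambda>x. a n x - a' x) + vmod M p (\<lambda>x. c *\<^sub>R (b n x - b' x)))"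
        by (rule vmod_add_le) (measurable, rule p_nonneg_bound)
      also have "\<dots> \<le> ennreal (2 powr P) * (vmod M p (\<lambda>x. a n x - a' x) + ennreal (C powr P) * vmod M p (\<lambda>x. b n x - b' x))"
        by (intro mult_left_mono add_left_mono vmod_scale_le p_measurable p_nonneg_bound) (auto simp: C_def)
      finally show ?thesis .
    qed
    have "(\<lambda>n. vmod M p (\<lambda>x. a n x - a' x) + ennreal (C powr P) * vmod M p (\<lambda>x. b n x - b' x)) \<longlonglongrightarrow> 0 + 0"
      by (intro tendsto_add la ennreal_cmult_tendsto_0 lb)
    then have "(\<lambda>n. vmod M p (\<lambda>x. a n x - a' x) + ennreal (C powr P) * vmod M p (\<lambda>x. b n x - b' x)) \<longlonglongrightarrow> 0" by simp
    then show ?thesis by (rule ennreal_tendsto_0_le[OF ennreal_cmult_tendsto_0 le])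
  qed
  show ?thesis
    unfolding W0_vmod_def
  proof (intro conjI exI[of _ "\<lambda>n x. \<phi>s n x + c * \<psi>s n x"] allI)
    show "(\<lambda>x. u x + c * v x) \<in> borel_measurable M" "(\<lambda>x. g x + c *\<^sub>R h x) \<in> borel_measurable M"
      using \<phi> \<psi> by auto
    show "test_fun \<Omega> (\<lambda>x. \<phi>s n x + c * \<psi>s n x)" for n by (rule test_fun_add_scale[OF \<phi>(3) \<psi>(3)])
    show "(\<lambda>n. vmod M p (\<lambda>x. \<phi>s n x + c * \<psi>s n x - (u x + c * v x))) \<longlonglongrightarrow> 0"
      using comb[OF test_fun_M(1)[OF \<phi>(3)] test_fun_M(1)[OF \<psi>(3)] \<phi>(1) \<psi>(1) \<phi>(4) \<psi>(4)] by simp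
    show "(\<lambda>n. vmod M p (\<lambda>x. grad (\<lambda>x. \<phi>s n x + c * \<psi>s n x) x - (g x + c *\<^sub>R h x))) \<longlonglongrightarrow> 0"
      using comb[OF test_fun_M(2)[OF \<phi>(3)] test_fun_M(2)[OF \<psi>(3)] \<phi>(2) \<psi>(2) \<phi>(5) \<psi>(5)]
      by (simp add: grad_add_scale[OF \<phi>(3) \<psi>(3)])
  qed
qed

lemma vmod_tendsto_0_const_exponent:
  assumes s: "0 < s" "s \<le> q" and w: "\<And>n. w n \<in> borel_measurable M" and lim: "(\<lambda>n. vmod M p (w n)) \<longlonglongrightarrow> 0"
  shows "(\<lambda>n. vmod M (\<lambda>x. s) (w n :: 'a \<Rightarrow> 'b::euclidean_space)) \<longlonglongrightarrow> 0"
  by (rule vmod_tendsto_0_lower_exponent[OF w p_measurable s(1) _ lim]) (use p_on s in force)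

lemma W0_vmod_approx:
  assumes ug: "W0_vmod u g" and e: "0 < e"
  obtains \<psi> where "test_fun \<Omega> \<psi>" "vmod M p (\<lambda>x. \<psi> x - u x) \<le> ennreal e" "vmod M p (\<lambda>x. grad \<psi> x - g x) \<le> ennreal e"
    "vmod M (\<lambda>x. 1) (\<lambda>x. \<psi> x - u x) \<le> ennreal e" "vmod M (\<lambda>x. 1) (\<lambda>x. grad \<psi> x - g x) \<le> ennreal e"
proof -
  obtain \<phi>s where \<phi>: "u \<in> borel_measurable M" "g \<in> borel_measurable M" "\<And>n. test_fun \<Omega> (\<phi>s n)"
    "(\<lambda>n. vmod M p (\<lambda>x. \<phi>s n x - u x)) \<longlonglongrightarrow> 0" "(\<lambda>n. vmod M p (\<lambda>x. grad (\<phi>s n) x - g x)) \<longlonglongrightarrow> 0"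
    using W0_vmodE[OF ug] by blast
  note t = test_fun_M[OF \<phi>(3)]
  have l: "(\<lambda>n. vmod M (\<lambda>x. 1) (\<lambda>x. \<phi>s n x - u x)) \<longlonglongrightarrow> 0" "(\<lambda>n. vmod M (\<lambda>x. 1) (\<lambda>x. grad (\<phi>s n) x - g x)) \<longlonglongrightarrow> 0"
    using q_gt_1 by (intro vmod_tendsto_0_const_exponent borel_measurable_diff t \<phi>; simp)+
  have ev: "\<forall>\<^sub>F n in sequentially. f n \<le> ennreal e" if "f \<longlonglongrightarrow> 0" for f :: "nat \<Rightarrow> ennreal"
    using that e unfolding ennreal_tendsto_0_iff_eventually_le by simp
  have "\<forall>\<^sub>F n in sequentially. vmod M p (\<lambda>x. \<phi>s n x - u x) \<le> ennreal e \<and> vmod M p (\<lambda>x. grad (\<phi>s n) x - g x) \<le> ennreal e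
     \<and> vmod M (\<lambda>x. 1) (\<lambda>x. \<phi>s n x - u x) \<le> ennreal e \<and> vmod M (\<lambda>x. 1) (\<lambda>x. grad (\<phi>s n) x - g x) \<le> ennreal e"
    by (intro eventually_conj ev \<phi>(4,5) l)
  then obtain n where "vmod M p (\<lambda>x. \<phi>s n x - u x) \<le> ennreal e \<and> vmod M p (\<lambda>x. grad (\<phi>s n) x - g x) \<le> ennreal e
     \<and> vmod M (\<lambda>x. 1) (\<lambda>x. \<phi>s n x - u x) \<le> ennreal e \<and> vmod M (\<lambda>x. 1) (\<lambda>x. grad (\<phi>s n) x - g x) \<le> ennreal e"
    unfolding eventually_sequentially by blast
  then show ?thesis using that[OF \<phi>(3)[of n]] by blast
qed

text \<open>For a constant exponent the inequality is linear and survives the limit; the two factors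
  \<open>2 powr q\<close> come from applying the quasi-triangle inequality to the function and to
  its gradient.\<close>

lemma W0_vmod_poincare:
  obtains K where "0 \<le> K" "\<And>u g. W0_vmod u g \<Longrightarrow> vmod M (\<lambda>x. q) u \<le> ennreal K * vmod M (\<lambda>x. q) g"
proof -
  obtain D where D: "0 \<le> D" "\<And>\<psi>. test_fun \<Omega> \<psi> \<Longrightarrow> vmod M (\<lambda>x. q) \<psi> \<le> ennreal D * vmod M (\<lambda>x. q) (grad \<psi>)"
    using test_fun_poincare[of q] q_gt_1 by auto
  show ?thesis
  proof (rule that[of "2 powr q * (D * 2 powr q)"])
    show "0 \<le> 2 powr q * (D * 2 powr q)" using D by simp
    fix u g assume ug: "W0_vmod u g"
    obtain \<phi>s where \<phi>: "u \<in> borel_measurable M" "g \<in> borel_measurable M" "\<And>n. test_fun \<Omega> (\<phi>s n)"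
      "(\<lambda>n. vmod M p (\<lambda>x. \<phi>s n x - u x)) \<longlonglongrightarrow> 0" "(\<lambda>n. vmod M p (\<lambda>x. grad (\<phi>s n) x - g x)) \<longlonglongrightarrow> 0"
      using W0_vmodE[OF ug] by blast
    note t = test_fun_M[OF \<phi>(3)]
    have la: "(\<lambda>n. vmod M (\<lambda>x. q) (\<lambda>x. \<phi>s n x - u x)) \<longlonglongrightarrow> 0" and lb: "(\<lambda>n. vmod M (\<lambda>x. q) (\<lambda>x. grad (\<phi>s n) x - g x)) \<longlonglongrightarrow> 0"
      using q_gt_1 by (intro vmod_tendsto_0_const_exponent borel_measurable_diff t \<phi>; simp)+
    have le: "vmod M (\<lambda>x. q) u \<le> ennreal (2 powr q) * (vmod M (\<lambda>x. q) (\<lambda>x. \<phi>s n x - u x)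
         + ennreal (D * 2 powr q) * (vmod M (\<lambda>x. q) (\<lambda>x. grad (\<phi>s n) x - g x) + vmod M (\<lambda>x. q) g))" for n
    proof -
      have "vmod M (\<lambda>x. q) u = vmod M (\<lambda>x. q) (\<lambda>x. (u x - \<phi>s n x) + \<phi>s n x)" by simp
      also have "\<dots> \<le> ennreal (2 powr q) * (vmod M (\<lambda>x. q) (\<lambda>x. u x - \<phi>s n x) + vmod M (\<lambda>x. q) (\<phi>s n))"
        using t \<phi> q_gt_1 by (intro vmod_add_le) auto
      also have "\<dots> \<le> ennreal (2 powr q) * (vmod M (\<lambda>x. q) (\<lambda>x. u x - \<phi>s n x) + ennreal D * vmod M (\<lambda>x. q) (grad (\<phi>s n)))"
        by (intro mult_left_mono add_left_mono D \<phi>) auto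
      also have "\<dots> \<le> ennreal (2 powr q) * (vmod M (\<lambda>x. q) (\<lambda>x. u x - \<phi>s n x)
          + ennreal D * (ennreal (2 powr q) * (vmod M (\<lambda>x. q) (\<lambda>x. grad (\<phi>s n) x - g x) + vmod M (\<lambda>x. q) g)))"
        using vmod_add_le[of "\<lambda>x. grad (\<phi>s n) x - g x" M g "\<lambda>x. q" q] t \<phi> q_gt_1
        by (intro mult_left_mono add_left_mono) auto
      also have "\<dots> = ennreal (2 powr q) * (vmod M (\<lambda>x. q) (\<lambda>x. \<phi>s n x - u x)
         + ennreal (D * 2 powr q) * (vmod M (\<lambda>x. q) (\<lambda>x. grad (\<phi>s n) x - g x) + vmod M (\<lambda>x. q) g))"
        using D(1) by (simp add: ennreal_mult mult.assoc vmod_minus_commute[of M _ u])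
      finally show ?thesis .
    qed
    have "(\<lambda>n. ennreal (2 powr q) * (vmod M (\<lambda>x. q) (\<lambda>x. \<phi>s n x - u x)
         + ennreal (D * 2 powr q) * (vmod M (\<lambda>x. q) (\<lambda>x. grad (\<phi>s n) x - g x) + vmod M (\<lambda>x. q) g)))
        \<longlonglongrightarrow> ennreal (2 powr q) * (0 + ennreal (D * 2 powr q) * (0 + vmod M (\<lambda>x. q) g))"
      by (intro tendsto_add ennreal_tendsto_cmult tendsto_const la lb) auto
    then have "vmod M (\<lambda>x. q) u \<le> ennreal (2 powr q) * (0 + ennreal (D * 2 powr q) * (0 + vmod M (\<lambda>x. q) g))"
      by (rule LIMSEQ_le_const) (use le in blast)
    then show "vmod M (\<lambda>x. q) u \<le> ennreal (2 powr q * (D * 2 powr q)) * vmod M (\<lambda>x. q) g"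
      using D(1) by (simp add: ennreal_mult mult.assoc)
  qed
qed

text \<open>A diagonal sequence of test functions has gradients that are Cauchy in the modular;
  \<open>test_fun_vmod_small\<close>, applied to differences, makes the functions Cauchy in the
  modular too. The L1 convergence identifies their limit as \<open>u0\<close>.\<close>

lemma W0_vmod_closed:
  assumes W: "\<And>n::nat. W0_vmod (u n) (g n)" and u0: "u0 \<in> borel_measurable M" and g0: "g0 \<in> borel_measurable M"
    and lu: "(\<lambda>n. vmod M (\<lambda>x. 1) (\<lambda>x. u n x - u0 x)) \<longlonglongrightarrow> 0"
    and lg: "(\<lambda>n. vmod M p (\<lambda>x. g n x - g0 x)) \<longlonglongrightarrow> 0"
  shows "W0_vmod u0 g0"
proof -
  have um: "u n \<in> borel_measurable M" and gm: "g n \<in> borel_measurable M" for n using W by (auto simp: W0_vmod_def)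
  define Q where "Q n \<psi> \<longleftrightarrow> test_fun \<Omega> \<psi> \<and> vmod M p (\<lambda>x. grad \<psi> x - g n x) \<le> ennreal (1 / real (Suc n))
      \<and> vmod M (\<lambda>x. 1) (\<lambda>x. \<psi> x - u n x) \<le> ennreal (1 / real (Suc n))" for n \<psi>
  have "\<exists>\<psi>. Q n \<psi>" for n
    unfolding Q_def by (rule W0_vmod_approx[OF W[of n], of "1 / real (Suc n)"]) auto
  then obtain \<psi> where "\<And>n. Q n (\<psi> n)" by metis
  then have \<psi>: "\<And>n. test_fun \<Omega> (\<psi> n)" "\<And>n. vmod M p (\<lambda>x. grad (\<psi> n) x - g n x) \<le> ennreal (1 / real (Suc n))"
      "\<And>n. vmod M (\<lambda>x. 1) (\<lambda>x. \<psi> n x - u n x) \<le> ennreal (1 / real (Suc n))"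
    by (simp_all only: Q_def)
  note t = test_fun_M[OF \<psi>(1)]
  have inv: "(\<lambda>n. ennreal (1 / real (Suc n))) \<longlonglongrightarrow> 0"
    using LIMSEQ_inverse_real_of_nat by (subst ennreal_tendsto_0_iff) (auto simp: inverse_eq_divide)
  have lgrad: "(\<lambda>n. vmod M p (\<lambda>x. grad (\<psi> n) x - g0 x)) \<longlonglongrightarrow> 0"
  proof (rule ennreal_tendsto_0_le)
    show "(\<lambda>n. ennreal (2 powr P) * (ennreal (1 / real (Suc n)) + vmod M p (\<lambda>x. g n x - g0 x))) \<longlonglongrightarrow> 0"
      using tendsto_add[OF inv lg] by (intro ennreal_cmult_tendsto_0) simp
    show "vmod M p (\<lambda>x. grad (\<psi> n) x - g0 x) \<le> ennreal (2 powr P) * (ennreal (1 / real (Suc n)) + vmod M p (\<lambda>x. g n x - g0 x))" for n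
      by (rule order_trans[OF vmod_diff_triangle[where v = "g n"] mult_left_mono[OF add_right_mono[OF \<psi>(2)]]])
         (use t gm g0 p_nonneg_bound in auto)
  qed
  have l1: "(\<lambda>n. vmod M (\<lambda>x. 1) (\<lambda>x. \<psi> n x - u0 x)) \<longlonglongrightarrow> 0"
  proof (rule ennreal_tendsto_0_le)
    show "(\<lambda>n. ennreal (2 powr 1) * (ennreal (1 / real (Suc n)) + vmod M (\<lambda>x. 1) (\<lambda>x. u n x - u0 x))) \<longlonglongrightarrow> 0"
      using tendsto_add[OF inv lu] by (intro ennreal_cmult_tendsto_0) simp
    show "vmod M (\<lambda>x. 1) (\<lambda>x. \<psi> n x - u0 x) \<le> ennreal (2 powr 1) * (ennreal (1 / real (Suc n)) + vmod M (\<lambda>x. 1) (\<lambda>x. u n x - u0 x))" for n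
      by (rule order_trans[OF vmod_diff_triangle[where v = "u n"] mult_left_mono[OF add_right_mono[OF \<psi>(3)]]])
         (use t um u0 in auto)
  qed
  have [measurable]: "\<psi> n \<in> borel_measurable M" "u0 \<in> borel_measurable M" for n by (fact t u0)+
  have Cauchy: "\<exists>N. \<forall>i\<ge>N. \<forall>j\<ge>N. vmod M p (\<lambda>x. \<psi> i x - \<psi> j x) \<le> ennreal e" if e: "0 < e" for e
  proof -
    obtain \<delta> where \<delta>: "0 < \<delta>" "\<And>\<psi>. test_fun \<Omega> \<psi> \<Longrightarrow> vmod M p (grad \<psi>) \<le> ennreal \<delta> \<Longrightarrow> vmod M p \<psi> \<le> ennreal e"
      using test_fun_vmod_small[OF e] by blast
    \<comment> \<open>Two gradient errors of size \<open>\<eta>\<close>, times the quasi-triangle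
      factor \<open>2 powr P\<close>, add up to \<open>\<delta>\<close>.\<close>
    define \<eta> where "\<eta> = \<delta> / (2 powr P * 2)"
    have "0 < \<eta>" using \<delta> by (simp add: \<eta>_def)
    then obtain N where N: "\<And>n. n \<ge> N \<Longrightarrow> vmod M p (\<lambda>x. grad (\<psi> n) x - g0 x) \<le> ennreal \<eta>"
      using lgrad unfolding ennreal_tendsto_0_iff_eventually_le eventually_sequentially by blast
    have "vmod M p (\<lambda>x. \<psi> i x - \<psi> j x) \<le> ennreal e" if "i \<ge> N" "j \<ge> N" for i j
    proof -
      have tt: "test_fun \<Omega> (\<lambda>x. \<psi> i x + (- 1) * \<psi> j x)" by (rule test_fun_add_scale[OF \<psi>(1) \<psi>(1)])
      have "vmod M p (\<lambda>x. grad (\<psi> i) x - grad (\<psi> j) x)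
         \<le> ennreal (2 powr P) * (vmod M p (\<lambda>x. grad (\<psi> i) x - g0 x) + vmod M p (\<lambda>x. g0 x - grad (\<psi> j) x))"
        by (intro vmod_diff_triangle t g0 p_measurable p_nonneg_bound)
      also have "\<dots> \<le> ennreal (2 powr P) * (ennreal \<eta> + ennreal \<eta>)"
        using N[OF that(1)] N[OF that(2)] vmod_minus_commute[of M p g0 "grad (\<psi> j)"]
        by (intro mult_left_mono add_mono) auto
      also have "\<dots> = ennreal \<delta>"
        using \<open>0 < \<eta>\<close> by (simp add: ennreal_plus[symmetric] ennreal_mult[symmetric] \<eta>_def del: ennreal_plus)
      finally have "vmod M p (grad (\<lambda>x. \<psi> i x + (- 1) * \<psi> j x)) \<le> ennreal \<delta>"
        using grad_add_scale[OF \<psi>(1)[of i] \<psi>(1)[of j], of "- 1"] by (simp add: vmod_def)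
      from \<delta>(2)[OF tt this] show ?thesis by simp
    qed
    then show ?thesis by blast
  qed
  have pi: "integrable M (\<psi> n)" for n by (rule integrable_if_vmod[OF t(1,3)])
  have fin1: "vmod M (\<lambda>x. 1) (\<lambda>x. \<psi> n x - u0 x) < \<infinity>" if "vmod M (\<lambda>x. 1) (\<lambda>x. \<psi> n x - u0 x) \<le> ennreal 1" for n
    using that by (rule order_le_less_trans) simp
  have "\<forall>\<^sub>F n in sequentially. vmod M (\<lambda>x. 1) (\<lambda>x. \<psi> n x - u0 x) \<le> ennreal 1"
    using l1 unfolding ennreal_tendsto_0_iff_eventually_le by (meson zero_less_one)
  \<comment> \<open>\<open>u0\<close> is only known to be measurable; one member at L1 distance at
    most 1 makes it integrable.\<close>
  then obtain n0 where "vmod M (\<lambda>x. 1) (\<lambda>x. \<psi> n0 x - u0 x) \<le> ennreal 1" by (auto simp: eventually_sequentially)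
  from integrable_if_vmod_finite[OF _ _ fin1[OF this]] have "integrable M (\<lambda>x. norm (\<psi> n0 x - u0 x))" by simp
  then have "integrable M (\<lambda>x. \<psi> n0 x - u0 x)" by (subst (asm) integrable_norm_iff) auto
  from Bochner_Integration.integrable_diff[OF pi[of n0] this] have u0i: "integrable M u0" by simp
  have di: "integrable M (\<lambda>x. \<psi> n x - u0 x)" for n using pi u0i by simp
  have "(\<lambda>n. \<integral>x. norm (\<psi> n x - u0 x) \<partial>M) \<longlonglongrightarrow> 0"
  proof -
    have "vmod M (\<lambda>x. 1) (\<lambda>x. \<psi> n x - u0 x) = ennreal (\<integral>x. norm (\<psi> n x - u0 x) \<partial>M)" for n
      using di by (subst vmod_eq_integral) auto
    then show ?thesis using l1 by (simp add: ennreal_tendsto_0_iff)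
  qed
  then obtain r where r: "strict_mono r" "AE x in M. (\<lambda>n. \<psi> (r n) x - u0 x) \<longlonglongrightarrow> 0"
    using tendsto_L1_AE_subseq[of M "\<lambda>n x. \<psi> n x - u0 x"] di by auto
  have "(\<lambda>n. vmod M p (\<lambda>x. \<psi> n x - u0 x)) \<longlonglongrightarrow> 0"
  proof (rule vmod_Cauchy_tendsto_AE_limit[where w = \<psi> and r = r])
    show "AE x in M. (\<lambda>n. \<psi> (r n) x) \<longlonglongrightarrow> u0 x" using r(2) by (simp add: LIM_zero_iff)
    show "0 < p x" if "x \<in> space M" for x using p_ge_1[OF that] by simp
  qed (use r(1) Cauchy in auto)
  then show ?thesis unfolding W0_vmod_def using u0 g0 \<psi>(1) lgrad by blast
qed

text \<open>Each member is replaced by a test function at L1 distance at most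
  \<open>1 / Suc n\<close>. The q-modular bound controls the gradients in L1 and, through the
  Poincare inequality, the functions, so \<open>rellich_L1\<close> applies.\<close>

lemma W0_vmod_compact:
  assumes W: "\<And>n::nat. W0_vmod (u n) (g n)" and B: "\<And>n. vmod M (\<lambda>x. q) (g n) \<le> ennreal B"
  shows "\<exists>r::nat \<Rightarrow> nat. strict_mono r \<and> (\<forall>e>0. \<exists>N. \<forall>i\<ge>N. \<forall>j\<ge>N. (\<integral>x. \<bar>u (r i) x - u (r j) x\<bar> \<partial>M) < e)"
proof -
  have um: "u n \<in> borel_measurable M" and gm: "g n \<in> borel_measurable M" for n using W by (auto simp: W0_vmod_def)
  have ui: "integrable M (u n)" for n by (rule integrable_if_vmod[OF um W0_vmod_finite(1)[OF W]])
  define Q where "Q n \<psi> \<longleftrightarrow> test_fun \<Omega> \<psi> \<and> vmod M (\<lambda>x. 1) (\<lambda>x. \<psi> x - u n x) \<le> ennreal (1 / real (Suc n))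
      \<and> vmod M (\<lambda>x. 1) (\<lambda>x. grad \<psi> x - g n x) \<le> ennreal (1 / real (Suc n))" for n \<psi>
  have "\<exists>\<psi>. Q n \<psi>" for n
    unfolding Q_def by (rule W0_vmod_approx[OF W[of n], of "1 / real (Suc n)"]) auto
  then obtain \<psi> where "\<And>n. Q n (\<psi> n)" by metis
  then have \<psi>: "\<And>n. test_fun \<Omega> (\<psi> n)" "\<And>n. vmod M (\<lambda>x. 1) (\<lambda>x. \<psi> n x - u n x) \<le> ennreal (1 / real (Suc n))"
      "\<And>n. vmod M (\<lambda>x. 1) (\<lambda>x. grad (\<psi> n) x - g n x) \<le> ennreal (1 / real (Suc n))"
    by (simp_all only: Q_def)
  note t = test_fun_M[OF \<psi>(1)]
  obtain D where D: "0 \<le> D" "\<And>\<psi>. test_fun \<Omega> \<psi> \<Longrightarrow> vmod M (\<lambda>x. 1) \<psi> \<le> ennreal D * vmod M (\<lambda>x. 1) (grad \<psi>)"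
    using test_fun_poincare[of 1] by auto
  define L1 where "L1 = 2 * (1 + (\<mu> + max 0 B))"
  have L1: "0 \<le> L1" by (simp add: L1_def)
  have gL: "vmod M (\<lambda>x. 1) (grad (\<psi> n)) \<le> ennreal L1" for n
  proof -
    have "vmod M (\<lambda>x. 1) (g n) \<le> ennreal \<mu> + vmod M (\<lambda>x. q) (g n)"
      using q_gt_1 by (intro vmod_const_le gm) auto
    also have "\<dots> \<le> ennreal \<mu> + ennreal (max 0 B)"
      using B[of n] by (intro add_left_mono) (auto intro: order_trans ennreal_leI)
    also have "\<dots> = ennreal (\<mu> + max 0 B)" by (rule ennreal_plus[symmetric]) auto
    finally have "vmod M (\<lambda>x. 1) (g n) \<le> ennreal (\<mu> + max 0 B)" .
    moreover have "vmod M (\<lambda>x. 1) (\<lambda>x. grad (\<psi> n) x - g n x) \<le> ennreal 1"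
      using \<psi>(3)[of n] by (rule order_trans) (auto intro!: ennreal_leI)
    moreover have "vmod M (\<lambda>x. 1) (\<lambda>x. (grad (\<psi> n) x - g n x) + g n x)
       \<le> ennreal (2 powr 1) * (vmod M (\<lambda>x. 1) (\<lambda>x. grad (\<psi> n) x - g n x) + vmod M (\<lambda>x. 1) (g n))"
      using t gm by (intro vmod_add_le) auto
    ultimately have "vmod M (\<lambda>x. 1) (grad (\<psi> n)) \<le> ennreal 2 * (ennreal 1 + ennreal (\<mu> + max 0 B))"
      by (simp del: ennreal_1 ennreal_numeral) (meson add_mono mult_left_mono order_trans zero_le)
    also have "ennreal 1 + ennreal (\<mu> + max 0 B) = ennreal (1 + (\<mu> + max 0 B))" by (rule ennreal_plus[symmetric]) auto
    also have "ennreal 2 * ennreal (1 + (\<mu> + max 0 B)) = ennreal L1" unfolding L1_def by (rule ennreal_mult[symmetric]) auto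
    finally show ?thesis .
  qed
  define L where "L = max L1 (D * L1)"
  have gL': "(\<integral>\<^sup>+x. ennreal (norm (grad (\<psi> n) x)) \<partial>lborel) \<le> ennreal L" for n
    using gL[of n] ennreal_leI[of L1 L] by (simp add: vmod_const_eq test_funD(3)[OF \<psi>(1)] L_def)
  have \<psi>L: "(\<integral>\<^sup>+x. ennreal \<bar>\<psi> n x\<bar> \<partial>lborel) \<le> ennreal L" for n
  proof -
    have "vmod M (\<lambda>x. 1) (\<psi> n) \<le> ennreal D * ennreal L1"
      using D(2)[OF \<psi>(1)[of n]] gL[of n] by (meson mult_left_mono order_trans zero_le)
    also have "\<dots> = ennreal (D * L1)" using D L1 by (intro ennreal_mult[symmetric]) auto
    also have "\<dots> \<le> ennreal L" by (rule ennreal_leI) (simp add: L_def)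
    finally show ?thesis by (simp add: vmod_const_eq test_funD(2)[OF \<psi>(1)])
  qed
  have fin: "emeasure lborel \<Omega> < \<infinity>" using bounded_\<Omega> by (rule emeasure_bounded_finite)
  have L: "0 \<le> L" using L1 by (simp add: L_def)
  obtain r :: "nat \<Rightarrow> nat" where r: "strict_mono r" and
    rc: "\<And>e. 0 < e \<Longrightarrow> \<exists>N. \<forall>i\<ge>N. \<forall>j\<ge>N. (\<integral>\<^sup>+x. ennreal \<bar>\<psi> (r i) x - \<psi> (r j) x\<bar> * indicator \<Omega> x \<partial>lborel) \<le> ennreal e"
    by (rule rellich_L1[of \<psi> "\<lambda>n. grad (\<psi> n)", OF test_funD(1)[OF \<psi>(1)] \<Omega>_lebesgue(2) fin L \<psi>L gL']) (rule that)
  have "\<exists>N. \<forall>i\<ge>N. \<forall>j\<ge>N. (\<integral>x. \<bar>u (r i) x - u (r j) x\<bar> \<partial>M) < e" if e: "0 < e" for e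
  proof -
    \<comment> \<open>Two quasi-triangle inequalities with factor 2 give a total of
      \<open>10 * \<eta>\<close>, which is below \<open>e\<close>.\<close>
    define \<eta> where "\<eta> = e / 16"
    have \<eta>: "0 < \<eta>" using e by (simp add: \<eta>_def)
    obtain N1 where N1: "\<And>i j. i \<ge> N1 \<Longrightarrow> j \<ge> N1 \<Longrightarrow> vmod M (\<lambda>x. 1) (\<lambda>x. \<psi> (r i) x - \<psi> (r j) x) \<le> ennreal \<eta>"
      using rc[OF \<eta>] by (auto simp: vmod_M_eq)
    obtain N2 where N2: "1 / real (Suc N2) < \<eta>" using nat_approx_posE[OF \<eta>] by blast
    have close: "vmod M (\<lambda>x. 1) (\<lambda>x. \<psi> (r i) x - u (r i) x) \<le> ennreal \<eta>" if "i \<ge> N2" for i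
    proof -
      have "N2 \<le> r i" using that seq_suble[OF r, of i] by linarith
      then have "1 / real (Suc (r i)) \<le> 1 / real (Suc N2)" by (simp add: frac_le)
      then show ?thesis using N2 \<psi>(2)[of "r i"] by (meson ennreal_leI less_imp_le order_trans)
    qed
    have "(\<integral>x. \<bar>u (r i) x - u (r j) x\<bar> \<partial>M) < e" if ij: "i \<ge> max N1 N2" "j \<ge> max N1 N2" for i j
    proof -
      have tri: "vmod M (\<lambda>x. 1) (\<lambda>x. a x - c x) \<le> ennreal 2 * (vmod M (\<lambda>x. 1) (\<lambda>x. a x - b x) + vmod M (\<lambda>x. 1) (\<lambda>x. b x - c x))"
        if "a \<in> borel_measurable M" "b \<in> borel_measurable M" "c \<in> borel_measurable M" for a b c :: "'a \<Rightarrow> real"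
        using vmod_diff_triangle[OF that, of "\<lambda>x. 1" 1] by simp
      have "vmod M (\<lambda>x. 1) (\<lambda>x. u (r i) x - u (r j) x)
        \<le> ennreal 2 * (vmod M (\<lambda>x. 1) (\<lambda>x. u (r i) x - \<psi> (r i) x) + vmod M (\<lambda>x. 1) (\<lambda>x. \<psi> (r i) x - u (r j) x))"
        by (intro tri um t)
      also have "\<dots> \<le> ennreal 2 * (ennreal \<eta> + ennreal 2 * (ennreal \<eta> + ennreal \<eta>))"
      proof (intro mult_left_mono add_mono zero_le)
        show "vmod M (\<lambda>x. 1) (\<lambda>x. u (r i) x - \<psi> (r i) x) \<le> ennreal \<eta>"
          using close[of i] ij by (simp add: vmod_minus_commute[of M _ "u (r i)"])
        have "vmod M (\<lambda>x. 1) (\<lambda>x. \<psi> (r i) x - u (r j) x)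
           \<le> ennreal 2 * (vmod M (\<lambda>x. 1) (\<lambda>x. \<psi> (r i) x - \<psi> (r j) x) + vmod M (\<lambda>x. 1) (\<lambda>x. \<psi> (r j) x - u (r j) x))"
          by (intro tri um t)
        also have "\<dots> \<le> ennreal 2 * (ennreal \<eta> + ennreal \<eta>)"
          using N1[of i j] close[of j] ij by (intro mult_left_mono add_mono) auto
        finally show "vmod M (\<lambda>x. 1) (\<lambda>x. \<psi> (r i) x - u (r j) x) \<le> ennreal 2 * (ennreal \<eta> + ennreal \<eta>)" .
      qed
      also have "\<dots> = ennreal (10 * \<eta>)"
        using \<eta> by (simp add: ennreal_plus[symmetric] ennreal_mult[symmetric] del: ennreal_plus ennreal_numeral)
      finally have "vmod M (\<lambda>x. 1) (\<lambda>x. u (r i) x - u (r j) x) \<le> ennreal (10 * \<eta>)" .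
      moreover have "vmod M (\<lambda>x. 1) (\<lambda>x. u (r i) x - u (r j) x) = ennreal (\<integral>x. \<bar>u (r i) x - u (r j) x\<bar> \<partial>M)"
        using ui by (subst vmod_eq_integral) auto
      ultimately have "(\<integral>x. \<bar>u (r i) x - u (r j) x\<bar> \<partial>M) \<le> 10 * \<eta>" using \<eta> by (simp add: ennreal_le_iff)
      then show ?thesis using e by (simp add: \<eta>_def)
    qed
    then show ?thesis by blast
  qed
  then show ?thesis using r by blast
qed

end

section \<open>The boundary value problem\<close>

text \<open>For \<open>\<bar>t\<bar> \<le> 1\<close> the positive exponent
  \<open>\<alpha> x - 1\<close> keeps the power at most 1, even at \<open>t = 0\<close>; for larger
  \<open>\<bar>t\<bar>\<close> the exponent \<open>\<beta> x - 1\<close> may be raised to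
  \<open>b - 1\<close>. Absolute values appear because \<open>C1\<close> and \<open>C2\<close> carry
  no sign condition.\<close>

lemma growth_bound:
  assumes x: "x \<in> \<Omega>" and \<alpha>: "1 < \<alpha> x" and \<beta>: "\<beta> x \<le> b" and b: "1 < b"
    and growth: "growth \<Omega> C1 C2 \<alpha> f" "growth \<Omega> C1 C2 \<beta> f"
  shows "\<bar>f x t\<bar> \<le> (\<bar>C1\<bar> + \<bar>C2\<bar>) * (1 + \<bar>t\<bar> powr (b - 1))"
proof -
  have *: "C1 + C2 * r \<le> (\<bar>C1\<bar> + \<bar>C2\<bar>) * (1 + s)" if "0 \<le> r" "r \<le> 1 + s" "0 \<le> s" for r s :: real
  proof -
    have "C2 * r \<le> \<bar>C2\<bar> * (1 + s)" using that by (intro mult_mono) auto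
    moreover have "C1 \<le> \<bar>C1\<bar> * (1 + s)" using mult_left_mono[of 1 "1 + s" "\<bar>C1\<bar>"] that by linarith
    ultimately show ?thesis by (simp add: distrib_right)
  qed
  show ?thesis
  proof (cases "t = 0")
    case True
    then have "\<bar>f x t\<bar> \<le> C1 + C2 * 0" using growth(1) x \<alpha> unfolding growth_def by force
    then show ?thesis using *[of 0 "\<bar>t\<bar> powr (b - 1)"] by simp
  next
    case t: False
    show ?thesis
    proof (cases "\<bar>t\<bar> \<le> 1")
      case True
      have "\<bar>f x t\<bar> \<le> C1 + C2 * \<bar>t\<bar> powr (\<alpha> x - 1)" using growth(1) x t unfolding growth_def by force
      also have "\<dots> \<le> (\<bar>C1\<bar> + \<bar>C2\<bar>) * (1 + \<bar>t\<bar> powr (b - 1))"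
        using True \<alpha> by (intro * add_increasing2) (auto simp: powr_le1)
      finally show ?thesis .
    next
      case False
      have "\<bar>f x t\<bar> \<le> C1 + C2 * \<bar>t\<bar> powr (\<beta> x - 1)" using growth(2) x t unfolding growth_def by force
      also have "\<dots> \<le> (\<bar>C1\<bar> + \<bar>C2\<bar>) * (1 + \<bar>t\<bar> powr (b - 1))"
        using False \<beta> by (intro * add_increasing powr_mono) auto
      finally show ?thesis .
    qed
  qed
qed

theorem theorem3p3:
  fixes \<Omega> :: "'a::euclidean_space set"
    and p1 p2 \<alpha> \<beta> :: "'a \<Rightarrow> real"
    and f :: "'a \<Rightarrow> real \<Rightarrow> real"
    and C1 C2 :: real
  assumes dom: "smooth_bounded_domain \<Omega>"
    and p1: "Cplus \<Omega> p1" and p2: "Cplus \<Omega> p2"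
    and carath: "caratheodory \<Omega> f"
    and alpha: "Cplus \<Omega> \<alpha>"
    and alpha_crit: "\<forall>x\<in>closure \<Omega>. below_crit \<alpha> (\<lambda>y. max (p1 y) (p2 y)) x"
    and growth_alpha: "growth \<Omega> C1 C2 \<alpha> f"
    and beta_cont: "continuous_on (closure \<Omega>) \<beta>"
    and beta_lo: "1 \<le> (SUP x\<in>closure \<Omega>. \<beta> x)"
    and beta_hi: "(SUP x\<in>closure \<Omega>. \<beta> x) < (INF x\<in>closure \<Omega>. min (p1 x) (p2 x))"
    and growth_beta: "growth \<Omega> C1 C2 \<beta> f"
  shows "\<exists>u. weak_solution \<Omega> p1 p2 f u"
proof -
  have \<Omega>: "open \<Omega>" "bounded \<Omega>" "\<Omega> \<noteq> {}" using dom by (auto simp: smooth_bounded_domain_def)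
  have cl: "compact (closure \<Omega>)" using \<Omega> by simp
  have cp: "continuous_on (closure \<Omega>) p1" "continuous_on (closure \<Omega>) p2" using p1 p2 by (auto simp: Cplus_def)
  have gt1: "1 < p1 x" "1 < p2 x" "1 < \<alpha> x" if "x \<in> closure \<Omega>" for x
    using p1 p2 alpha that by (auto simp: Cplus_def)
  define q where "q = (INF x\<in>closure \<Omega>. min (p1 x) (p2 x))"
  \<comment> \<open>The average of the supremum of \<open>\<beta>\<close> and \<open>q\<close> lies
    strictly between them, so it exceeds 1 even when that supremum equals 1.\<close>
  define b where "b = ((SUP x\<in>closure \<Omega>. \<beta> x) + q) / 2"
  have q: "1 < q" using beta_lo beta_hi by (simp add: q_def)
  have b: "1 < b" "b < q" "(SUP x\<in>closure \<Omega>. \<beta> x) \<le> b" using beta_lo beta_hi by (auto simp: b_def q_def)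
  have q_le: "q \<le> min (p1 x) (p2 x)" if "x \<in> closure \<Omega>" for x
    unfolding q_def
  proof (rule cINF_lower[OF _ that])
    show "bdd_below ((\<lambda>x. min (p1 x) (p2 x)) ` closure \<Omega>)"
      by (rule bdd_belowI[of _ 1]) (use gt1 in \<open>auto intro: less_imp_le\<close>)
  qed
  have \<beta>_le: "\<beta> x \<le> b" if "x \<in> closure \<Omega>" for x
  proof -
    have "bdd_above (\<beta> ` closure \<Omega>)"
      using compact_continuous_image[OF beta_cont cl] by (intro bounded_imp_bdd_above compact_imp_bounded)
    then have "\<beta> x \<le> (SUP x\<in>closure \<Omega>. \<beta> x)" using that by (rule cSUP_upper[rotated])
    then show ?thesis using b(3) by linarith
  qed
  obtain P1 where P1: "\<And>x. x \<in> closure \<Omega> \<Longrightarrow> norm (p1 x) \<le> P1"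
    using compact_imp_bounded[OF compact_continuous_image[OF cp(1) cl]] unfolding bounded_iff by blast
  obtain P2 where P2: "\<And>x. x \<in> closure \<Omega> \<Longrightarrow> norm (p2 x) \<le> P2"
    using compact_imp_bounded[OF compact_continuous_image[OF cp(2) cl]] unfolding bounded_iff by blast
  define P where "P = max P1 P2"
  have pb: "q \<le> p1 x \<and> p1 x \<le> P" "q \<le> p2 x \<and> p2 x \<le> P" if "x \<in> closure \<Omega>" for x
    using q_le[OF that] P1[OF that] P2[OF that] by (auto simp: P_def)
  interpret v1: variable_exponent \<Omega> p1 q P by unfold_locales (use \<Omega> cp pb q in auto)
  interpret v2: variable_exponent \<Omega> p2 q P by unfold_locales (use \<Omega> cp pb q in auto)
  let ?M = "lebesgue_on \<Omega>"
  have \<Omega>_cl: "x \<in> closure \<Omega>" if "x \<in> \<Omega>" for x using that closure_subset by blast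
  \<comment> \<open>The two memberships share the gradient \<open>g\<close>, while their
    approximating test functions may be different sequences.\<close>
  define X where "X u g \<longleftrightarrow> v1.W0_vmod u g \<and> v2.W0_vmod u g" for u g
  obtain K where K: "0 \<le> K" "\<And>u g. v1.W0_vmod u g \<Longrightarrow> vmod ?M (\<lambda>x. q) u \<le> ennreal K * vmod ?M (\<lambda>x. q) g"
    using v1.W0_vmod_poincare by blast
  have "AE x in lebesgue. x \<in> \<Omega> \<longrightarrow> continuous_on UNIV (f x)" using carath by (simp add: caratheodory_def)
  then obtain N where N: "N \<in> null_sets lebesgue" "{x. \<not> (x \<in> \<Omega> \<longrightarrow> continuous_on UNIV (f x))} \<subseteq> N"
    by (auto simp: eventually_ae_filter)
  \<comment> \<open>Continuity in \<open>t\<close> is given for almost every \<open>x\<close>.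
    Setting the function to 0 on the exceptional null set makes it hold everywhere and preserves the
    growth bound.\<close>
  define f' where "f' x t = (if x \<in> N then 0 else f x t)" for x t
  have f'_meas: "(\<lambda>x. f' x t) \<in> borel_measurable ?M" for t
  proof -
    have "N \<inter> \<Omega> \<in> sets ?M" using N by (auto simp: sets_restrict_space)
    then have "{x \<in> space ?M. x \<in> N} \<in> sets ?M" by (simp add: Collect_conj_eq Int_commute)
    then show ?thesis unfolding f'_def using carath by (intro measurable_If) (auto simp: caratheodory_def)
  qed
  have Xm: "u \<in> borel_measurable ?M" "g \<in> borel_measurable ?M" if "X u g" for u g
    using that by (auto simp: X_def v1.W0_vmod_def)
  have fin1: "vmod ?M p1 g < \<infinity>" and fin2: "vmod ?M p2 g < \<infinity>" if "X u g" for u g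
    using that v1.W0_vmod_finite(2) v2.W0_vmod_finite(2) by (auto simp only: X_def)
  have finq: "vmod ?M (\<lambda>x. q) g < \<infinity>" if "X u g" for u g
  proof -
    have "vmod ?M (\<lambda>x. q) g \<le> ennreal v1.\<mu> + vmod ?M p1 g"
      using pb(1)[OF \<Omega>_cl] q by (intro v1.vmod_const_le Xm[OF that] v1.p_measurable) auto
    also have "\<dots> < \<infinity>" using fin1[OF that] by simp
    finally show ?thesis .
  qed
  have finuq: "vmod ?M (\<lambda>x. q) u < \<infinity>" if "X u g" for u g
  proof -
    have "vmod ?M (\<lambda>x. q) u \<le> ennreal K * vmod ?M (\<lambda>x. q) g" using K(2) that by (auto simp: X_def)
    also have "\<dots> < \<infinity>" using finq[OF that] by (simp add: ennreal_mult_less_top)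
    finally show ?thesis .
  qed
  have int_gq: "integrable ?M (\<lambda>x. norm (g x) powr q)" and int_uq: "integrable ?M (\<lambda>x. norm (u x) powr q)" if "X u g" for u g
    by (rule integrable_if_vmod_finite[OF Xm(2)[OF that] _ finq[OF that]], simp)
       (rule integrable_if_vmod_finite[OF Xm(1)[OF that] _ finuq[OF that]], simp)
  interpret energy_space ?M p1 p2 q P K b "\<bar>C1\<bar> + \<bar>C2\<bar>" X f'
  proof (unfold_locales, goal_cases)
    case 1 show ?case by (rule v1.p_measurable)
  next
    case 2 show ?case by (rule v2.p_measurable)
  next
    case 3 show ?case by (rule q)
  next
    case (4 x) then show ?case using pb(1)[OF \<Omega>_cl] by simp
  next
    case (5 x) then show ?case using pb(2)[OF \<Omega>_cl] by simp
  next
    case 6 show ?case by (rule K)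
  next
    case 7 show ?case using \<Omega>(3) pb(1)[OF \<Omega>_cl] by force
  next
    case (8 u g) then show ?case by (rule Xm)
  next
    case (9 u g) then show ?case by (rule Xm)
  next
    case (10 u g) then show ?case using Xm fin1 by (intro integrable_if_vmod_finite v1.p_measurable) auto
  next
    case (11 u g) then show ?case using Xm fin2 by (intro integrable_if_vmod_finite v2.p_measurable) auto
  next
    case (12 u g) then show ?case using int_uq by simp
  next
    case (13 u g)
    have "ennreal (\<integral>x. norm (u x) powr q \<partial>?M) \<le> ennreal K * ennreal (\<integral>x. norm (g x) powr q \<partial>?M)"
      unfolding vmod_eq_integral[OF int_uq[OF 13], symmetric] vmod_eq_integral[OF int_gq[OF 13], symmetric]
      by (rule K(2)) (use 13 in \<open>simp add: X_def\<close>)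
    also have "\<dots> = ennreal (K * (\<integral>x. norm (g x) powr q \<partial>?M))"
      using K(1) by (intro ennreal_mult[symmetric]) auto
    finally show ?case using K(1) by (simp add: ennreal_le_iff)
  next
    case 14 show ?case by (simp add: X_def v1.W0_vmod_zero v2.W0_vmod_zero)
  next
    case (15 u g v h c) then show ?case by (simp add: X_def v1.W0_vmod_linear v2.W0_vmod_linear)
  next
    case (16 u g B)
    have "vmod ?M (\<lambda>x. q) (g n) \<le> ennreal B" for n
      unfolding vmod_eq_integral[OF int_gq[OF 16(1)]] by (rule ennreal_leI[OF 16(2)])
    then show ?case using 16(1) by (intro v1.W0_vmod_compact[of u g B]) (auto simp: X_def)
  next
    case (17 u g u0 g0)
    then show ?case unfolding X_def using v1.W0_vmod_closed[of u g u0 g0] v2.W0_vmod_closed[of u g u0 g0] by blast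
  next
    case (18 t) show ?case by (rule f'_meas)
  next
    case (19 x)
    show ?case
    proof (cases "x \<in> N")
      case False
      then have "continuous_on UNIV (f x)" using N(2) 19 by auto
      moreover have "f' x = f x" using False by (simp add: f'_def fun_eq_iff)
      ultimately show ?thesis by simp
    qed (simp add: f'_def)
  next
    case 20 show ?case by (rule b)
  next
    case 21 show ?case by (rule b)
  next
    case 22 show ?case by simp
  next
    case (23 x t)
    then have x: "x \<in> \<Omega>" by simp
    have "\<bar>f' x t\<bar> \<le> \<bar>f x t\<bar>" by (simp add: f'_def)
    also have "\<dots> \<le> (\<bar>C1\<bar> + \<bar>C2\<bar>) * (1 + \<bar>t\<bar> powr (b - 1))"
      by (rule growth_bound[OF x gt1(3)[OF \<Omega>_cl[OF x]] \<beta>_le[OF \<Omega>_cl[OF x]] b(1) growth_alpha growth_beta])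
    finally show ?case .
  qed
  obtain u g where X: "X u g" and EL: "\<And>v h. X v h \<Longrightarrow>
     integrable ?M (\<lambda>x. norm (g x) powr (p1 x - 2) * (g x \<bullet> h x)) \<and>
     integrable ?M (\<lambda>x. norm (g x) powr (p2 x - 2) * (g x \<bullet> h x)) \<and>
     integrable ?M (\<lambda>x. f' x (u x) * v x) \<and>
     (\<integral>x. norm (g x) powr (p1 x - 2) * (g x \<bullet> h x) \<partial>?M) + (\<integral>x. norm (g x) powr (p2 x - 2) * (g x \<bullet> h x) \<partial>?M)
       = (\<integral>x. f' x (u x) * v x \<partial>?M)"
    by (rule euler_lagrange) (rule that)
  have set_int: "set_integrable lebesgue \<Omega> w \<longleftrightarrow> integrable ?M w" for w :: "'a \<Rightarrow> real"
    by (simp add: set_integrable_def integrable_restrict_space)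
  have set_eq: "(LINT x:\<Omega>|lebesgue. w x) = (\<integral>x. w x \<partial>?M)" for w :: "'a \<Rightarrow> real"
    by (simp add: set_lebesgue_integral_def integral_restrict_space)
  \<comment> \<open>The way back from \<open>f'\<close> to \<open>f\<close>: the two integrands
    agree almost everywhere, so integrability and the value of the integral carry over.\<close>
  have AE_f: "AE x in lebesgue. indicator \<Omega> x *\<^sub>R (f' x (u x) * v x) = indicator \<Omega> x *\<^sub>R (f x (u x) * v x)" for v :: "'a \<Rightarrow> real"
    by (rule AE_I'[OF N(1)]) (auto simp: f'_def)
  have f_int: "set_integrable lebesgue \<Omega> (\<lambda>x. f x (u x) * v x)"
      "(LINT x:\<Omega>|lebesgue. f x (u x) * v x) = (\<integral>x. f' x (u x) * v x \<partial>?M)"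
    if "integrable ?M (\<lambda>x. f' x (u x) * v x)" for v
  proof -
    have i: "integrable lebesgue (\<lambda>x. indicator \<Omega> x *\<^sub>R (f' x (u x) * v x))"
      using that by (simp add: integrable_restrict_space)
    have m: "(\<lambda>x. indicator \<Omega> x *\<^sub>R (f x (u x) * v x)) \<in> borel_measurable lebesgue"
      by (rule borel_measurable_AE[OF borel_measurable_integrable[OF i] AE_f])
    show "set_integrable lebesgue \<Omega> (\<lambda>x. f x (u x) * v x)"
      unfolding set_integrable_def by (rule integrable_cong_AE_imp[OF i m AE_f])
    have "(LINT x:\<Omega>|lebesgue. f x (u x) * v x) = (LINT x:\<Omega>|lebesgue. f' x (u x) * v x)"
      unfolding set_lebesgue_integral_def
      by (rule integral_cong_AE[OF m borel_measurable_integrable[OF i] AE_symmetric[OF AE_f]])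
    then show "(LINT x:\<Omega>|lebesgue. f x (u x) * v x) = (\<integral>x. f' x (u x) * v x \<partial>?M)" by (simp only: set_eq)
  qed
  have "weak_solution \<Omega> p1 p2 f u"
    unfolding weak_solution_def v1.W0_iff_W0_vmod v2.W0_iff_W0_vmod set_int[symmetric]
  proof (intro exI[of _ g] conjI allI impI)
    show "v1.W0_vmod u g" "v2.W0_vmod u g" using X by (auto simp: X_def)
    fix v h assume "v1.W0_vmod v h \<and> v2.W0_vmod v h"
    then have "X v h" by (simp add: X_def)
    note E = EL[OF this]
    then have i: "integrable ?M (\<lambda>x. f' x (u x) * v x)" by blast
    show "set_integrable lebesgue \<Omega> (\<lambda>x. norm (g x) powr (p1 x - 2) * (g x \<bullet> h x))"
      "set_integrable lebesgue \<Omega> (\<lambda>x. norm (g x) powr (p2 x - 2) * (g x \<bullet> h x))"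
      using E by (auto simp: set_int)
    show "set_integrable lebesgue \<Omega> (\<lambda>x. f x (u x) * v x)" by (rule f_int(1)[OF i])
    show "(LINT x:\<Omega>|lebesgue. norm (g x) powr (p1 x - 2) * (g x \<bullet> h x))
        + (LINT x:\<Omega>|lebesgue. norm (g x) powr (p2 x - 2) * (g x \<bullet> h x))
        = (LINT x:\<Omega>|lebesgue. f x (u x) * v x)"
      using E unfolding f_int(2)[OF i] by (simp only: set_eq)
  qed
  then show ?thesis by blast
qed

end
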